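(* Let $M^n$ be a Riemannian manifold, $F^l\subset M^n$ a submanifold, and $\xi$ a normal vector field on $F^l$ which is parallel in the normal bundle of $F^l$. Then $\xi(F^l)$ is totally geodesic in $TM^n$ (with the Sasaki metric) if and only if $F^l$ is totally geodesic in $M^n$.
   Context: All manifolds and vector fields are smooth; superscripts denote dimensions. $\bar\nabla$ is the Levi-Civita connection of the metric $\bar g$ of $M^n$. Let $\pi:TM^n\to M^n$ be the projection and $K:TTM^n\to TM^n$ the connection map, given in induced coordinates $(x^a,\xi^a)$ by $K(\tilde X^a\partial_{x^a}+\tilde X^{n+a}\partial_{\xi^a})=(\tilde X^{n+a}+\bar\Gamma^a_{bc}\xi^b\tilde X^c)\partial_{x^a}$. The Sasaki metric on $TM^n$ is $g_s(\tilde X,\tilde Y)=\bar g(\pi_*\tilde X,\pi_*\tilde Y)+\bar g(K\tilde X,K\tilde Y)$. A normal vector field $\xi$ on $F^l$ is a smooth section of the normal bundle of $F^l$ in $M^n$, regarded as a map $\xi:F^l\to TM^n$; $\xi(F^l)$ is its image. It is parallel in the normal bundle if $\nabla^\perp_X\xi=(\bar\nabla_X\xi)^\perp=0$ for all $X$ tangent to $F^l$. *)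

theory Defs
  imports "HOL-Analysis.Analysis"
begin

section \<open>Smooth maps between Euclidean spaces\<close>

text \<open>To be used on open sets S only.\<close>

primrec Ck_on :: "nat \<Rightarrow> ('a::euclidean_space \<Rightarrow> 'b::real_normed_vector) \<Rightarrow> 'a set \<Rightarrow> bool" where
  "Ck_on 0 f S \<longleftrightarrow> continuous_on S f"
| "Ck_on (Suc k) f S \<longleftrightarrow>
     (\<forall>x\<in>S. f differentiable (at x)) \<and>
     (\<forall>e\<in>Basis. Ck_on k (\<lambda>x. frechet_derivative f (at x) e) S)"

definition smooth_on :: "('a::euclidean_space \<Rightarrow> 'b::real_normed_vector) \<Rightarrow> 'a set \<Rightarrow> bool" where
  "smooth_on f S \<longleftrightarrow> (\<forall>k. Ck_on k f S)"

definition partial_deriv :: "'n::finite \<Rightarrow> (real^'n \<Rightarrow> real) \<Rightarrow> real^'n \<Rightarrow> real" where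
  "partial_deriv a f x = frechet_derivative f (at x) (axis a 1)"


section \<open>Smooth manifolds\<close>

text \<open>
  A chart is a pair of its domain and its coordinate map, and a manifold is given by an atlas (not
  necessarily maximal): the point set is the union of the chart domains, the topology is the one
  that makes the charts homeomorphisms onto open sets.
\<close>

type_synonym ('p, 'n) chart = "'p set \<times> ('p \<Rightarrow> real^'n)"

type_synonym ('p, 'n) atlas = "('p, 'n) chart set"

definition pts :: "('p, 'n::finite) atlas \<Rightarrow> 'p set" where
  "pts A = \<Union>(fst ` A)"

definition charts_at :: "('p, 'n::finite) atlas \<Rightarrow> 'p \<Rightarrow> ('p, 'n) chart set" where
  "charts_at A p = {c \<in> A. p \<in> fst c}"

definition chart_inv :: "('p, 'n::finite) chart \<Rightarrow> real^'n \<Rightarrow> 'p" where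
  "chart_inv c = inv_into (fst c) (snd c)"

definition smooth_atlas :: "('p, 'n::finite) atlas \<Rightarrow> bool" where
  "smooth_atlas A \<longleftrightarrow>
     (\<forall>c\<in>A. inj_on (snd c) (fst c)) \<and>
     (\<forall>c\<in>A. \<forall>d\<in>A. open (snd c ` (fst c \<inter> fst d)) \<and>
        smooth_on (snd d \<circ> chart_inv c) (snd c ` (fst c \<inter> fst d)))"

definition atlas_topology :: "('p, 'n::finite) atlas \<Rightarrow> 'p topology" where
  "atlas_topology A =
     topology (\<lambda>S. S \<subseteq> pts A \<and> (\<forall>c\<in>A. open (snd c ` (S \<inter> fst c))))"

definition smooth_manifold :: "('p, 'n::finite) atlas \<Rightarrow> bool" where
  "smooth_manifold A \<longleftrightarrow> smooth_atlas A \<and>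
     Hausdorff_space (atlas_topology A) \<and> second_countable (atlas_topology A)"

lemma openin_atlas_topology:
  assumes "smooth_atlas A"
  shows "openin (atlas_topology A) S \<longleftrightarrow>
    S \<subseteq> pts A \<and> (\<forall>c\<in>A. open (snd c ` (S \<inter> fst c)))"
proof -
  let ?P = "\<lambda>S. S \<subseteq> pts A \<and> (\<forall>c\<in>A. open (snd c ` (S \<inter> fst c)))"
  have inj: "inj_on (snd c) (fst c)" if "c \<in> A" for c
    using assms that by (auto simp: smooth_atlas_def)
  have "istopology ?P"
    unfolding istopology_def
  proof (intro conjI allI impI)
    fix S T assume S: "?P S" and T: "?P T"
    show "S \<inter> T \<subseteq> pts A" using S by blast
    show "\<forall>c\<in>A. open (snd c ` (S \<inter> T \<inter> fst c))"
    proof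
      fix c assume c: "c \<in> A"
      have "snd c ` (S \<inter> T \<inter> fst c) = snd c ` (S \<inter> fst c) \<inter> snd c ` (T \<inter> fst c)"
        using inj[OF c] by (auto simp: inj_on_def)
      then show "open (snd c ` (S \<inter> T \<inter> fst c))" using S T c by auto
    qed
  next
    fix \<K> assume K: "\<forall>K\<in>\<K>. ?P K"
    show "\<Union>\<K> \<subseteq> pts A" using K by blast
    show "\<forall>c\<in>A. open (snd c ` (\<Union>\<K> \<inter> fst c))"
    proof
      fix c assume c: "c \<in> A"
      have "snd c ` (\<Union>\<K> \<inter> fst c) = (\<Union>K\<in>\<K>. snd c ` (K \<inter> fst c))" by blast
      then show "open (snd c ` (\<Union>\<K> \<inter> fst c))" using K c by auto
    qed
  qed
  then show ?thesis
    unfolding atlas_topology_def by (simp add: topology_inverse')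
qed

text \<open>
  Openness of the coordinate image of each \<open>W \<inter> f -` fst d\<close> is continuity of \<open>f\<close> on \<open>W\<close>.
\<close>

definition smooth_map_on ::
  "'p set \<Rightarrow> ('p, 'm::finite) atlas \<Rightarrow> ('q, 'n::finite) atlas \<Rightarrow> ('p \<Rightarrow> 'q) \<Rightarrow> bool" where
  "smooth_map_on W A B f \<longleftrightarrow>
     openin (atlas_topology A) W \<and> f ` W \<subseteq> pts B \<and>
     (\<forall>c\<in>A. \<forall>d\<in>B.
        open (snd c ` (fst c \<inter> W \<inter> f -` fst d)) \<and>
        smooth_on (snd d \<circ> f \<circ> chart_inv c) (snd c ` (fst c \<inter> W \<inter> f -` fst d)))"


section \<open>Tangent vectors and the tangent bundle\<close>

text \<open>
  A tangent vector at p is the family of its component vectors in all charts around p, subject to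
  the transformation law.  It is 0 on the remaining charts, so that a tangent vector is determined
  by its components and the vector space operations are pointwise.
\<close>

type_synonym ('p, 'n) tvec = "('p, 'n) chart \<Rightarrow> real^'n"

definition tangent_space :: "('p, 'n::finite) atlas \<Rightarrow> 'p \<Rightarrow> ('p, 'n) tvec set" where
  "tangent_space A p =
     {v. (\<forall>c\<in>charts_at A p. \<forall>d\<in>charts_at A p.
            v d = frechet_derivative (snd d \<circ> chart_inv c) (at (snd c p)) (v c)) \<and>
         (\<forall>c. c \<notin> charts_at A p \<longrightarrow> v c = 0)}"

text \<open>The coordinate vector field \<open>\<partial>\<^sub>a\<close> of the chart c.\<close>

definition coord_vec :: "('p, 'n::finite) atlas \<Rightarrow> ('p, 'n) chart \<Rightarrow> 'p \<Rightarrow> 'n \<Rightarrow> ('p, 'n) tvec" where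
  "coord_vec A c p a = (\<lambda>d. if d \<in> charts_at A p
     then frechet_derivative (snd d \<circ> chart_inv c) (at (snd c p)) (axis a 1) else 0)"

text \<open>
  Derivative of f in the direction of a tangent vector at p; by the chain rule it
  does not depend on the chart selected.
\<close>

definition dir_deriv ::
  "('p, 'n::finite) atlas \<Rightarrow> 'p \<Rightarrow> ('p, 'n) tvec \<Rightarrow> ('p \<Rightarrow> 'b::real_normed_vector) \<Rightarrow> 'b" where
  "dir_deriv A p v f =
     (let c = (SOME c. c \<in> charts_at A p)
      in frechet_derivative (f \<circ> chart_inv c) (at (snd c p)) (v c))"

definition differential ::
  "('p, 'm::finite) atlas \<Rightarrow> ('q, 'n::finite) atlas \<Rightarrow> ('p \<Rightarrow> 'q) \<Rightarrow> 'p \<Rightarrow> ('p, 'm) tvec \<Rightarrow> ('q, 'n) tvec"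
  where
  "differential A B f p v =
     (\<lambda>d. if d \<in> charts_at B (f p) then dir_deriv A p v (snd d \<circ> f) else 0)"

text \<open>
  Induced coordinates \<open>(x\<^sup>a, \<xi>\<^sup>a)\<close> on the tangent bundle; the index \<open>Inl a\<close> is the position a, the
  index \<open>Inr a\<close> is the position n + a.
\<close>

definition induced_chart ::
  "('p, 'n::finite) atlas \<Rightarrow> ('p, 'n) chart \<Rightarrow> ('p \<times> ('p, 'n) tvec, 'n + 'n) chart" where
  "induced_chart A c =
     ({(p, v). p \<in> fst c \<and> v \<in> tangent_space A p},
      \<lambda>(p, v). \<chi> i. case i of Inl a \<Rightarrow> snd c p $ a | Inr a \<Rightarrow> v c $ a)"

definition tangent_bundle ::
  "('p, 'n::finite) atlas \<Rightarrow> ('p \<times> ('p, 'n) tvec, 'n + 'n) atlas" where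
  "tangent_bundle A = induced_chart A ` A"


section \<open>Riemannian manifolds and the Levi-Civita connection\<close>

type_synonym ('p, 'n) metric = "'p \<Rightarrow> ('p, 'n) tvec \<Rightarrow> ('p, 'n) tvec \<Rightarrow> real"

definition metric_matrix ::
  "('p, 'n::finite) atlas \<Rightarrow> ('p, 'n) metric \<Rightarrow> ('p, 'n) chart \<Rightarrow> real^'n \<Rightarrow> real^'n^'n" where
  "metric_matrix A g c x =
     (let p = chart_inv c x in \<chi> a b. g p (coord_vec A c p a) (coord_vec A c p b))"

definition riemannian_manifold :: "('p, 'n::finite) atlas \<Rightarrow> ('p, 'n) metric \<Rightarrow> bool" where
  "riemannian_manifold A g \<longleftrightarrow> smooth_manifold A \<and>
     (\<forall>p\<in>pts A. \<forall>u\<in>tangent_space A p. \<forall>v\<in>tangent_space A p.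
        g p u v = g p v u \<and>
        (u \<noteq> (\<lambda>_. 0) \<longrightarrow> g p u u > 0) \<and>
        (\<forall>w\<in>tangent_space A p. \<forall>r s.
           g p (\<lambda>c. r *\<^sub>R u c + s *\<^sub>R v c) w = r * g p u w + s * g p v w)) \<and>
     (\<forall>c\<in>A. \<forall>a b. smooth_on (\<lambda>x. metric_matrix A g c x $ a $ b) (snd c ` fst c))"

text \<open>
  \<open>christoffel A g c x a b d\<close> is \<open>\<Gamma>\<^sup>a\<^sub>b\<^sub>d\<close> in the chart c at the coordinate point x.
\<close>

definition christoffel ::
  "('p, 'n::finite) atlas \<Rightarrow> ('p, 'n) metric \<Rightarrow> ('p, 'n) chart \<Rightarrow> real^'n \<Rightarrow> 'n \<Rightarrow> 'n \<Rightarrow> 'n \<Rightarrow> real"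
  where
  "christoffel A g c x a b d =
     (let G = metric_matrix A g c
      in (\<Sum>e\<in>UNIV. matrix_inv (G x) $ a $ e *
            (partial_deriv b (\<lambda>y. G y $ d $ e) x + partial_deriv d (\<lambda>y. G y $ b $ e) x
             - partial_deriv e (\<lambda>y. G y $ b $ d) x)) / 2)"


section \<open>Submanifolds\<close>

text \<open>
  A (possibly only immersed) submanifold is a subset with a smooth structure of its own for which
  the inclusion map is an immersion.  An embedded submanifold carries its usual structure.
\<close>

definition submanifold :: "('p, 'l::finite) atlas \<Rightarrow> ('p, 'n::finite) atlas \<Rightarrow> bool" where
  "submanifold B A \<longleftrightarrow> smooth_manifold B \<and>
     smooth_map_on (pts B) B A (\<lambda>p. p) \<and>
     (\<forall>p\<in>pts B. inj_on (differential B A (\<lambda>p. p) p) (tangent_space B p))"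

text \<open>The tangent space of the submanifold, as a subspace of that of the ambient manifold.\<close>

definition sub_tangent ::
  "('p, 'n::finite) atlas \<Rightarrow> ('p, 'l::finite) atlas \<Rightarrow> 'p \<Rightarrow> ('p, 'n) tvec set" where
  "sub_tangent A B p = differential B A (\<lambda>p. p) p ` tangent_space B p"

definition normal_part ::
  "('p, 'n::finite) atlas \<Rightarrow> ('p, 'n) metric \<Rightarrow> ('p, 'l::finite) atlas \<Rightarrow> 'p \<Rightarrow>
   ('p, 'n) tvec \<Rightarrow> ('p, 'n) tvec" where
  "normal_part A g B p v =
     (THE w. w \<in> tangent_space A p \<and> (\<forall>u\<in>sub_tangent A B p. g p w u = 0) \<and>
             (\<lambda>c. v c - w c) \<in> sub_tangent A B p)"

text \<open>
  Covariant derivative \<open>\<nabla>\<^sub>X Z\<close> of the ambient connection, where X is tangent to the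
  submanifold at p and Z is a section of the ambient tangent bundle over the submanifold.
\<close>

definition cov_deriv ::
  "('p, 'n::finite) atlas \<Rightarrow> ('p, 'n) metric \<Rightarrow> ('p, 'l::finite) atlas \<Rightarrow> 'p \<Rightarrow>
   ('p, 'l) tvec \<Rightarrow> ('p \<Rightarrow> ('p, 'n) tvec) \<Rightarrow> ('p, 'n) tvec" where
  "cov_deriv A g B p X Z =
     (\<lambda>c. if c \<in> charts_at A p
          then \<chi> a. dir_deriv B p X (\<lambda>q. Z q c $ a) +
                 (\<Sum>b\<in>UNIV. \<Sum>d\<in>UNIV. christoffel A g c (snd c p) a b d *
                    differential B A (\<lambda>p. p) p X c $ b * Z p c $ d)
          else 0)"

definition vector_field_on ::
  "'p set \<Rightarrow> ('p, 'n::finite) atlas \<Rightarrow> ('p \<Rightarrow> ('p, 'n) tvec) \<Rightarrow> bool" where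
  "vector_field_on W A Y \<longleftrightarrow> (\<forall>p\<in>W. Y p \<in> tangent_space A p) \<and>
     smooth_map_on W A (tangent_bundle A) (\<lambda>p. (p, Y p))"

definition second_fundamental_form ::
  "('p, 'n::finite) atlas \<Rightarrow> ('p, 'n) metric \<Rightarrow> ('p, 'l::finite) atlas \<Rightarrow> 'p \<Rightarrow>
   ('p \<Rightarrow> ('p, 'l) tvec) \<Rightarrow> ('p \<Rightarrow> ('p, 'l) tvec) \<Rightarrow> ('p, 'n) tvec" where
  "second_fundamental_form A g B p X Y =
     normal_part A g B p
       (cov_deriv A g B p (X p) (\<lambda>q. differential B A (\<lambda>p. p) q (Y q)))"

definition totally_geodesic ::
  "('p, 'n::finite) atlas \<Rightarrow> ('p, 'n) metric \<Rightarrow> ('p, 'l::finite) atlas \<Rightarrow> bool" where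
  "totally_geodesic A g B \<longleftrightarrow> submanifold B A \<and>
     (\<forall>W X Y. vector_field_on W B X \<and> vector_field_on W B Y \<longrightarrow>
        (\<forall>p\<in>W. second_fundamental_form A g B p X Y = (\<lambda>_. 0)))"


section \<open>Normal vector fields\<close>

definition normal_vector_field ::
  "('p, 'n::finite) atlas \<Rightarrow> ('p, 'n) metric \<Rightarrow> ('p, 'l::finite) atlas \<Rightarrow>
   ('p \<Rightarrow> 'p \<times> ('p, 'n) tvec) \<Rightarrow> bool" where
  "normal_vector_field A g B \<xi> \<longleftrightarrow>
     smooth_map_on (pts B) B (tangent_bundle A) \<xi> \<and>
     (\<forall>p\<in>pts B. fst (\<xi> p) = p \<and> (\<forall>u\<in>sub_tangent A B p. g p (snd (\<xi> p)) u = 0))"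

definition normal_parallel ::
  "('p, 'n::finite) atlas \<Rightarrow> ('p, 'n) metric \<Rightarrow> ('p, 'l::finite) atlas \<Rightarrow>
   ('p \<Rightarrow> 'p \<times> ('p, 'n) tvec) \<Rightarrow> bool" where
  "normal_parallel A g B \<xi> \<longleftrightarrow>
     (\<forall>p\<in>pts B. \<forall>X\<in>tangent_space B p.
        normal_part A g B p (cov_deriv A g B p X (\<lambda>q. snd (\<xi> q))) = (\<lambda>_. 0))"

text \<open>The smooth structure which an injective map f transports to its image.\<close>

definition image_atlas :: "('p \<Rightarrow> 'q) \<Rightarrow> ('p, 'n::finite) atlas \<Rightarrow> ('q, 'n) atlas" where
  "image_atlas f B = (\<lambda>c. (f ` fst c, snd c \<circ> inv_into (pts B) f)) ` B"


section \<open>The Sasaki metric\<close>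

definition connection_map ::
  "('p, 'n::finite) atlas \<Rightarrow> ('p, 'n) metric \<Rightarrow> 'p \<times> ('p, 'n) tvec \<Rightarrow>
   ('p \<times> ('p, 'n) tvec, 'n + 'n) tvec \<Rightarrow> ('p, 'n) tvec" where
  "connection_map A g z X =
     (\<lambda>c. if c \<in> charts_at A (fst z)
          then \<chi> a. X (induced_chart A c) $ Inr a +
                 (\<Sum>b\<in>UNIV. \<Sum>d\<in>UNIV. christoffel A g c (snd c (fst z)) a b d *
                    snd z c $ b * X (induced_chart A c) $ Inl d)
          else 0)"

definition sasaki_metric ::
  "('p, 'n::finite) atlas \<Rightarrow> ('p, 'n) metric \<Rightarrow> ('p \<times> ('p, 'n) tvec, 'n + 'n) metric" where
  "sasaki_metric A g z X Y =
     (let dpi = differential (tangent_bundle A) A fst z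
      in g (fst z) (dpi X) (dpi Y)
         + g (fst z) (connection_map A g z X) (connection_map A g z Y))"

end

theory Submission
  imports Defs
begin

text \<open>
  Let \<open>\<eta>(X)\<close> be the covariant derivative of \<open>\<xi>\<close> along \<open>X\<close>; it is tangent to \<open>F\<close>, as \<open>\<xi>\<close>
  is parallel in the normal bundle.  The second fundamental forms are symmetric, so it is enough to
  look at accelerations of curves.  In the Sasaki metric the acceleration of \<open>\<xi>\<close> along a curve
  \<open>x\<close> in \<open>F\<close> has vertical part \<open>\<nabla>\<eta>(x')\<close>, and its horizontal part is \<open>\<nabla>x'\<close> up to a
  curvature term that is linear in \<open>\<eta>(x')\<close>.

  If the image is totally geodesic, then \<open>\<nabla>\<eta>(x') = \<eta>(z)\<close> for some \<open>z\<close> tangent to \<open>F\<close>, so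
  differentiating \<open>g(\<eta>(x'), \<xi>) = 0\<close> gives \<open>g(\<eta>(x'), \<eta>(x')) = 0\<close>.  The curvature term then
  vanishes and \<open>\<nabla>x'\<close> is tangent to \<open>F\<close>.  If \<open>F\<close> is totally geodesic, differentiating
  \<open>g(\<xi>, Y) = 0\<close> for tangent \<open>Y\<close> gives \<open>g(\<eta>(x'), Y) = 0\<close>, so \<open>\<eta> = 0\<close> and the
  acceleration of \<open>\<xi>\<close> is the horizontal lift of a tangent vector.
\<close>

subsection \<open>Differential calculus\<close>

text \<open>All computations take place in one chart \<open>e\<close> of the submanifold and one
  chart \<open>c\<close> of the ambient manifold. There the second fundamental form vanishes exactly
  if a coordinate acceleration lies in the range of the derivative of the inclusion. The definitions
  involve choices (\<open>THE\<close> for normal parts, \<open>SOME\<close> for charts), so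
  transformation laws come before any use of coordinates.

  The Christoffel symbols of the Sasaki metric are never written out, as this would mean inverting
  its matrix. By the Koszul formula, their products with test vectors need only first derivatives of
  the metric. Test vectors are parametrised by their horizontal and vertical parts: a purely
  vertical one isolates the derivative of \<open>\<eta>\<close>, and once \<open>\<eta>\<close> is
  known to vanish, a purely horizontal one isolates the acceleration in the base.

  The two directions use \<open>\<eta>\<close> differently. From the image to the base, it is enough
  that \<open>\<eta>\<close> vanishes at one point on one velocity vector. In the converse,
  \<open>\<eta>\<close> gets differentiated, so it has to vanish on an open set.\<close>

abbreviation fd :: "('a::real_normed_vector \<Rightarrow> 'b::real_normed_vector) \<Rightarrow> 'a \<Rightarrow> 'a \<Rightarrow> 'b" where
  "fd f x v \<equiv> frechet_derivative f (at x) v"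

lemma fd_eqI: "(f has_derivative f') (at x) \<Longrightarrow> fd f x = f'"
  by (simp add: frechet_derivative_at[symmetric])

lemma fd_works: "f differentiable (at x) \<Longrightarrow> (f has_derivative fd f x) (at x)"
  by (simp add: frechet_derivative_works[symmetric])

lemma fd_linear: "f differentiable (at x) \<Longrightarrow> linear (fd f x)"
  using fd_works has_derivative_linear by blast

lemma fd_cong:
  assumes "open S" "x \<in> S" "\<And>y. y \<in> S \<Longrightarrow> f y = g y"
  shows "fd f x = fd g x"
proof -
  have "(f has_derivative f') (at x) \<longleftrightarrow> (g has_derivative f') (at x)" for f'
    using has_derivative_transform_within_open[of f f' x UNIV S g]
      has_derivative_transform_within_open[of g f' x UNIV S f] assms by auto
  then show ?thesis unfolding frechet_derivative_def by presburger
qed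

lemma differentiable_cong_open:
  assumes "open S" "x \<in> S" "\<And>y. y \<in> S \<Longrightarrow> f y = g y" "f differentiable (at x)"
  shows "g differentiable (at x)"
  using assms has_derivative_transform_within_open[of f _ x UNIV S g]
  unfolding differentiable_def by auto

lemma linear_basis_expansion:
  fixes f :: "'a::euclidean_space \<Rightarrow> 'b::real_vector"
  assumes "linear f"
  shows "f x = (\<Sum>b\<in>Basis. (x \<bullet> b) *\<^sub>R f b)"
proof -
  have "f x = f (\<Sum>b\<in>Basis. (x \<bullet> b) *\<^sub>R b)" by (simp add: euclidean_representation)
  also have "\<dots> = (\<Sum>b\<in>Basis. (x \<bullet> b) *\<^sub>R f b)"
    by (simp add: linear_sum[OF assms] linear_cmul[OF assms])
  finally show ?thesis .
qed

section \<open>Closure of C^k and smooth maps under algebraic operations and composition\<close>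

lemma Ck_on_cong:
  assumes "open S" "\<And>x. x \<in> S \<Longrightarrow> f x = g x" "Ck_on k f S"
  shows "Ck_on k g S"
  using assms(2,3)
proof (induction k arbitrary: f g)
  case 0
  then show ?case by (metis Ck_on.simps(1) continuous_on_cong)
next
  case (Suc k)
  show ?case unfolding Ck_on.simps
  proof (intro conjI ballI)
    fix x assume "x \<in> S"
    then show "g differentiable (at x)"
      using Suc.prems differentiable_cong_open[OF assms(1) \<open>x \<in> S\<close>, of f g] by auto
  next
    fix e :: 'a assume e: "e \<in> Basis"
    show "Ck_on k (\<lambda>x. fd g x e) S"
    proof (rule Suc.IH[of "\<lambda>x. fd f x e"])
      show "Ck_on k (\<lambda>x. fd f x e) S" using Suc.prems e by auto
      show "fd f x e = fd g x e" if "x \<in> S" for x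
        using fd_cong[OF assms(1) that, of f g] Suc.prems by auto
    qed
  qed
qed

lemma Ck_on_imp_continuous: "Ck_on k f S \<Longrightarrow> continuous_on S f"
  by (cases k) (auto intro!: continuous_at_imp_continuous_on differentiable_imp_continuous_within)

lemma Ck_on_mono: "Ck_on (Suc k) f S \<Longrightarrow> Ck_on k f S"
proof (induction k arbitrary: f)
  case 0
  then show ?case using Ck_on_imp_continuous[OF 0] by simp
next
  case (Suc k)
  have "Ck_on k (\<lambda>x. fd f x e) S" if "e \<in> Basis" for e
    using Suc.prems that by (intro Suc.IH) (subst (asm) Ck_on.simps(2), blast)
  then show ?case using Suc.prems by simp
qed

lemma Ck_on_subset: "Ck_on k f S \<Longrightarrow> T \<subseteq> S \<Longrightarrow> Ck_on k f T"
  by (induction k arbitrary: f) (auto intro: continuous_on_subset)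

lemma Ck_on_const: "Ck_on k (\<lambda>x. c) S"
  by (induction k arbitrary: c) (auto simp: fd_eqI[OF has_derivative_const])

lemma Ck_on_linear:
  assumes "bounded_linear f"
  shows "Ck_on k f S"
proof (cases k)
  case 0
  then show ?thesis using linear_continuous_on[OF assms] by simp
next
  case (Suc m)
  have h: "(f has_derivative f) (at x)" for x using assms by (rule bounded_linear_imp_has_derivative)
  then have "fd f x = f" for x by (rule fd_eqI)
  then show ?thesis using Suc Ck_on_const bounded_linear_imp_differentiable[OF assms] by auto
qed

lemma Ck_on_add:
  assumes "open S" "Ck_on k f S" "Ck_on k g S"
  shows "Ck_on k (\<lambda>x. f x + g x) S"
  using assms(2,3)
proof (induction k arbitrary: f g)
  case 0
  then show ?case by (simp add: continuous_on_add)
next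
  case (Suc k)
  have d: "fd (\<lambda>x. f x + g x) x = (\<lambda>v. fd f x v + fd g x v)" if "x \<in> S" for x
    using Suc.prems that by (intro fd_eqI has_derivative_add fd_works) auto
  have "Ck_on k (\<lambda>x. fd (\<lambda>x. f x + g x) x e) S" if "e \<in> Basis" for e
  proof (rule Ck_on_cong[OF assms(1)])
    show "Ck_on k (\<lambda>x. fd f x e + fd g x e) S" using Suc.prems that by (intro Suc.IH) auto
  qed (simp add: d)
  then show ?case using Suc.prems by auto
qed

lemma Ck_on_sum:
  assumes "open S" "\<And>i. i \<in> I \<Longrightarrow> Ck_on k (f i) S"
  shows "Ck_on k (\<lambda>x. \<Sum>i\<in>I. f i x) S"
proof (cases "finite I")
  case True
  then show ?thesis using assms(2)
    by (induction I rule: finite_induct) (auto intro: Ck_on_const Ck_on_add[OF assms(1)])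
qed (simp add: Ck_on_const)

lemma Ck_on_scaleR:
  assumes "open S" "Ck_on k r S" "Ck_on k g S"
  shows "Ck_on k (\<lambda>x. r x *\<^sub>R g x) S"
  using assms(2,3)
proof (induction k arbitrary: r g)
  case 0
  then show ?case by (simp add: continuous_on_scaleR)
next
  case (Suc k)
  have dr: "r differentiable (at x)" and dg: "g differentiable (at x)" if "x \<in> S" for x
    using Suc.prems that by auto
  have h: "((\<lambda>x. r x *\<^sub>R g x) has_derivative (\<lambda>v. r x *\<^sub>R fd g x v + fd r x v *\<^sub>R g x)) (at x)"
    if "x \<in> S" for x
    by (rule has_derivative_scaleR[OF fd_works[OF dr[OF that]] fd_works[OF dg[OF that]]])
  have "Ck_on k (\<lambda>x. fd (\<lambda>x. r x *\<^sub>R g x) x e) S" if "e \<in> Basis" for e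
  proof (rule Ck_on_cong[OF assms(1)])
    show "Ck_on k (\<lambda>x. r x *\<^sub>R fd g x e + fd r x e *\<^sub>R g x) S"
      using Suc.prems that Ck_on_mono[OF Suc.prems(1)] Ck_on_mono[OF Suc.prems(2)]
      by (intro Ck_on_add assms(1) Suc.IH) auto
    show "r x *\<^sub>R fd g x e + fd r x e *\<^sub>R g x = fd (\<lambda>x. r x *\<^sub>R g x) x e" if "x \<in> S" for x
      by (simp add: fd_eqI[OF h[OF that]])
  qed
  then show ?case using h by (auto simp: differentiable_def)
qed

lemma Ck_on_bounded_linear:
  assumes "open S" "bounded_linear L" "Ck_on k f S"
  shows "Ck_on k (\<lambda>x. L (f x)) S"
  using assms(3)
proof (induction k arbitrary: f)
  case 0
  then show ?case using bounded_linear.continuous_on[OF assms(2)] by simp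
next
  case (Suc k)
  have h: "((\<lambda>x. L (f x)) has_derivative (\<lambda>v. L (fd f x v))) (at x)" if "x \<in> S" for x
    using Suc.prems that by (intro bounded_linear.has_derivative[OF assms(2)] fd_works) auto
  have "Ck_on k (\<lambda>x. fd (\<lambda>x. L (f x)) x e) S" if "e \<in> Basis" for e
  proof (rule Ck_on_cong[OF assms(1)])
    show "Ck_on k (\<lambda>x. L (fd f x e)) S" using Suc.prems that by (intro Suc.IH) auto
  qed (simp add: fd_eqI[OF h])
  then show ?case using h by (auto simp: differentiable_def)
qed

text \<open>By the chain rule, a partial derivative of the composite is a sum of components of a
  partial derivative of \<open>f\<close> times partial derivatives of \<open>g\<close> taken along
  \<open>f\<close>. Only \<open>g\<close> varies in the induction: its partial derivatives lose one
  order, and \<open>f\<close> is used at the lower order through \<open>Ck_on_mono\<close>.\<close>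

lemma Ck_on_compose:
  fixes f :: "'a::euclidean_space \<Rightarrow> 'b::euclidean_space" and g :: "'b \<Rightarrow> 'c::real_normed_vector"
  assumes "open S" "open T" "f ` S \<subseteq> T" "Ck_on k f S" "Ck_on k g T"
  shows "Ck_on k (\<lambda>x. g (f x)) S"
  using assms(4,5)
proof (induction k arbitrary: g)
  case 0
  then show ?case using continuous_on_compose2[of T g S f] assms(3) by simp
next
  case (Suc k)
  have fT: "f x \<in> T" if "x \<in> S" for x using assms(3) that by blast
  have df: "f differentiable (at x)" if "x \<in> S" for x using Suc.prems that by auto
  have dg: "g differentiable (at x)" if "x \<in> T" for x using Suc.prems that by auto
  have h: "((\<lambda>x. g (f x)) has_derivative (\<lambda>v. fd g (f x) (fd f x v))) (at x)" if "x \<in> S" for x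
    using has_derivative_compose[OF fd_works[OF df[OF that]] fd_works[OF dg[OF fT[OF that]]]] .
  have "Ck_on k (\<lambda>x. fd (\<lambda>x. g (f x)) x e) S" if e: "e \<in> Basis" for e
  proof (rule Ck_on_cong[OF assms(1)])
    have "Ck_on k (\<lambda>x. fd f x e) S" using Suc.prems(1) e by auto
    from Ck_on_bounded_linear[OF assms(1) bounded_linear_inner_left this]
    have 1: "Ck_on k (\<lambda>x. fd f x e \<bullet> b) S" for b .
    have 2: "Ck_on k (\<lambda>x. fd g (f x) b) S" if "b \<in> Basis" for b
      using Suc.prems(2) that by (intro Suc.IH Ck_on_mono[OF Suc.prems(1)]) auto
    show "Ck_on k (\<lambda>x. \<Sum>b\<in>Basis. (fd f x e \<bullet> b) *\<^sub>R fd g (f x) b) S"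
      by (intro Ck_on_sum Ck_on_scaleR assms(1) 1 2)
    show "(\<Sum>b\<in>Basis. (fd f x e \<bullet> b) *\<^sub>R fd g (f x) b) = fd (\<lambda>x. g (f x)) x e" if "x \<in> S" for x
      using linear_basis_expansion[OF fd_linear[OF dg[OF fT[OF that]]], of "fd f x e"]
      by (simp add: fd_eqI[OF h[OF that]])
  qed
  then show ?case using h by (auto simp: differentiable_def)
qed

lemma smooth_on_cong:
  "open S \<Longrightarrow> (\<And>x. x \<in> S \<Longrightarrow> f x = g x) \<Longrightarrow> smooth_on f S \<Longrightarrow> smooth_on g S"
  unfolding smooth_on_def using Ck_on_cong by blast

lemma smooth_on_subset: "smooth_on f S \<Longrightarrow> T \<subseteq> S \<Longrightarrow> smooth_on f T"
  unfolding smooth_on_def using Ck_on_subset by blast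

lemma smooth_on_const: "smooth_on (\<lambda>x. c) S"
  unfolding smooth_on_def using Ck_on_const by blast

lemma smooth_on_linear: "bounded_linear f \<Longrightarrow> smooth_on f S"
  unfolding smooth_on_def using Ck_on_linear by blast

lemma smooth_on_add:
  "open S \<Longrightarrow> smooth_on f S \<Longrightarrow> smooth_on g S \<Longrightarrow> smooth_on (\<lambda>x. f x + g x) S"
  unfolding smooth_on_def using Ck_on_add by blast

lemma smooth_on_sum:
  "open S \<Longrightarrow> (\<And>i. i \<in> I \<Longrightarrow> smooth_on (f i) S) \<Longrightarrow> smooth_on (\<lambda>x. \<Sum>i\<in>I. f i x) S"
  unfolding smooth_on_def by (intro allI Ck_on_sum) auto

lemma smooth_on_scaleR:
  "open S \<Longrightarrow> smooth_on r S \<Longrightarrow> smooth_on g S \<Longrightarrow> smooth_on (\<lambda>x. r x *\<^sub>R g x) S"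
  unfolding smooth_on_def using Ck_on_scaleR by blast

lemma smooth_on_bounded_linear:
  "open S \<Longrightarrow> bounded_linear L \<Longrightarrow> smooth_on f S \<Longrightarrow> smooth_on (\<lambda>x. L (f x)) S"
  unfolding smooth_on_def using Ck_on_bounded_linear by blast

lemma smooth_on_compose:
  fixes f :: "'a::euclidean_space \<Rightarrow> 'b::euclidean_space" and g :: "'b \<Rightarrow> 'c::real_normed_vector"
  shows "open S \<Longrightarrow> open T \<Longrightarrow> f ` S \<subseteq> T \<Longrightarrow> smooth_on f S \<Longrightarrow> smooth_on g T
    \<Longrightarrow> smooth_on (\<lambda>x. g (f x)) S"
  unfolding smooth_on_def using Ck_on_compose by blast

lemma smooth_on_differentiable: "smooth_on f S \<Longrightarrow> x \<in> S \<Longrightarrow> f differentiable (at x)"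
  unfolding smooth_on_def by (metis Ck_on.simps(2))

lemma smooth_on_continuous: "smooth_on f S \<Longrightarrow> continuous_on S f"
  unfolding smooth_on_def using Ck_on.simps(1) by blast

lemma smooth_on_fd:
  fixes f :: "'a::euclidean_space \<Rightarrow> 'b::real_normed_vector"
  assumes "open S" "smooth_on f S"
  shows "smooth_on (\<lambda>x. fd f x v) S"
proof (rule smooth_on_cong[OF assms(1)])
  have "smooth_on (\<lambda>x. fd f x b) S" if "b \<in> Basis" for b
    using assms(2) that unfolding smooth_on_def by (metis Ck_on.simps(2))
  then show "smooth_on (\<lambda>x. \<Sum>b\<in>Basis. (v \<bullet> b) *\<^sub>R fd f x b) S"
    by (intro smooth_on_sum smooth_on_scaleR smooth_on_const assms(1))
  show "(\<Sum>b\<in>Basis. (v \<bullet> b) *\<^sub>R fd f x b) = fd f x v" if "x \<in> S" for x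
    using linear_basis_expansion[OF fd_linear[OF smooth_on_differentiable[OF assms(2) that]], of v]
    by simp
qed

text \<open>Base point and vector both move; expanding the vector in the basis leaves fixed
  directions with smooth coefficients. The fibre components of tangent bundle transitions and of
  coordinate fields have this form.\<close>

lemma smooth_on_fd_apply:
  fixes f :: "'a::euclidean_space \<Rightarrow> 'b::real_normed_vector" and w :: "'c::euclidean_space \<Rightarrow> 'a"
  assumes "open S" "open T" "smooth_on f S" "h ` T \<subseteq> S" "smooth_on h T" "smooth_on w T"
  shows "smooth_on (\<lambda>x. fd f (h x) (w x)) T"
proof (rule smooth_on_cong[OF assms(2)])
  have "smooth_on (\<lambda>x. fd f (h x) b) T" for b
    by (rule smooth_on_compose[OF assms(2,1,4,5) smooth_on_fd[OF assms(1,3)]])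
  then show "smooth_on (\<lambda>x. \<Sum>b\<in>Basis. (w x \<bullet> b) *\<^sub>R fd f (h x) b) T"
    by (intro smooth_on_sum smooth_on_scaleR assms smooth_on_bounded_linear[OF _ bounded_linear_inner_left])
  show "(\<Sum>b\<in>Basis. (w x \<bullet> b) *\<^sub>R fd f (h x) b) = fd f (h x) (w x)" if "x \<in> T" for x
  proof -
    have "h x \<in> S" using assms(4) that by blast
    from linear_basis_expansion[OF fd_linear[OF smooth_on_differentiable[OF assms(3) this]], of "w x"]
    show ?thesis by simp
  qed
qed

text \<open>In finite dimension it suffices to know the derivative for each fixed vector
  \<open>u\<close>: after expanding \<open>a y\<close> in the basis, the product rule applies
  termwise.\<close>

lemma has_derivative_linear_family:
  fixes L :: "'x::real_normed_vector \<Rightarrow> 'a::euclidean_space \<Rightarrow> 'c::real_normed_vector"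
  assumes S: "open S" "x \<in> S" and lin: "\<And>y. y \<in> S \<Longrightarrow> linear (L y)"
    and d: "\<And>u. ((\<lambda>y. L y u) has_derivative (\<lambda>v. L' v u)) (at x)"
    and a: "(a has_derivative a') (at x)"
  shows "((\<lambda>y. L y (a y)) has_derivative (\<lambda>v. L' v (a x) + L x (a' v))) (at x)"
proof -
  have r: "L y w = (\<Sum>b\<in>Basis. (w \<bullet> b) *\<^sub>R L y b)" if "y \<in> S" for y w
    by (rule linear_basis_expansion[OF lin[OF that]])
  \<comment> \<open>Linearity of \<open>L' v\<close> in its vector argument is inherited from
    \<open>L y\<close>, by uniqueness of the derivative.\<close>
  have 0: "(\<Sum>b\<in>Basis. (u \<bullet> b) *\<^sub>R L' v b) = L' v u" for u v
  proof -
    have "((\<lambda>y. \<Sum>b\<in>Basis. (u \<bullet> b) *\<^sub>R L y b) has_derivative (\<lambda>v. \<Sum>b\<in>Basis. (u \<bullet> b) *\<^sub>R L' v b)) (at x)"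
      by (auto intro!: derivative_eq_intros d)
    then have "((\<lambda>y. L y u) has_derivative (\<lambda>v. \<Sum>b\<in>Basis. (u \<bullet> b) *\<^sub>R L' v b)) (at x)"
      by (rule has_derivative_transform_within_open[OF _ S]) (simp add: r[symmetric])
    from has_derivative_unique[OF this d] show ?thesis by metis
  qed
  have "((\<lambda>y. \<Sum>b\<in>Basis. (a y \<bullet> b) *\<^sub>R L y b) has_derivative
     (\<lambda>v. \<Sum>b\<in>Basis. (a x \<bullet> b) *\<^sub>R L' v b + (a' v \<bullet> b) *\<^sub>R L x b)) (at x)"
    by (intro has_derivative_sum has_derivative_scaleR d has_derivative_inner_left a)
  then have "((\<lambda>y. L y (a y)) has_derivative
     (\<lambda>v. \<Sum>b\<in>Basis. (a x \<bullet> b) *\<^sub>R L' v b + (a' v \<bullet> b) *\<^sub>R L x b)) (at x)"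
    by (rule has_derivative_transform_within_open[OF _ S]) (simp add: r[symmetric])
  then show ?thesis by (simp add: sum.distrib 0 r[OF S(2), symmetric])
qed

text \<open>The linear case is applied to one slot after the other. The metric and the Christoffel
  symbols are both treated this way, as bilinear maps that depend on the point.\<close>

lemma has_derivative_bilinear_family:
  fixes B :: "'x::real_normed_vector \<Rightarrow> 'a::euclidean_space \<Rightarrow> 'b::euclidean_space \<Rightarrow> 'c::real_normed_vector"
    and h :: "'y::real_normed_vector \<Rightarrow> 'x"
  assumes S: "open S" "h x \<in> S" and lin1: "\<And>y w. y \<in> S \<Longrightarrow> linear (\<lambda>u. B y u w)"
    and lin2: "\<And>y u. y \<in> S \<Longrightarrow> linear (B y u)"
    and d: "\<And>u w. (\<lambda>y. B y u w) differentiable (at (h x))"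
    and h: "(h has_derivative h') (at x)"
    and a: "(a has_derivative a') (at x)" and b: "(b has_derivative b') (at x)"
  shows "((\<lambda>y. B (h y) (a y) (b y)) has_derivative
    (\<lambda>v. fd (\<lambda>y. B y (a x) (b x)) (h x) (h' v) + B (h x) (a' v) (b x) + B (h x) (a x) (b' v))) (at x)"
proof -
  from h have "isCont h x" by (rule has_derivative_continuous)
  then obtain T where T: "open T" "x \<in> T" "\<And>y. y \<in> T \<Longrightarrow> h y \<in> S"
    using S unfolding continuous_at_open by meson
  have d0: "((\<lambda>y. B (h y) u w) has_derivative (\<lambda>v. fd (\<lambda>y. B y u w) (h x) (h' v))) (at x)" for u w
    using has_derivative_compose[OF h fd_works[OF d]] .
  have d1: "((\<lambda>y. B (h y) u (b y)) has_derivative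
      (\<lambda>v. fd (\<lambda>y. B y u (b x)) (h x) (h' v) + B (h x) u (b' v))) (at x)" for u
    by (rule has_derivative_linear_family[OF T(1,2) _ d0 b]) (rule lin2[OF T(3)])
  have "((\<lambda>y. B (h y) (a y) (b y)) has_derivative
    (\<lambda>v. (fd (\<lambda>y. B y (a x) (b x)) (h x) (h' v) + B (h x) (a x) (b' v)) + B (h x) (a' v) (b x))) (at x)"
    by (rule has_derivative_linear_family[OF T(1,2) _ d1 a]) (rule lin1[OF T(3)])
  then show ?thesis by (simp add: algebra_simps)
qed

lemma has_derivative_fd_apply:
  fixes f :: "'a::euclidean_space \<Rightarrow> 'b::real_normed_vector" and w :: "'c::real_normed_vector \<Rightarrow> 'a"
  assumes S: "open S" "h x \<in> S" and f: "smooth_on f S"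
    and h: "(h has_derivative h') (at x)" and w: "(w has_derivative w') (at x)"
  shows "((\<lambda>y. fd f (h y) (w y)) has_derivative
     (\<lambda>v. fd (\<lambda>y. fd f y (w x)) (h x) (h' v) + fd f (h x) (w' v))) (at x)"
proof -
  from h have "isCont h x" by (rule has_derivative_continuous)
  then obtain T where T: "open T" "x \<in> T" "\<And>y. y \<in> T \<Longrightarrow> h y \<in> S"
    using S unfolding continuous_at_open by meson
  have d0: "((\<lambda>y. fd f (h y) u) has_derivative (\<lambda>v. fd (\<lambda>y. fd f y u) (h x) (h' v))) (at x)" for u
    using has_derivative_compose[OF h fd_works[OF smooth_on_differentiable[OF smooth_on_fd[OF S(1) f] S(2)]]] .
  show ?thesis
    by (rule has_derivative_linear_family[OF T(1,2) _ d0 w])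
      (rule fd_linear[OF smooth_on_differentiable[OF f T(3)]])
qed

text \<open>
  Two applications of the mean value theorem to the second difference
  \<open>f (x + tu + tv) - f (x + tu) - f (x + tv) + f x\<close>.
\<close>

lemma second_difference_mvt:
  fixes f :: "'a::euclidean_space \<Rightarrow> real"
  assumes S: "open S" and f: "smooth_on f S" and t: "0 < t"
    and sub: "\<And>r s. 0 \<le> r \<Longrightarrow> r \<le> t \<Longrightarrow> 0 \<le> s \<Longrightarrow> s \<le> t \<Longrightarrow> x + r *\<^sub>R u + s *\<^sub>R v \<in> S"
  shows "\<exists>r s. 0 \<le> r \<and> r \<le> t \<and> 0 \<le> s \<and> s \<le> t \<and>
    f (x + t *\<^sub>R u + t *\<^sub>R v) - f (x + t *\<^sub>R u) - f (x + t *\<^sub>R v) + f x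
      = t * t * fd (\<lambda>y. fd f y u) (x + r *\<^sub>R u + s *\<^sub>R v) v"
proof -
  have df: "(f has_derivative fd f y) (at y)" if "y \<in> S" for y
    by (rule fd_works[OF smooth_on_differentiable[OF f that]])
  have df2: "((\<lambda>y. fd f y u) has_derivative fd (\<lambda>y. fd f y u) y) (at y)" if "y \<in> S" for y
    by (rule fd_works[OF smooth_on_differentiable[OF smooth_on_fd[OF S f] that]])
  have 1: "((\<lambda>r. f (x + r *\<^sub>R u + s *\<^sub>R v)) has_real_derivative fd f (x + r *\<^sub>R u + s *\<^sub>R v) u) (at r)"
    if "0 \<le> r" "r \<le> t" "0 \<le> s" "s \<le> t" for r s
  proof -
    have "((\<lambda>r. x + r *\<^sub>R u + s *\<^sub>R v) has_derivative (\<lambda>h. h *\<^sub>R u)) (at r)"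
      by (auto intro!: derivative_eq_intros)
    from has_derivative_compose[OF this df[OF sub[OF that]]]
    show ?thesis unfolding has_field_derivative_def
      using linear_cmul[OF has_derivative_linear[OF df[OF sub[OF that]]]]
      by (simp add: mult_commute_abs)
  qed
  have 2: "((\<lambda>s. fd f (x + r *\<^sub>R u + s *\<^sub>R v) u) has_real_derivative
      fd (\<lambda>y. fd f y u) (x + r *\<^sub>R u + s *\<^sub>R v) v) (at s)"
    if "0 \<le> r" "r \<le> t" "0 \<le> s" "s \<le> t" for r s
  proof -
    have "((\<lambda>s. x + r *\<^sub>R u + s *\<^sub>R v) has_derivative (\<lambda>h. h *\<^sub>R v)) (at s)"
      by (auto intro!: derivative_eq_intros)
    from has_derivative_compose[OF this df2[OF sub[OF that]]]
    show ?thesis unfolding has_field_derivative_def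
      using linear_cmul[OF has_derivative_linear[OF df2[OF sub[OF that]]]]
      by (simp add: mult_commute_abs)
  qed
  have "\<exists>r>0. r < t \<and> (f (x + t *\<^sub>R u + t *\<^sub>R v) - f (x + t *\<^sub>R u + 0 *\<^sub>R v))
      - (f (x + 0 *\<^sub>R u + t *\<^sub>R v) - f (x + 0 *\<^sub>R u + 0 *\<^sub>R v))
     = (t - 0) * (fd f (x + r *\<^sub>R u + t *\<^sub>R v) u - fd f (x + r *\<^sub>R u + 0 *\<^sub>R v) u)"
    using t by (intro MVT2 DERIV_diff 1) auto
  then obtain r where r: "0 < r" "r < t"
    "(f (x + t *\<^sub>R u + t *\<^sub>R v) - f (x + t *\<^sub>R u + 0 *\<^sub>R v))
      - (f (x + 0 *\<^sub>R u + t *\<^sub>R v) - f (x + 0 *\<^sub>R u + 0 *\<^sub>R v))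
     = (t - 0) * (fd f (x + r *\<^sub>R u + t *\<^sub>R v) u - fd f (x + r *\<^sub>R u + 0 *\<^sub>R v) u)" by blast
  have "\<exists>s>0. s < t \<and> fd f (x + r *\<^sub>R u + t *\<^sub>R v) u - fd f (x + r *\<^sub>R u + 0 *\<^sub>R v) u
     = (t - 0) * fd (\<lambda>y. fd f y u) (x + r *\<^sub>R u + s *\<^sub>R v) v"
    using t r by (intro MVT2 2) auto
  then obtain s where s: "0 < s" "s < t" "fd f (x + r *\<^sub>R u + t *\<^sub>R v) u - fd f (x + r *\<^sub>R u + 0 *\<^sub>R v) u
     = (t - 0) * fd (\<lambda>y. fd f y u) (x + r *\<^sub>R u + s *\<^sub>R v) v" by blast
  show ?thesis using r s by (intro exI[of _ r] exI[of _ s]) (auto simp: algebra_simps)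
qed

text \<open>The second difference is symmetric in \<open>u\<close> and \<open>v\<close>, and equals
  \<open>t * t\<close> times either iterated derivative at suitable points near \<open>x\<close>. If
  the two differed at \<open>x\<close>, continuity would keep them apart at those points.\<close>

lemma second_derivative_symmetric_real:
  fixes f :: "'a::euclidean_space \<Rightarrow> real"
  assumes S: "open S" "x \<in> S" and f: "smooth_on f S"
  shows "fd (\<lambda>y. fd f y u) x v = fd (\<lambda>y. fd f y v) x u"
proof (rule ccontr)
  let ?A = "\<lambda>y. fd (\<lambda>y. fd f y u) y v" and ?B = "\<lambda>y. fd (\<lambda>y. fd f y v) y u"
  assume "?A x \<noteq> ?B x"
  \<comment> \<open>Half the gap, so that two errors below \<open>e\<close> cannot bridge
    it.\<close>
  define e where "e = \<bar>?A x - ?B x\<bar> / 2"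
  have e: "e > 0" using \<open>?A x \<noteq> ?B x\<close> by (simp add: e_def)
  have "smooth_on ?A S" "smooth_on ?B S" by (intro smooth_on_fd S f)+
  then have "isCont ?A x" "isCont ?B x"
    using S smooth_on_continuous continuous_on_eq_continuous_at by blast+
  then obtain d1 d2 where d1: "d1 > 0" "\<And>y. dist y x < d1 \<Longrightarrow> dist (?A y) (?A x) < e"
    and d2: "d2 > 0" "\<And>y. dist y x < d2 \<Longrightarrow> dist (?B y) (?B x) < e"
    unfolding continuous_at_eps_delta dist_norm using e by blast
  obtain d3 where d3: "d3 > 0" "ball x d3 \<subseteq> S" using S open_contains_ball by blast
  define d where "d = min d1 (min d2 d3)"
  have d: "d > 0" using d1 d2 d3 by (simp add: d_def)
  \<comment> \<open>The summand 1 keeps \<open>N\<close> positive for \<open>u = v = 0\<close>. With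
    \<open>t\<close> chosen below, the parallelogram stays within distance \<open>d / 2\<close> of
    \<open>x\<close>.\<close>
  define N where "N = norm u + norm v + 1"
  have N: "N > 0" by (simp add: N_def add_nonneg_pos)
  define t where "t = d / (2 * N)"
  have t: "t > 0" using d N by (simp add: t_def)
  have near: "dist (x + r *\<^sub>R u + s *\<^sub>R v) x < d" if "0 \<le> r" "r \<le> t" "0 \<le> s" "s \<le> t" for r s
  proof -
    have "norm (r *\<^sub>R u + s *\<^sub>R v) \<le> norm (r *\<^sub>R u) + norm (s *\<^sub>R v)" by (rule norm_triangle_ineq)
    also have "\<dots> \<le> t * norm u + t * norm v" using that by (intro add_mono) (auto intro: mult_right_mono)
    also have "\<dots> \<le> t * N" using t by (simp add: N_def algebra_simps)
    also have "\<dots> = d / 2" using N by (simp add: t_def)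
    finally show ?thesis using d by (simp add: dist_norm algebra_simps)
  qed
  then have inS: "x + r *\<^sub>R u + s *\<^sub>R v \<in> S" if "0 \<le> r" "r \<le> t" "0 \<le> s" "s \<le> t" for r s
    using that d3 by (fastforce simp: d_def dist_commute)
  obtain r s where rs: "0 \<le> r" "r \<le> t" "0 \<le> s" "s \<le> t"
    "f (x + t *\<^sub>R u + t *\<^sub>R v) - f (x + t *\<^sub>R u) - f (x + t *\<^sub>R v) + f x = t * t * ?A (x + r *\<^sub>R u + s *\<^sub>R v)"
    using second_difference_mvt[OF S(1) f t inS] by blast
  have inS': "x + r *\<^sub>R v + s *\<^sub>R u \<in> S" if "0 \<le> r" "r \<le> t" "0 \<le> s" "s \<le> t" for r s
    using inS[of s r] that by (simp add: ac_simps)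
  obtain r' s' where rs': "0 \<le> r'" "r' \<le> t" "0 \<le> s'" "s' \<le> t"
    "f (x + t *\<^sub>R v + t *\<^sub>R u) - f (x + t *\<^sub>R v) - f (x + t *\<^sub>R u) + f x = t * t * ?B (x + r' *\<^sub>R v + s' *\<^sub>R u)"
    using second_difference_mvt[OF S(1) f t inS'] by blast
  have "t * t * ?A (x + r *\<^sub>R u + s *\<^sub>R v) = t * t * ?B (x + r' *\<^sub>R v + s' *\<^sub>R u)"
    using rs(5) rs'(5) by (simp add: algebra_simps)
  then have eq: "?A (x + r *\<^sub>R u + s *\<^sub>R v) = ?B (x + s' *\<^sub>R u + r' *\<^sub>R v)" using t by (simp add: ac_simps)
  have "dist (?A (x + r *\<^sub>R u + s *\<^sub>R v)) (?A x) < e"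
    using near[OF rs(1-4)] by (intro d1) (simp add: d_def)
  moreover have "dist (?B (x + s' *\<^sub>R u + r' *\<^sub>R v)) (?B x) < e"
    using near[OF rs'(3,4,1,2)] by (intro d2) (simp add: d_def)
  ultimately have "\<bar>?A x - ?B x\<bar> < 2 * e" using eq by (simp add: dist_real_def)
  then show False by (simp add: e_def)
qed

text \<open>Pairing with a basis vector commutes with both derivatives, which leaves the real-valued
  case.\<close>

lemma second_derivative_symmetric:
  fixes f :: "'a::euclidean_space \<Rightarrow> 'b::euclidean_space"
  assumes S: "open S" "x \<in> S" and f: "smooth_on f S"
  shows "fd (\<lambda>y. fd f y u) x v = fd (\<lambda>y. fd f y v) x u"
proof (rule euclidean_eqI)
  fix b :: 'b
  have sm: "smooth_on (\<lambda>y. f y \<bullet> b) S"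
    by (rule smooth_on_bounded_linear[OF S(1) bounded_linear_inner_left f])
  have 1: "fd (\<lambda>y. f y \<bullet> b) y w = fd f y w \<bullet> b" if "y \<in> S" for y w
    using fd_eqI[OF has_derivative_inner_left[OF fd_works[OF smooth_on_differentiable[OF f that]]]] by simp
  have 2: "fd (\<lambda>y. fd (\<lambda>y. f y \<bullet> b) y w) x z = fd (\<lambda>y. fd f y w) x z \<bullet> b" for w z
    using fd_cong[OF S 1[of _ w]]
      fd_eqI[OF has_derivative_inner_left[OF fd_works[OF smooth_on_differentiable[OF smooth_on_fd[OF S(1) f, of w] S(2)]]], of b]
    by simp
  show "fd (\<lambda>y. fd f y u) x v \<bullet> b = fd (\<lambda>y. fd f y v) x u \<bullet> b"
    using second_derivative_symmetric_real[OF S sm, of u v] by (simp add: 2)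
qed

subsection \<open>Tangent vectors in charts\<close>

abbreviation transition :: "('p, 'n::finite) chart \<Rightarrow> ('p, 'm::finite) chart \<Rightarrow> real^'n \<Rightarrow> real^'m" where
  "transition c d \<equiv> snd d \<circ> chart_inv c"

abbreviation overlap :: "('p, 'n::finite) chart \<Rightarrow> ('p, 'm::finite) chart \<Rightarrow> (real^'n) set" where
  "overlap c d \<equiv> snd c ` (fst c \<inter> fst d)"

text \<open>The inverse of \<open>v \<mapsto> v c\<close>: a tangent vector is a family over all
  charts, and this is the family with prescribed components in \<open>c\<close>. On axis vectors it
  is \<open>coord_vec\<close>.\<close>

definition tvec :: "('p, 'n::finite) atlas \<Rightarrow> ('p, 'n) chart \<Rightarrow> 'p \<Rightarrow> real^'n \<Rightarrow> ('p, 'n) tvec" where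
  "tvec A c p u = (\<lambda>d. if d \<in> charts_at A p then fd (transition c d) (snd c p) u else 0)"

lemma charts_at_iff: "c \<in> charts_at A p \<longleftrightarrow> c \<in> A \<and> p \<in> fst c"
  by (simp add: charts_at_def)

lemma pts_iff: "p \<in> pts A \<longleftrightarrow> (\<exists>c. c \<in> charts_at A p)"
  by (auto simp: pts_def charts_at_def simp del: split_paired_Ex)

locale atlas =
  fixes A :: "('p, 'n::finite) atlas"
  assumes smooth_atlas: "smooth_atlas A"
begin

lemma inj_chart: "c \<in> A \<Longrightarrow> inj_on (snd c) (fst c)"
  using smooth_atlas by (auto simp: smooth_atlas_def)

lemma chart_inv_snd [simp]: "c \<in> A \<Longrightarrow> p \<in> fst c \<Longrightarrow> chart_inv c (snd c p) = p"
  by (simp add: chart_inv_def inj_chart)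

lemma snd_chart_inv: "x \<in> snd c ` fst c \<Longrightarrow> snd c (chart_inv c x) = x"
  by (simp add: chart_inv_def f_inv_into_f)

lemma chart_inv_in: "x \<in> snd c ` fst c \<Longrightarrow> chart_inv c x \<in> fst c"
  by (simp add: chart_inv_def inv_into_into)

lemma open_overlap: "c \<in> A \<Longrightarrow> d \<in> A \<Longrightarrow> open (overlap c d)"
  using smooth_atlas by (auto simp: smooth_atlas_def)

lemma open_dom: "c \<in> A \<Longrightarrow> open (snd c ` fst c)"
  using open_overlap[of c c] by simp

lemma smooth_transition: "c \<in> A \<Longrightarrow> d \<in> A \<Longrightarrow> smooth_on (transition c d) (overlap c d)"
  using smooth_atlas by (auto simp: smooth_atlas_def)

lemma mem_overlap: "p \<in> fst c \<Longrightarrow> p \<in> fst d \<Longrightarrow> snd c p \<in> overlap c d"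
  by auto

text \<open>Near the point, the representation in \<open>c\<close> is the one in \<open>d\<close>
  preceded by the transition map, so the chain rule applies. The cocycle rule for transitions and
  the chart independence of directional derivatives rest on this.\<close>

lemma change_chart:
  assumes "c \<in> charts_at A p" "d \<in> charts_at A p"
    and h: "(h \<circ> chart_inv d has_derivative h') (at (snd d p))"
  shows "(h \<circ> chart_inv c has_derivative (\<lambda>v. h' (fd (transition c d) (snd c p) v))) (at (snd c p))"
proof -
  have c: "c \<in> A" "p \<in> fst c" and d: "d \<in> A" "p \<in> fst d" using assms by (auto simp: charts_at_iff)
  have 1: "(transition c d has_derivative fd (transition c d) (snd c p)) (at (snd c p))"
    by (rule fd_works[OF smooth_on_differentiable[OF smooth_transition[OF c(1) d(1)] mem_overlap[OF c(2) d(2)]]])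
  have 2: "(h \<circ> chart_inv d has_derivative h') (at (transition c d (snd c p)))" using h c by simp
  have "((\<lambda>x. (h \<circ> chart_inv d) (transition c d x)) has_derivative
      (\<lambda>v. h' (fd (transition c d) (snd c p) v))) (at (snd c p))"
    by (rule has_derivative_compose[OF 1 2])
  then show ?thesis
  proof (rule has_derivative_transform_within_open[OF _ open_overlap[OF c(1) d(1)] mem_overlap[OF c(2) d(2)]])
    fix x assume "x \<in> overlap c d"
    then show "(h \<circ> chart_inv d) (transition c d x) = (h \<circ> chart_inv c) x" using c d by auto
  qed
qed

lemma transition_differentiable:
  "c \<in> charts_at A p \<Longrightarrow> d \<in> charts_at A p \<Longrightarrow> transition c d differentiable (at (snd c p))"
  using smooth_on_differentiable[OF smooth_transition mem_overlap] by (auto simp: charts_at_iff)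

lemma fd_transition_linear:
  "c \<in> charts_at A p \<Longrightarrow> d \<in> charts_at A p \<Longrightarrow> linear (fd (transition c d) (snd c p))"
  by (rule fd_linear[OF transition_differentiable])

lemma fd_transition_compose:
  assumes "c \<in> charts_at A p" "d \<in> charts_at A p" "e \<in> charts_at A p"
  shows "fd (transition d e) (snd d p) (fd (transition c d) (snd c p) u) = fd (transition c e) (snd c p) u"
  using fd_eqI[OF change_chart[OF assms(1,2) fd_works[OF transition_differentiable[OF assms(2,3)]]]] by simp

lemma fd_transition_self [simp]:
  assumes "c \<in> charts_at A p"
  shows "fd (transition c c) (snd c p) u = u"
proof -
  have c: "c \<in> A" "p \<in> fst c" using assms by (auto simp: charts_at_iff)
  have "fd (transition c c) (snd c p) = fd (\<lambda>x. x) (snd c p)"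
    using c by (intro fd_cong[OF open_dom[OF c(1)]]) auto
  then show ?thesis using fd_eqI[OF has_derivative_ident] by metis
qed

lemma fd_transition_inverse:
  assumes "c \<in> charts_at A p" "d \<in> charts_at A p"
  shows "fd (transition c d) (snd c p) (fd (transition d c) (snd d p) u) = u"
  using fd_transition_compose[OF assms(2,1,2)] assms by simp

lemma tvec_self [simp]: "c \<in> charts_at A p \<Longrightarrow> tvec A c p u c = u"
  by (simp add: tvec_def)

lemma tangent_change:
  assumes "v \<in> tangent_space A p" "c \<in> charts_at A p" "d \<in> charts_at A p"
  shows "v d = fd (transition c d) (snd c p) (v c)"
  using assms unfolding tangent_space_def by blast

lemma tangent_outside:
  assumes "v \<in> tangent_space A p" "c \<notin> charts_at A p"
  shows "v c = 0"
  using assms unfolding tangent_space_def by blast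

lemma tangentI:
  assumes "\<And>c d. c \<in> charts_at A p \<Longrightarrow> d \<in> charts_at A p \<Longrightarrow> v d = fd (transition c d) (snd c p) (v c)"
    and "\<And>c. c \<notin> charts_at A p \<Longrightarrow> v c = 0"
  shows "v \<in> tangent_space A p"
  using assms unfolding tangent_space_def by blast

lemma tvec_in: "c \<in> charts_at A p \<Longrightarrow> tvec A c p u \<in> tangent_space A p"
  by (rule tangentI) (simp_all add: tvec_def fd_transition_compose)

lemma tvec_eq: "v \<in> tangent_space A p \<Longrightarrow> c \<in> charts_at A p \<Longrightarrow> tvec A c p (v c) = v"
  by (rule ext) (simp add: tvec_def tangent_change[of v p c, symmetric] tangent_outside)

lemma tangent_eqI:
  "v \<in> tangent_space A p \<Longrightarrow> w \<in> tangent_space A p \<Longrightarrow> c \<in> charts_at A p \<Longrightarrow> v c = w c \<Longrightarrow> v = w"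
  using tvec_eq by metis

lemma tangent_lincomb:
  "v \<in> tangent_space A p \<Longrightarrow> w \<in> tangent_space A p \<Longrightarrow> (\<lambda>c. r *\<^sub>R v c + s *\<^sub>R w c) \<in> tangent_space A p"
  by (rule tangentI)
    (auto simp: tangent_outside linear_add[OF fd_transition_linear] linear_cmul[OF fd_transition_linear]
      tangent_change[symmetric])

lemma tangent_zero: "(\<lambda>_. 0) \<in> tangent_space A p"
  by (rule tangentI) (simp_all add: linear_0[OF fd_transition_linear])

lemma tangent_diff:
  "v \<in> tangent_space A p \<Longrightarrow> w \<in> tangent_space A p \<Longrightarrow> (\<lambda>c. v c - w c) \<in> tangent_space A p"
  using tangent_lincomb[of v p w 1 "-1"] by simp

lemma tvec_lincomb:
  "c \<in> charts_at A p \<Longrightarrow> tvec A c p (r *\<^sub>R u + s *\<^sub>R w) = (\<lambda>d. r *\<^sub>R tvec A c p u d + s *\<^sub>R tvec A c p w d)"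
  by (rule tangent_eqI[where p=p and c=c]) (auto intro: tvec_in tangent_lincomb)

text \<open>The definition takes a chart by \<open>SOME\<close>. Differentiability in
  \<open>c\<close> carries over to that chart by the chain rule, and the components of
  \<open>v\<close> change accordingly.\<close>

lemma dir_deriv_eq:
  assumes v: "v \<in> tangent_space A p" and c: "c \<in> charts_at A p"
    and h: "(h \<circ> chart_inv c) differentiable (at (snd c p))"
  shows "dir_deriv A p v h = fd (h \<circ> chart_inv c) (snd c p) (v c)"
proof -
  define c0 where "c0 = (SOME c. c \<in> charts_at A p)"
  have c0: "c0 \<in> charts_at A p" unfolding c0_def using c by (rule someI)
  have "dir_deriv A p v h = fd (h \<circ> chart_inv c0) (snd c0 p) (v c0)"
    unfolding dir_deriv_def c0_def Let_def ..
  also have "\<dots> = fd (h \<circ> chart_inv c) (snd c p) (fd (transition c0 c) (snd c0 p) (v c0))"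
    by (simp add: fd_eqI[OF change_chart[OF c0 c fd_works[OF h]]])
  finally show ?thesis using tangent_change[OF v c0 c] by simp
qed

end


subsection \<open>Metric and Christoffel symbols in charts\<close>

text \<open>The Christoffel symbols as a bilinear map at each coordinate point, so that later
  arguments can use linearity in place of index sums.\<close>

definition gam :: "('p, 'n::finite) atlas \<Rightarrow> ('p, 'n) metric \<Rightarrow> ('p, 'n) chart \<Rightarrow>
    real^'n \<Rightarrow> real^'n \<Rightarrow> real^'n \<Rightarrow> real^'n" where
  "gam A g c x u w = (\<chi> a. \<Sum>b\<in>UNIV. \<Sum>d\<in>UNIV. christoffel A g c x a b d * u $ b * w $ d)"

definition gform :: "('p, 'n::finite) atlas \<Rightarrow> ('p, 'n) metric \<Rightarrow> ('p, 'n) chart \<Rightarrow>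
    real^'n \<Rightarrow> real^'n \<Rightarrow> real^'n \<Rightarrow> real" where
  "gform A g c x u w = (let p = chart_inv c x in g p (tvec A c p u) (tvec A c p w))"

abbreviation dgform :: "('p, 'n::finite) atlas \<Rightarrow> ('p, 'n) metric \<Rightarrow> ('p, 'n) chart \<Rightarrow>
    real^'n \<Rightarrow> real^'n \<Rightarrow> real^'n \<Rightarrow> real^'n \<Rightarrow> real" where
  "dgform A g c x v u w \<equiv> fd (\<lambda>y. gform A g c y u w) x v"

lemma metric_matrix_gform: "metric_matrix A g c x $ a $ b = gform A g c x (axis a 1) (axis b 1)"
  by (simp add: metric_matrix_def gform_def coord_vec_def tvec_def Let_def)

lemma linear_gam1: "linear (\<lambda>u. gam A g c x u w)"
  by (rule linearI) (auto simp: gam_def vec_eq_iff sum.distrib algebra_simps sum_distrib_left)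

lemma linear_gam2: "linear (\<lambda>w. gam A g c x u w)"
  by (rule linearI) (auto simp: gam_def vec_eq_iff sum.distrib algebra_simps sum_distrib_left)

lemma linear_axis_expansion:
  fixes f :: "real^'n::finite \<Rightarrow> 'b::real_vector"
  assumes "linear f"
  shows "f u = (\<Sum>i\<in>UNIV. u $ i *\<^sub>R f (axis i 1))"
proof -
  have "f u = f (\<Sum>i\<in>UNIV. u $ i *\<^sub>R axis i 1)"
    using basis_expansion[of u] by (simp add: scalar_mult_eq_scaleR)
  then show ?thesis by (simp add: linear_sum[OF assms] linear_cmul[OF assms])
qed

lemma linear_eq_axis:
  fixes f h :: "real^'n::finite \<Rightarrow> 'b::real_vector"
  assumes "linear f" "linear h" "\<And>i. f (axis i 1) = h (axis i 1)"
  shows "f u = h u"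
  unfolding linear_axis_expansion[OF assms(1), of u] linear_axis_expansion[OF assms(2), of u] assms(3) ..

text \<open>The regularity asked for is the one derivative of the metric that enters the Christoffel
  symbols. This admits the Sasaki metric as an instance: its coefficients contain Christoffel
  symbols of \<open>g\<close>, for which differentiability is shown below.\<close>

locale riem = atlas A for A :: "('p, 'n::finite) atlas" +
  fixes g :: "('p, 'n) metric"
  assumes metric_sym: "u \<in> tangent_space A p \<Longrightarrow> v \<in> tangent_space A p \<Longrightarrow> p \<in> pts A \<Longrightarrow> g p u v = g p v u"
    and metric_pos: "u \<in> tangent_space A p \<Longrightarrow> p \<in> pts A \<Longrightarrow> u \<noteq> (\<lambda>_. 0) \<Longrightarrow> g p u u > 0"
    and metric_lin: "u \<in> tangent_space A p \<Longrightarrow> v \<in> tangent_space A p \<Longrightarrow> w \<in> tangent_space A p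
      \<Longrightarrow> p \<in> pts A \<Longrightarrow> g p (\<lambda>c. r *\<^sub>R u c + s *\<^sub>R v c) w = r * g p u w + s * g p v w"
    and metric_diff: "c \<in> A \<Longrightarrow> x \<in> snd c ` fst c \<Longrightarrow> (\<lambda>x. metric_matrix A g c x $ a $ b) differentiable (at x)"
begin

lemma metric_gform:
  assumes "c \<in> charts_at A p" "u \<in> tangent_space A p" "v \<in> tangent_space A p"
  shows "g p u v = gform A g c (snd c p) (u c) (v c)"
  using assms by (simp add: gform_def tvec_eq) (simp add: charts_at_iff tvec_eq)

lemma chart_at_point:
  assumes "c \<in> A" "x \<in> snd c ` fst c"
  shows "c \<in> charts_at A (chart_inv c x)" "chart_inv c x \<in> pts A"
  using assms chart_inv_in[OF assms(2)] by (auto simp: charts_at_iff pts_iff simp del: split_paired_Ex)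

lemma gform_sym:
  assumes "c \<in> A" "x \<in> snd c ` fst c"
  shows "gform A g c x u w = gform A g c x w u"
  unfolding gform_def Let_def using chart_at_point[OF assms] by (intro metric_sym tvec_in)

lemma linear_gform1:
  assumes "c \<in> A" "x \<in> snd c ` fst c"
  shows "linear (\<lambda>u. gform A g c x u w)"
proof -
  note p = chart_at_point[OF assms]
  have "gform A g c x (r *\<^sub>R u + s *\<^sub>R v) w = r * gform A g c x u w + s * gform A g c x v w" for r s u v
    unfolding gform_def Let_def tvec_lincomb[OF p(1)]
    by (rule metric_lin[OF tvec_in[OF p(1)] tvec_in[OF p(1)] tvec_in[OF p(1)] p(2)])
  from this[of 1 _ 1] this[of _ _ 0] show ?thesis by (intro linearI) auto
qed

lemma linear_gform2:
  assumes "c \<in> A" "x \<in> snd c ` fst c"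
  shows "linear (\<lambda>w. gform A g c x u w)"
  using linear_gform1[OF assms, of u] by (simp add: gform_sym[OF assms, of u])

lemma gform_pos:
  assumes "c \<in> A" "x \<in> snd c ` fst c" "u \<noteq> 0"
  shows "gform A g c x u u > 0"
proof -
  note p = chart_at_point[OF assms(1,2)]
  have "tvec A c (chart_inv c x) u \<noteq> (\<lambda>_. 0)" using tvec_self[OF p(1), of u] assms(3) by auto
  then show ?thesis unfolding gform_def Let_def by (intro metric_pos tvec_in p)
qed

lemma gform_self_zero:
  "c \<in> A \<Longrightarrow> x \<in> snd c ` fst c \<Longrightarrow> gform A g c x u u = 0 \<Longrightarrow> u = 0"
  using gform_pos[of c x u] by fastforce

lemma gform_eqI:
  assumes "c \<in> A" "x \<in> snd c ` fst c" "\<And>z. gform A g c x u z = gform A g c x w z"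
  shows "u = w"
proof -
  have "gform A g c x (u - w) (u - w) = 0"
    using linear_diff[OF linear_gform1[OF assms(1,2)]] assms(3) by simp
  then show ?thesis using gform_self_zero[OF assms(1,2)] by fastforce
qed

text \<open>On axis vectors these are the entries of the metric matrix; the bilinear expansion
  extends this to all vectors. It holds on the chart image, an open set, whence the local
  congruence.\<close>

lemma gform_differentiable:
  assumes "c \<in> A" "x \<in> snd c ` fst c"
  shows "(\<lambda>y. gform A g c y u w) differentiable (at x)"
proof (rule differentiable_cong_open[OF open_dom[OF assms(1)] assms(2)])
  show "(\<lambda>y. \<Sum>b\<in>Basis. \<Sum>d\<in>Basis. (u \<bullet> b) * (w \<bullet> d) * gform A g c y b d) differentiable (at x)"
    using metric_diff[OF assms, unfolded metric_matrix_gform]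
    by (intro differentiable_sum differentiable_mult differentiable_const) (auto simp: Basis_vec_def)
  show "(\<Sum>b\<in>Basis. \<Sum>d\<in>Basis. (u \<bullet> b) * (w \<bullet> d) * gform A g c y b d) = gform A g c y u w"
    if "y \<in> snd c ` fst c" for y
    by (subst linear_basis_expansion[OF linear_gform1[OF assms(1) that], of u],
        subst linear_basis_expansion[OF linear_gform2[OF assms(1) that], of _ w])
      (simp add: sum_distrib_left mult.assoc)
qed

lemma gform_has_derivative:
  assumes c: "c \<in> A" "h x \<in> snd c ` fst c"
    and h: "(h has_derivative h') (at x)"
    and a: "(a has_derivative a') (at x)" and b: "(b has_derivative b') (at x)"
  shows "((\<lambda>y. gform A g c (h y) (a y) (b y)) has_derivative
    (\<lambda>v. dgform A g c (h x) (h' v) (a x) (b x) + gform A g c (h x) (a' v) (b x)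
      + gform A g c (h x) (a x) (b' v))) (at x)"
proof (rule has_derivative_bilinear_family[where S="snd c ` fst c" and B="gform A g c"])
  show "open (snd c ` fst c)" by (rule open_dom[OF c(1)])
qed (fact c(2) h a b linear_gform1[OF c(1)] linear_gform2[OF c(1)] gform_differentiable[OF c])+

section \<open>First derivatives of the metric and the Levi-Civita connection\<close>

lemma linear_dgform0: "c \<in> A \<Longrightarrow> x \<in> snd c ` fst c \<Longrightarrow> linear (\<lambda>v. dgform A g c x v u w)"
  by (rule fd_linear[OF gform_differentiable])

lemma linear_dgform1:
  assumes "c \<in> A" "x \<in> snd c ` fst c"
  shows "linear (\<lambda>u. dgform A g c x v u w)"
proof -
  note d = fd_works[OF gform_differentiable[OF assms]]
  show ?thesis
  proof (rule linearI)
    fix a b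
    have "fd (\<lambda>y. gform A g c y (a + b) w) x = fd (\<lambda>y. gform A g c y a w + gform A g c y b w) x"
      by (rule fd_cong[OF open_dom[OF assms(1)] assms(2)]) (simp add: linear_add[OF linear_gform1[OF assms(1)]])
    then show "dgform A g c x v (a + b) w = dgform A g c x v a w + dgform A g c x v b w"
      using fd_eqI[OF has_derivative_add[OF d d]] by metis
  next
    fix r a
    have "fd (\<lambda>y. gform A g c y (r *\<^sub>R a) w) x = fd (\<lambda>y. r *\<^sub>R gform A g c y a w) x"
      by (rule fd_cong[OF open_dom[OF assms(1)] assms(2)]) (simp add: linear_cmul[OF linear_gform1[OF assms(1)]])
    then show "dgform A g c x v (r *\<^sub>R a) w = r *\<^sub>R dgform A g c x v a w"
      using fd_eqI[OF has_derivative_scaleR_right[OF d]] by metis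
  qed
qed

lemma dgform_sym:
  assumes "c \<in> A" "x \<in> snd c ` fst c"
  shows "dgform A g c x v u w = dgform A g c x v w u"
  using fd_cong[OF open_dom[OF assms(1)] assms(2), of "\<lambda>y. gform A g c y u w" "\<lambda>y. gform A g c y w u"]
    gform_sym[OF assms(1)] by metis

lemma linear_dgform2:
  assumes "c \<in> A" "x \<in> snd c ` fst c"
  shows "linear (\<lambda>w. dgform A g c x v u w)"
  using linear_dgform1[OF assms, where v=v and w=u] by (simp add: dgform_sym[OF assms, where v=v and u=u])

text \<open>A vector killed by the metric matrix is orthogonal to all axis vectors, hence zero by
  definiteness. As \<open>matrix_inv\<close> is a Hilbert choice, invertibility has to be
  established before it can be used.\<close>

lemma metric_matrix_inv:
  assumes "c \<in> A" "x \<in> snd c ` fst c"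
  shows "matrix_inv (metric_matrix A g c x) ** metric_matrix A g c x = mat 1"
proof -
  let ?G = "metric_matrix A g c x"
  have "u = 0" if "?G *v u = 0" for u
  proof (rule gform_eqI[OF assms])
    fix z
    have "gform A g c x u (axis i 1) = 0" for i
    proof -
      have "gform A g c x u (axis i 1) = (\<Sum>j\<in>UNIV. u $ j *\<^sub>R gform A g c x (axis j 1) (axis i 1))"
        by (rule linear_axis_expansion[OF linear_gform1[OF assms]])
      also have "\<dots> = (\<Sum>j\<in>UNIV. u $ j * ?G $ i $ j)"
        by (simp add: metric_matrix_gform gform_sym[OF assms, of "axis i 1"])
      also have "\<dots> = (?G *v u) $ i" by (simp add: matrix_vector_mult_def mult.commute)
      finally show ?thesis using that by simp
    qed
    then have "gform A g c x u z = 0"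
      by (subst linear_axis_expansion[OF linear_gform2[OF assms]]) simp
    then show "gform A g c x u z = gform A g c x 0 z" by (simp add: linear_0[OF linear_gform1[OF assms]])
  qed
  then have "invertible ?G"
    using invertible_left_inverse matrix_left_invertible_ker by blast
  then show ?thesis unfolding invertible_def matrix_inv_def by (rule someI2_ex) simp
qed

text \<open>This is the Koszul formula; no bracket terms occur because coordinate fields commute. On
  axis vectors the metric matrix cancels the inverse in \<open>christoffel\<close>, and linearity in
  each slot does the rest. Symmetry, metric compatibility and the transformation law of the
  connection are all derived from it.\<close>

lemma gform_gam:
  assumes "c \<in> A" "x \<in> snd c ` fst c"
  shows "gform A g c x (gam A g c x u w) z
    = (dgform A g c x u w z + dgform A g c x w u z - dgform A g c x z u w) / 2"
proof -
  let ?G = "metric_matrix A g c x"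
  let ?L = "\<lambda>u w z. gform A g c x (gam A g c x u w) z"
  let ?R = "\<lambda>u w z. (dgform A g c x u w z + dgform A g c x w u z - dgform A g c x z u w) / 2"
  have l: "linear (\<lambda>u. ?L u w z)" "linear (\<lambda>w. ?L u w z)" "linear (\<lambda>z. ?L u w z)" for u w z
    by (rule linear_compose[OF linear_gam1 linear_gform1[OF assms], unfolded comp_def]
      linear_compose[OF linear_gam2 linear_gform1[OF assms], unfolded comp_def]
      linear_gform2[OF assms])+
  have "linear (\<lambda>x. (f x + h x - k x) / 2)" if "linear f" "linear h" "linear k"
    for f h k :: "real^'n \<Rightarrow> real"
    using that by (intro linearI) (auto simp: linear_add linear_cmul field_simps)
  then have r: "linear (\<lambda>u. ?R u w z)" "linear (\<lambda>w. ?R u w z)" "linear (\<lambda>z. ?R u w z)" for u w z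
    using linear_dgform0[OF assms] linear_dgform1[OF assms] linear_dgform2[OF assms] by blast+
  have ax: "?L (axis i 1) (axis j 1) (axis k 1) = ?R (axis i 1) (axis j 1) (axis k 1)" for i j k
  proof -
    define T where "T e = partial_deriv i (\<lambda>y. metric_matrix A g c y $ j $ e) x
      + partial_deriv j (\<lambda>y. metric_matrix A g c y $ i $ e) x
      - partial_deriv e (\<lambda>y. metric_matrix A g c y $ i $ j) x" for e
    have chr: "christoffel A g c x a i j = (\<Sum>e\<in>UNIV. matrix_inv ?G $ a $ e * T e) / 2" for a
      by (simp add: christoffel_def T_def Let_def)
    have gm: "gam A g c x (axis i 1) (axis j 1) $ a = christoffel A g c x a i j" for a
    proof -
      have "christoffel A g c x a b d * axis i 1 $ b * axis j 1 $ d
        = (if d = j then if b = i then christoffel A g c x a i j else 0 else 0)" for b d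
        by (auto simp: axis_def)
      then show ?thesis by (simp add: gam_def)
    qed
    have "?L (axis i 1) (axis j 1) (axis k 1)
      = (\<Sum>a\<in>UNIV. gam A g c x (axis i 1) (axis j 1) $ a *\<^sub>R gform A g c x (axis a 1) (axis k 1))"
      by (rule linear_axis_expansion[OF linear_gform1[OF assms]])
    also have "\<dots> = (\<Sum>a\<in>UNIV. christoffel A g c x a i j * ?G $ k $ a)"
      by (simp add: metric_matrix_gform gm gform_sym[OF assms, of "axis k 1"])
    also have "\<dots> = (\<Sum>e\<in>UNIV. (\<Sum>a\<in>UNIV. ?G $ k $ a * matrix_inv ?G $ a $ e) * T e) / 2"
    proof -
      have "(\<Sum>a\<in>UNIV. christoffel A g c x a i j * ?G $ k $ a)
          = (\<Sum>a\<in>UNIV. \<Sum>e\<in>UNIV. ?G $ k $ a * matrix_inv ?G $ a $ e * T e) / 2"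
        by (simp add: chr sum_distrib_left sum_divide_distrib ac_simps)
      also have "\<dots> = (\<Sum>e\<in>UNIV. \<Sum>a\<in>UNIV. ?G $ k $ a * matrix_inv ?G $ a $ e * T e) / 2"
        by (subst sum.swap) (rule refl)
      finally show ?thesis by (simp add: sum_distrib_right)
    qed
    also have "\<dots> = (\<Sum>e\<in>UNIV. if k = e then T e else 0) / 2"
    proof -
      have "?G ** matrix_inv ?G = mat 1" using metric_matrix_inv[OF assms] matrix_left_right_inverse by blast
      then have "(?G ** matrix_inv ?G) $ k $ e = (if k = e then 1 else 0)" for e by (simp add: mat_def)
      then have "(\<Sum>a\<in>UNIV. ?G $ k $ a * matrix_inv ?G $ a $ e) * T e = (if k = e then T e else 0)" for e
        by (simp add: matrix_matrix_mult_def)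
      then show ?thesis by simp
    qed
    also have "\<dots> = T k / 2" by simp
    finally show ?thesis by (simp add: T_def partial_deriv_def metric_matrix_gform)
  qed
  have "?L (axis i 1) (axis j 1) z = ?R (axis i 1) (axis j 1) z" for i j
    by (rule linear_eq_axis[OF l(3) r(3) ax])
  then have "?L (axis i 1) w z = ?R (axis i 1) w z" for i by (rule linear_eq_axis[OF l(2) r(2)])
  then show ?thesis by (rule linear_eq_axis[OF l(1) r(1)])
qed

lemma gam_sym:
  assumes "c \<in> A" "x \<in> snd c ` fst c"
  shows "gam A g c x u w = gam A g c x w u"
proof (rule gform_eqI[OF assms])
  fix z
  show "gform A g c x (gam A g c x u w) z = gform A g c x (gam A g c x w u) z"
    unfolding gform_gam[OF assms] using dgform_sym[OF assms, where v=z and u=u and w=w] by simp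
qed

text \<open>In the sum of the Koszul formulas for \<open>(v, u, w)\<close> and
  \<open>(v, w, u)\<close> everything cancels except the derivative along \<open>v\<close>.\<close>

lemma metric_compatible:
  assumes "c \<in> A" "x \<in> snd c ` fst c"
  shows "dgform A g c x v u w = gform A g c x (gam A g c x v u) w + gform A g c x u (gam A g c x v w)"
proof -
  have "gform A g c x u (gam A g c x v w) = gform A g c x (gam A g c x v w) u"
    by (rule gform_sym[OF assms])
  then show ?thesis
    using dgform_sym[OF assms, where v=v and u=u and w=w] dgform_sym[OF assms, where v=u and u=v and w=w]
      dgform_sym[OF assms, where v=w and u=v and w=u]
    by (simp add: gform_gam[OF assms] field_simps)
qed

lemma gform_transition:
  assumes "c \<in> charts_at A p" "d \<in> charts_at A p"
  shows "gform A g c (snd c p) u w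
    = gform A g d (snd d p) (fd (transition c d) (snd c p) u) (fd (transition c d) (snd c p) w)"
proof -
  have "tvec A c p v = tvec A d p (fd (transition c d) (snd c p) v)" for v
    by (rule tangent_eqI[OF tvec_in[OF assms(1)] tvec_in[OF assms(2)] assms(2)])
      (simp add: assms tvec_self, simp add: tvec_def assms)
  then show ?thesis using assms by (simp add: gform_def charts_at_iff)
qed

text \<open>Differentiating the pullback identity for the metric brings in the second derivative
  \<open>H\<close> of the transition map. In the Koszul formula the \<open>H\<close> terms cancel by
  symmetry, except for the two that contain \<open>H u w\<close>; nondegeneracy then removes the
  test vector.\<close>

lemma gam_transition:
  assumes c: "c \<in> charts_at A p" and d: "d \<in> charts_at A p"
  shows "gam A g d (snd d p) (fd (transition c d) (snd c p) u) (fd (transition c d) (snd c p) w)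
    = fd (transition c d) (snd c p) (gam A g c (snd c p) u w)
      - fd (\<lambda>y. fd (transition c d) y w) (snd c p) u"
proof -
  define \<phi> where "\<phi> = transition c d"
  define x where "x = snd c p"
  define y where "y = snd d p"
  define H where "H u w = fd (\<lambda>y. fd \<phi> y w) x u" for u w
  have cA: "c \<in> A" "p \<in> fst c" and dA: "d \<in> A" "p \<in> fst d" using c d by (auto simp: charts_at_iff)
  have \<phi>x: "\<phi> x = y" using cA by (simp add: \<phi>_def x_def y_def)
  have xc: "x \<in> snd c ` fst c" and yd: "y \<in> snd d ` fst d" using cA dA by (auto simp: x_def y_def)
  have ov: "open (overlap c d)" "x \<in> overlap c d" using open_overlap[OF cA(1) dA(1)] cA dA by (auto simp: x_def)
  have sm: "smooth_on \<phi> (overlap c d)" unfolding \<phi>_def by (rule smooth_transition[OF cA(1) dA(1)])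
  have H_sym: "H u w = H w u" for u w
    unfolding H_def by (rule second_derivative_symmetric[OF ov sm])
  have dphi: "(\<phi> has_derivative fd \<phi> x) (at x)" by (rule fd_works[OF smooth_on_differentiable[OF sm ov(2)]])
  have d2: "((\<lambda>z. fd \<phi> z w) has_derivative (\<lambda>v. H v w)) (at x)" for w
    unfolding H_def by (rule fd_works[OF smooth_on_differentiable[OF smooth_on_fd[OF ov(1) sm] ov(2)]])
  have lin: "linear (fd \<phi> x)" by (rule has_derivative_linear[OF dphi])
  have tr: "gform A g c z u w = gform A g d (\<phi> z) (fd \<phi> z u) (fd \<phi> z w)" if "z \<in> overlap c d" for z u w
  proof -
    obtain q where q: "q \<in> fst c" "q \<in> fst d" "z = snd c q" using \<open>z \<in> overlap c d\<close> by blast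
    then show ?thesis using gform_transition[of c q d u w] cA dA
      by (simp add: charts_at_iff \<phi>_def)
  qed
  have dg: "dgform A g c x v u w = dgform A g d y (fd \<phi> x v) (fd \<phi> x u) (fd \<phi> x w)
      + gform A g d y (H v u) (fd \<phi> x w) + gform A g d y (fd \<phi> x u) (H v w)" for v u w
  proof -
    have "dgform A g c x v u w = fd (\<lambda>z. gform A g d (\<phi> z) (fd \<phi> z u) (fd \<phi> z w)) x v"
      by (rule fun_cong[OF fd_cong[OF ov tr]])
    also have "\<dots> = dgform A g d (\<phi> x) (fd \<phi> x v) (fd \<phi> x u) (fd \<phi> x w)
      + gform A g d (\<phi> x) (H v u) (fd \<phi> x w) + gform A g d (\<phi> x) (fd \<phi> x u) (H v w)"
      using yd \<phi>x by (subst fd_eqI[OF gform_has_derivative[OF dA(1) _ dphi d2 d2]]) auto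
    finally show ?thesis by (simp add: \<phi>x)
  qed
  have "gform A g d y (fd \<phi> x (gam A g c x u w)) z'
    = gform A g d y (gam A g d y (fd \<phi> x u) (fd \<phi> x w) + H u w) z'" for z'
  proof -
    \<comment> \<open>The derivative of the transition map is invertible, so every test vector in
      \<open>d\<close> comes from one in \<open>c\<close>.\<close>
    define z where "z = fd (transition d c) y z'"
    have z: "fd \<phi> x z = z'"
      unfolding \<phi>_def x_def z_def y_def by (rule fd_transition_inverse[OF c d])
    have "gform A g d y (fd \<phi> x (gam A g c x u w)) z' = gform A g c x (gam A g c x u w) z"
      using tr[OF ov(2)] z \<phi>x by simp
    also have "\<dots> = gform A g d y (gam A g d y (fd \<phi> x u) (fd \<phi> x w)) z' + gform A g d y (H u w) z'"
      unfolding gform_gam[OF cA(1) xc] gform_gam[OF dA(1) yd] dg z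
      using H_sym[of w u] H_sym[of z u] H_sym[of z w] gform_sym[OF dA(1) yd]
      by (simp add: field_simps)
    finally show ?thesis by (simp add: linear_add[OF linear_gform1[OF dA(1) yd]])
  qed
  then have "fd \<phi> x (gam A g c x u w) = gam A g d y (fd \<phi> x u) (fd \<phi> x w) + H u w"
    by (rule gform_eqI[OF dA(1) yd])
  then show ?thesis unfolding \<phi>_def[symmetric] x_def[symmetric] y_def[symmetric] H_def[symmetric] by simp
qed

end

subsection \<open>Submanifolds in charts\<close>

definition join :: "real^'n::finite \<Rightarrow> real^'m::finite \<Rightarrow> real^('n + 'm)" where
  "join a b = (\<chi> i. case i of Inl k \<Rightarrow> a $ k | Inr k \<Rightarrow> b $ k)"

definition lpart :: "real^('n::finite + 'm::finite) \<Rightarrow> real^'n" where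
  "lpart y = (\<chi> k. y $ Inl k)"

definition rpart :: "real^('n::finite + 'm::finite) \<Rightarrow> real^'m" where
  "rpart y = (\<chi> k. y $ Inr k)"

lemma lpart_join [simp]: "lpart (join a b) = a" and rpart_join [simp]: "rpart (join a b) = b"
  by (simp_all add: lpart_def rpart_def join_def vec_eq_iff)

lemma join_parts [simp]: "join (lpart y) (rpart y) = y"
  by (auto simp: lpart_def rpart_def join_def vec_eq_iff split: sum.split)

lemma linear_lpart: "linear lpart" and linear_rpart: "linear rpart"
  by (auto intro!: linearI simp: lpart_def rpart_def vec_eq_iff)

lemma linear_join1: "linear (\<lambda>a. join a 0)" and linear_join2: "linear (\<lambda>b. join 0 b)"
  by (auto intro!: linearI simp: join_def vec_eq_iff split: sum.split)

lemma join_split: "join a b = join a 0 + join 0 b"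
  by (auto simp: join_def vec_eq_iff split: sum.split)

lemma join_add: "join a b + join c d = join (a + c) (b + d)"
  by (auto simp: join_def vec_eq_iff split: sum.split)

lemma join_zero [simp]: "join 0 0 = 0"
  by (auto simp: join_def vec_eq_iff split: sum.split)

lemmas bl_parts = linear_conv_bounded_linear[THEN iffD1, OF linear_lpart]
  linear_conv_bounded_linear[THEN iffD1, OF linear_rpart]
  linear_conv_bounded_linear[THEN iffD1, OF linear_join1]
  linear_conv_bounded_linear[THEN iffD1, OF linear_join2]

lemma smooth_on_join:
  assumes "open S" "smooth_on a S" "smooth_on b S"
  shows "smooth_on (\<lambda>x. join (a x) (b x)) S"
  by (subst join_split)
    (intro smooth_on_add smooth_on_bounded_linear[OF _ bl_parts(3)] smooth_on_bounded_linear[OF _ bl_parts(4)] assms)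

lemma has_derivative_join:
  assumes "(a has_derivative a') F" "(b has_derivative b') F"
  shows "((\<lambda>x. join (a x) (b x)) has_derivative (\<lambda>v. join (a' v) (b' v))) F"
proof -
  have "((\<lambda>x. join (a x) 0 + join 0 (b x)) has_derivative (\<lambda>v. join (a' v) 0 + join 0 (b' v))) F"
    by (intro has_derivative_add bounded_linear.has_derivative[OF bl_parts(3)]
        bounded_linear.has_derivative[OF bl_parts(4)] assms)
  then show ?thesis by (simp add: join_add)
qed

lemma snd_induced_chart: "snd (induced_chart A c) z = join (snd c (fst z)) (snd z c)"
  by (cases z) (simp add: induced_chart_def join_def)

lemma fst_induced_chart: "z \<in> fst (induced_chart A c) \<longleftrightarrow> fst z \<in> fst c \<and> snd z \<in> tangent_space A (fst z)"
  by (cases z) (simp add: induced_chart_def)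

text \<open>In coordinates, the covariant derivative along \<open>v\<close> of the field along the
  submanifold with constant components \<open>w\<close> in \<open>e\<close>. For
  \<open>v = w\<close> it is the acceleration of the image of a straight coordinate line. The same
  expression is used for the image in the tangent bundle.\<close>

definition accel :: "('p, 'n::finite) atlas \<Rightarrow> ('p, 'n) metric \<Rightarrow> ('p, 'l::finite) chart \<Rightarrow> ('p, 'n) chart \<Rightarrow>
    real^'l \<Rightarrow> real^'l \<Rightarrow> real^'l \<Rightarrow> real^'n" where
  "accel A g e c x v w = fd (\<lambda>u. fd (transition e c) u w) x v
     + gam A g c (transition e c x) (fd (transition e c) x v) (fd (transition e c) x w)"

locale submanifold_of = riem A g for A :: "('p, 'n::finite) atlas" and g :: "('p, 'n) metric" +
  fixes B :: "('p, 'l::finite) atlas"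
  assumes submanifold: "submanifold B A"

sublocale submanifold_of \<subseteq> sub: atlas B
  using submanifold by unfold_locales (simp add: submanifold_def smooth_manifold_def)

context submanifold_of
begin

lemma pts_sub: "p \<in> pts B \<Longrightarrow> p \<in> pts A"
  using submanifold by (auto simp: submanifold_def smooth_map_on_def)

lemma inclusion_chart:
  assumes "e \<in> B" "c \<in> A"
  shows open_inclusion: "open (overlap e c)" and smooth_inclusion: "smooth_on (transition e c) (overlap e c)"
proof -
  have "fst e \<inter> pts B \<inter> (\<lambda>p. p) -` fst c = fst e \<inter> fst c" using assms by (auto simp: pts_def)
  moreover have "open (snd e ` (fst e \<inter> pts B \<inter> (\<lambda>p. p) -` fst c)) \<and>
    smooth_on (snd c \<circ> (\<lambda>p. p) \<circ> chart_inv e) (snd e ` (fst e \<inter> pts B \<inter> (\<lambda>p. p) -` fst c))"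
    using submanifold assms unfolding submanifold_def smooth_map_on_def by blast
  moreover have "snd c \<circ> (\<lambda>p. p) \<circ> chart_inv e = transition e c" by auto
  ultimately show "open (overlap e c)" "smooth_on (transition e c) (overlap e c)" by auto
qed

lemma inclusion_differentiable:
  "e \<in> charts_at B p \<Longrightarrow> c \<in> charts_at A p \<Longrightarrow> transition e c differentiable (at (snd e p))"
  using smooth_on_differentiable[OF smooth_inclusion mem_overlap] by (auto simp: charts_at_iff)

lemma linear_inclusion:
  "e \<in> charts_at B p \<Longrightarrow> c \<in> charts_at A p \<Longrightarrow> linear (fd (transition e c) (snd e p))"
  by (rule fd_linear[OF inclusion_differentiable])

lemma differential_chart:
  assumes "X \<in> tangent_space B p" "e \<in> charts_at B p" "c \<in> charts_at A p"
  shows "differential B A (\<lambda>p. p) p X c = fd (transition e c) (snd e p) (X e)"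
proof -
  have "snd c \<circ> (\<lambda>p. p) = snd c" by auto
  then show ?thesis
    using assms sub.dir_deriv_eq[OF assms(1,2) inclusion_differentiable[OF assms(2,3)]]
    by (simp add: differential_def)
qed

lemma transition_through:
  assumes "e \<in> B" "c \<in> A" "u \<in> overlap e c"
  shows "transition c d (transition e c u) = transition e d u"
  using assms by auto

lemma fd_inclusion_compose:
  assumes "e \<in> charts_at B p" "c \<in> charts_at A p" "d \<in> charts_at A p"
  shows "fd (transition c d) (snd c p) (fd (transition e c) (snd e p) u) = fd (transition e d) (snd e p) u"
proof -
  have e: "e \<in> B" "p \<in> fst e" and c: "c \<in> A" "p \<in> fst c" using assms by (auto simp: charts_at_iff)
  have x: "transition e c (snd e p) = snd c p" using e by simp
  have "((\<lambda>u. transition c d (transition e c u)) has_derivative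
     (\<lambda>v. fd (transition c d) (snd c p) (fd (transition e c) (snd e p) v))) (at (snd e p))"
    using has_derivative_compose[OF fd_works[OF inclusion_differentiable[OF assms(1,2)]], of "transition c d"
        "fd (transition c d) (snd c p)"] fd_works[OF transition_differentiable[OF assms(2,3)]]
    by (simp add: x e)
  then have "(transition e d has_derivative
     (\<lambda>v. fd (transition c d) (snd c p) (fd (transition e c) (snd e p) v))) (at (snd e p))"
    by (rule has_derivative_transform_within_open[OF _ open_inclusion[OF e(1) c(1)] mem_overlap[OF e(2) c(2)]])
      (rule transition_through[OF e(1) c(1)])
  then show ?thesis using fd_eqI by metis
qed

lemma differential_in:
  assumes "X \<in> tangent_space B p" "p \<in> pts B"
  shows "differential B A (\<lambda>p. p) p X \<in> tangent_space A p"
proof -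
  obtain e where e: "e \<in> charts_at B p" using assms pts_iff by metis
  show ?thesis
  proof (rule tangentI)
    fix c d assume "c \<in> charts_at A p" "d \<in> charts_at A p"
    then show "differential B A (\<lambda>p. p) p X d = fd (transition c d) (snd c p) (differential B A (\<lambda>p. p) p X c)"
      by (simp add: differential_chart[OF assms(1) e] fd_inclusion_compose[OF e])
  qed (simp add: differential_def)
qed

lemma inclusion_inj:
  assumes e: "e \<in> charts_at B p" and c: "c \<in> charts_at A p" and 0: "fd (transition e c) (snd e p) u = 0"
  shows "u = 0"
proof -
  have p: "p \<in> pts B" using e pts_iff by metis
  have z: "tvec B e p 0 \<in> tangent_space B p" "tvec B e p u \<in> tangent_space B p" by (rule sub.tvec_in[OF e])+
  have "differential B A (\<lambda>p. p) p (tvec B e p u) = differential B A (\<lambda>p. p) p (tvec B e p 0)"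
    using 0 linear_0[OF linear_inclusion[OF e c]]
    by (intro tangent_eqI[OF differential_in[OF z(2) p] differential_in[OF z(1) p] c])
      (simp add: differential_chart[OF z(1) e c] differential_chart[OF z(2) e c] sub.tvec_self[OF e])
  moreover have "inj_on (differential B A (\<lambda>p. p) p) (tangent_space B p)"
    using submanifold p by (auto simp: submanifold_def)
  ultimately have "tvec B e p u = tvec B e p 0" using z by (auto dest: inj_onD)
  then show ?thesis using sub.tvec_self[OF e] by metis
qed

text \<open>Reduces tangency to linear algebra in one pair of charts: for an element of
  \<open>tangent_space\<close>, the components in \<open>c\<close> determine those in all other
  charts.\<close>

lemma sub_tangent_iff:
  assumes e: "e \<in> charts_at B p" and c: "c \<in> charts_at A p"
  shows "v \<in> sub_tangent A B p \<longleftrightarrow> v \<in> tangent_space A p \<and> v c \<in> range (fd (transition e c) (snd e p))"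
proof -
  have p: "p \<in> pts B" using e pts_iff by metis
  show ?thesis
  proof
    assume "v \<in> sub_tangent A B p"
    then obtain X where X: "X \<in> tangent_space B p" "v = differential B A (\<lambda>p. p) p X"
      unfolding sub_tangent_def by blast
    then show "v \<in> tangent_space A p \<and> v c \<in> range (fd (transition e c) (snd e p))"
      using differential_in[OF X(1) p] differential_chart[OF X(1) e c] by auto
  next
    assume v: "v \<in> tangent_space A p \<and> v c \<in> range (fd (transition e c) (snd e p))"
    then obtain u where u: "v c = fd (transition e c) (snd e p) u" by blast
    have X: "tvec B e p u \<in> tangent_space B p" by (rule sub.tvec_in[OF e])
    have "v = differential B A (\<lambda>p. p) p (tvec B e p u)"
      using v by (intro tangent_eqI[OF _ differential_in[OF X p] c])
        (auto simp: differential_chart[OF X e c] u sub.tvec_self[OF e])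
    then show "v \<in> sub_tangent A B p" unfolding sub_tangent_def using X by blast
  qed
qed

text \<open>These are the normal equations for projecting \<open>v\<close> onto the range of
  \<open>L\<close>. The Gram map \<open>T\<close> is injective because the metric is definite and
  \<open>L\<close> is injective, hence surjective in finite dimension.\<close>

lemma orthogonal_projection:
  fixes L :: "real^'l \<Rightarrow> real^'n"
  assumes c: "c \<in> A" "x \<in> snd c ` fst c" and L: "linear L" and inj: "\<And>u. L u = 0 \<Longrightarrow> u = 0"
  shows "\<exists>u. \<forall>z. gform A g c x (v - L u) (L z) = 0"
proof -
  define T where "T u = (\<chi> i. gform A g c x (L u) (L (axis i 1)))" for u
  have lin: "linear (\<lambda>z. gform A g c x w (L z))" for w
    using linear_compose[OF L linear_gform2[OF c]] by (simp add: comp_def)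
  have "linear T"
    by (rule linearI) (auto simp: T_def vec_eq_iff linear_add[OF L] linear_cmul[OF L]
        linear_add[OF linear_gform1[OF c]] linear_cmul[OF linear_gform1[OF c]])
  moreover have "inj T"
  proof (rule linear_injective_0[THEN iffD2, OF \<open>linear T\<close>], intro allI impI)
    fix u assume "T u = 0"
    then have "gform A g c x (L u) (L (axis i 1)) = 0" for i by (simp add: T_def vec_eq_iff)
    then have "gform A g c x (L u) (L u) = 0" by (subst linear_axis_expansion[OF lin]) simp
    then show "u = 0" using gform_self_zero[OF c] inj by blast
  qed
  ultimately have "surj T" by (rule linear_injective_imp_surjective) (rule refl)
  then obtain u where "T u = (\<chi> i. gform A g c x v (L (axis i 1)))" by (metis surjD)
  then have "gform A g c x (v - L u) (L (axis i 1)) = 0" for i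
    by (simp add: T_def vec_eq_iff linear_diff[OF linear_gform1[OF c]])
  then have "gform A g c x (v - L u) (L z) = 0" for z by (subst linear_axis_expansion[OF lin]) simp
  then show ?thesis by blast
qed

text \<open>Since \<open>normal_part\<close> is a definite description, its value can be used only
  once there is exactly one candidate. Orthogonal projection provides one; the difference of two
  candidates is both tangent and normal, hence zero.\<close>

lemma normal_part_zero_iff:
  assumes p: "p \<in> pts B" and v: "v \<in> tangent_space A p"
  shows "normal_part A g B p v = (\<lambda>_. 0) \<longleftrightarrow> v \<in> sub_tangent A B p"
proof -
  obtain e c where e: "e \<in> charts_at B p" and c: "c \<in> charts_at A p" using p pts_sub pts_iff by metis
  have cA: "c \<in> A" "snd c p \<in> snd c ` fst c" using c by (auto simp: charts_at_iff)
  define L where "L = fd (transition e c) (snd e p)"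
  have L: "linear L" unfolding L_def by (rule linear_inclusion[OF e c])
  note st = sub_tangent_iff[OF e c, folded L_def]
  define P where "P w \<longleftrightarrow> w \<in> tangent_space A p \<and> (\<forall>u\<in>sub_tangent A B p. g p w u = 0) \<and>
             (\<lambda>c. v c - w c) \<in> sub_tangent A B p" for w
  obtain u where u: "\<And>z. gform A g c (snd c p) (v c - L u) (L z) = 0"
    using orthogonal_projection[OF cA L inclusion_inj[OF e c, folded L_def]] by blast
  define w where "w = tvec A c p (v c - L u)"
  have w: "w \<in> tangent_space A p" "w c = v c - L u" unfolding w_def using tvec_in[OF c] tvec_self[OF c] by auto
  have Pw: "P w" unfolding P_def
  proof (intro conjI ballI w)
    fix t assume "t \<in> sub_tangent A B p"
    then obtain z where t: "t \<in> tangent_space A p" "t c = L z" using st by blast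
    show "g p w t = 0" using metric_gform[OF c w(1) t(1)] u by (simp add: w t)
  next
    show "(\<lambda>c. v c - w c) \<in> sub_tangent A B p"
      unfolding st using tangent_diff[OF v w(1)] w(2) by auto
  qed
  have unique: "w' = w" if "P w'" for w'
  proof -
    from that have w': "w' \<in> tangent_space A p" by (simp add: P_def)
    have "(\<lambda>c. v c - w' c) \<in> sub_tangent A B p" using that by (simp add: P_def)
    then obtain z where z: "v c - w' c = L z" unfolding st by auto
    have "w c - w' c = L (z - u)" using z w(2) by (simp add: linear_diff[OF L])
    then have t: "tvec A c p (w c - w' c) \<in> sub_tangent A B p"
      unfolding st using tvec_in[OF c] tvec_self[OF c] by auto
    have t': "tvec A c p (w c - w' c) \<in> tangent_space A p" using tvec_in[OF c] .
    have "g p w (tvec A c p (w c - w' c)) = 0" "g p w' (tvec A c p (w c - w' c)) = 0"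
      using Pw that t unfolding P_def by auto
    then have "gform A g c (snd c p) (w c - w' c) (w c - w' c) = 0"
      using metric_gform[OF c w(1) t'] metric_gform[OF c w' t'] tvec_self[OF c]
      by (simp add: linear_diff[OF linear_gform1[OF cA]])
    then have "w' c = w c" using gform_self_zero[OF cA] by fastforce
    then show ?thesis using tangent_eqI[OF w' w(1) c] by simp
  qed
  have "normal_part A g B p v = w"
    unfolding normal_part_def P_def[symmetric] by (rule the_equality) (auto intro: Pw unique)
  moreover have "w = (\<lambda>_. 0) \<longleftrightarrow> v \<in> sub_tangent A B p"
  proof
    assume "w = (\<lambda>_. 0)"
    then show "v \<in> sub_tangent A B p" using Pw unfolding P_def by simp
  next
    assume "v \<in> sub_tangent A B p"
    then have "P (\<lambda>_. 0)"
      unfolding P_def using tangent_zero metric_gform[OF c tangent_zero] linear_0[OF linear_gform1[OF cA]]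
      by (auto simp: st)
    then show "w = (\<lambda>_. 0)" using unique by simp
  qed
  ultimately show ?thesis by simp
qed

section \<open>The ambient covariant derivative along the submanifold\<close>

lemma cov_deriv_chart:
  assumes e: "e \<in> charts_at B p" and c: "c \<in> charts_at A p" and X: "X \<in> tangent_space B p"
    and Z: "(\<lambda>u. Z (chart_inv e u) c) differentiable (at (snd e p))"
  shows "cov_deriv A g B p X Z c = fd (\<lambda>u. Z (chart_inv e u) c) (snd e p) (X e)
     + gam A g c (snd c p) (fd (transition e c) (snd e p) (X e)) (Z p c)"
proof -
  have "dir_deriv B p X (\<lambda>q. Z q c $ a) = fd (\<lambda>u. Z (chart_inv e u) c) (snd e p) (X e) $ a" for a
  proof -
    have d: "((\<lambda>q. Z q c $ a) \<circ> chart_inv e has_derivative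
        (\<lambda>v. fd (\<lambda>u. Z (chart_inv e u) c) (snd e p) v $ a)) (at (snd e p))"
      using bounded_linear.has_derivative[OF bounded_linear_vec_nth fd_works[OF Z]] by (simp add: comp_def)
    then show ?thesis
      by (subst sub.dir_deriv_eq[OF X e]) (auto simp: fd_eqI differentiable_def)
  qed
  then show ?thesis
    using c by (simp add: cov_deriv_def gam_def vec_eq_iff differential_chart[OF X e c])
qed

text \<open>Differentiating the transformation law of \<open>Z\<close> produces a second derivative
  of the transition map, which cancels the one in \<open>gam_transition\<close>. The check is needed
  because \<open>normal_part_zero_iff\<close> speaks of elements of the tangent space only.\<close>

lemma cov_deriv_in:
  assumes e: "e \<in> charts_at B p" and X: "X \<in> tangent_space B p"
    and N: "open N" "snd e p \<in> N" "\<And>u. u \<in> N \<Longrightarrow> Z (chart_inv e u) \<in> tangent_space A (chart_inv e u)"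
    and Z: "\<And>c. c \<in> charts_at A p \<Longrightarrow> (\<lambda>u. Z (chart_inv e u) c) differentiable (at (snd e p))"
  shows "cov_deriv A g B p X Z \<in> tangent_space A p"
proof (rule tangentI)
  fix c d assume c: "c \<in> charts_at A p" and d: "d \<in> charts_at A p"
  have eB: "e \<in> B" "p \<in> fst e" and cA: "c \<in> A" "p \<in> fst c" and dA: "d \<in> A" "p \<in> fst d"
    using e c d by (auto simp: charts_at_iff)
  define x where "x = snd e p"
  define \<phi> where "\<phi> = transition c d"
  define f where "f = transition e c"
  define Zc where "Zc u = Z (chart_inv e u) c" for u
  define Zd where "Zd u = Z (chart_inv e u) d" for u
  have fx: "f x = snd c p" using eB by (simp add: f_def x_def)
  have x: "chart_inv e x = p" using eB by (simp add: x_def)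
  define V where "V = N \<inter> overlap e c \<inter> overlap e d"
  have V: "open V" "x \<in> V" unfolding V_def x_def
    using N(1,2) open_inclusion[OF eB(1) cA(1)] open_inclusion[OF eB(1) dA(1)]
      mem_overlap[OF eB(2) cA(2)] mem_overlap[OF eB(2) dA(2)] by auto
  \<comment> \<open>The transformation law is needed on a neighbourhood of \<open>x\<close>, as it
    is about to be differentiated.\<close>
  have ZV: "Zd u = fd \<phi> (f u) (Zc u)" if u: "u \<in> V" for u
  proof -
    obtain q where q: "q \<in> fst e" "q \<in> fst c" "u = snd e q" using u unfolding V_def by blast
    obtain q' where q': "q' \<in> fst e" "q' \<in> fst d" "u = snd e q'" using u unfolding V_def by blast
    have "q' = q" using q q' sub.chart_inv_snd[OF eB(1)] by metis
    moreover have "chart_inv e u = q" using q eB by simp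
    ultimately show ?thesis using N(3)[of u] u tangent_change[of "Z q" q c d] q q' cA dA
      by (simp add: Zc_def Zd_def f_def \<phi>_def V_def charts_at_iff)
  qed
  have ov: "open (overlap c d)" "f x \<in> overlap c d"
    using open_overlap[OF cA(1) dA(1)] mem_overlap[OF cA(2) dA(2)] fx by auto
  have sm: "smooth_on \<phi> (overlap c d)" unfolding \<phi>_def by (rule smooth_transition[OF cA(1) dA(1)])
  have df: "(f has_derivative fd f x) (at x)"
    unfolding f_def x_def by (rule fd_works[OF inclusion_differentiable[OF e c]])
  have dZ: "(Zc has_derivative fd Zc x) (at x)"
    unfolding Zc_def x_def by (rule fd_works[OF Z[OF c]])
  have "((\<lambda>u. fd \<phi> (f u) (Zc u)) has_derivative
      (\<lambda>v. fd (\<lambda>y. fd \<phi> y (Zc x)) (f x) (fd f x v) + fd \<phi> (f x) (fd Zc x v))) (at x)"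
    by (rule has_derivative_fd_apply[OF ov sm df dZ])
  then have "(Zd has_derivative
      (\<lambda>v. fd (\<lambda>y. fd \<phi> y (Zc x)) (f x) (fd f x v) + fd \<phi> (f x) (fd Zc x v))) (at x)"
    by (rule has_derivative_transform_within_open[OF _ V]) (simp add: ZV)
  then have D: "fd Zd x v = fd (\<lambda>y. fd \<phi> y (Zc x)) (f x) (fd f x v) + fd \<phi> (f x) (fd Zc x v)" for v
    by (simp add: fd_eqI)
  have G: "gam A g d (snd d p) (fd \<phi> (f x) a) (fd \<phi> (f x) b)
    = fd \<phi> (f x) (gam A g c (snd c p) a b) - fd (\<lambda>y. fd \<phi> y b) (f x) a" for a b
    using gam_transition[OF c d] by (simp add: fx \<phi>_def)
  have lin: "linear (fd \<phi> (f x))" using fd_transition_linear[OF c d] by (simp add: fx \<phi>_def)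
  have fd': "fd (transition e d) x v = fd \<phi> (f x) (fd f x v)" for v
    using fd_inclusion_compose[OF e c d] eB by (simp add: x_def f_def \<phi>_def)
  have "cov_deriv A g B p X Z d = fd Zd x (X e) + gam A g d (snd d p) (fd (transition e d) x (X e)) (Zd x)"
    using cov_deriv_chart[where Z=Z, OF e d X Z[OF d]] x by (simp add: Zd_def[abs_def] x_def)
  also have "\<dots> = fd \<phi> (f x) (fd Zc x (X e) + gam A g c (snd c p) (fd f x (X e)) (Zc x))"
    unfolding fd' ZV[OF V(2)] D G by (simp add: linear_add[OF lin])
  also have "fd Zc x (X e) + gam A g c (snd c p) (fd f x (X e)) (Zc x) = cov_deriv A g B p X Z c"
    using cov_deriv_chart[where Z=Z, OF e c X Z[OF c]] x by (simp add: Zc_def[abs_def] x_def f_def)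
  finally show "cov_deriv A g B p X Z d = fd (transition c d) (snd c p) (cov_deriv A g B p X Z c)"
    unfolding \<phi>_def[symmetric] fx .
qed (simp add: cov_deriv_def)

section \<open>The second fundamental form and total geodesy in charts\<close>

lemma vector_field_chart:
  assumes Y: "vector_field_on W B Y" and e: "e \<in> B"
  shows "open (snd e ` (fst e \<inter> W))" "smooth_on (\<lambda>u. Y (chart_inv e u) e) (snd e ` (fst e \<inter> W))"
proof -
  have "openin (atlas_topology B) W" using Y by (simp add: vector_field_on_def smooth_map_on_def)
  then show o: "open (snd e ` (fst e \<inter> W))"
    using e openin_atlas_topology[OF sub.smooth_atlas] by (auto simp: Int_commute)
  have tan: "Y q \<in> tangent_space B q" if "q \<in> W" for q using that Y by (simp add: vector_field_on_def)
  have "induced_chart B e \<in> tangent_bundle B" using e by (simp add: tangent_bundle_def)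
  then have "smooth_on (snd (induced_chart B e) \<circ> (\<lambda>p. (p, Y p)) \<circ> chart_inv e)
      (snd e ` (fst e \<inter> W \<inter> (\<lambda>p. (p, Y p)) -` fst (induced_chart B e)))"
    using Y e unfolding vector_field_on_def smooth_map_on_def by blast
  moreover have "fst e \<inter> W \<inter> (\<lambda>p. (p, Y p)) -` fst (induced_chart B e) = fst e \<inter> W"
    using tan by (auto simp: fst_induced_chart)
  ultimately have "smooth_on (snd (induced_chart B e) \<circ> (\<lambda>p. (p, Y p)) \<circ> chart_inv e) (snd e ` (fst e \<inter> W))"
    by simp
  from smooth_on_bounded_linear[OF o bl_parts(2) this]
  show "smooth_on (\<lambda>u. Y (chart_inv e u) e) (snd e ` (fst e \<inter> W))"
    by (simp add: snd_induced_chart comp_def)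
qed

text \<open>Differentiating the components of \<open>Y\<close> contributes a vector in the range of
  the derivative of the inclusion, which is irrelevant modulo tangent vectors. What remains depends
  only on the values of \<open>X\<close> and \<open>Y\<close> at \<open>p\<close>.\<close>

lemma second_fundamental_form_zero_iff:
  assumes X: "vector_field_on W B X" and Y: "vector_field_on W B Y" and p: "p \<in> W"
    and e: "e \<in> charts_at B p" and c: "c \<in> charts_at A p"
  shows "second_fundamental_form A g B p X Y = (\<lambda>_. 0) \<longleftrightarrow>
    accel A g e c (snd e p) (X p e) (Y p e) \<in> range (fd (transition e c) (snd e p))"
proof -
  have eB: "e \<in> B" "p \<in> fst e" and cA: "c \<in> A" "p \<in> fst c" using e c by (auto simp: charts_at_iff)
  have pB: "p \<in> pts B" using e pts_iff by metis
  have tanX: "X p \<in> tangent_space B p" using X p by (simp add: vector_field_on_def)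
  have tanY: "Y q \<in> tangent_space B q" if "q \<in> W" for q using that Y by (simp add: vector_field_on_def)
  define x where "x = snd e p"
  define N where "N = snd e ` (fst e \<inter> W)"
  have N: "open N" "x \<in> N" using vector_field_chart(1)[OF Y eB(1)] p eB by (auto simp: N_def x_def)
  define y where "y u = Y (chart_inv e u) e" for u
  have sy: "smooth_on y N" using vector_field_chart(2)[OF Y eB(1)] by (simp add: y_def[abs_def] N_def)
  have dy: "(y has_derivative fd y x) (at x)" by (rule fd_works[OF smooth_on_differentiable[OF sy N(2)]])
  define Z where "Z q = differential B A (\<lambda>p. p) q (Y q)" for q
  have Ntan: "Z (chart_inv e u) \<in> tangent_space A (chart_inv e u)" if "u \<in> N" for u
  proof -
    obtain q where "q \<in> fst e" "q \<in> W" "u = snd e q" using \<open>u \<in> N\<close> unfolding N_def by blast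
    then show ?thesis using eB differential_in[OF tanY, of q] pts_iff[of q B] unfolding Z_def
      by (metis charts_at_iff sub.chart_inv_snd)
  qed
  have Zd: "((\<lambda>u. Z (chart_inv e u) d) has_derivative
       (\<lambda>v. fd (\<lambda>z. fd (transition e d) z (y x)) x v + fd (transition e d) x (fd y x v))) (at x)"
    if d: "d \<in> charts_at A p" for d
  proof -
    have dA: "d \<in> A" "p \<in> fst d" using d by (auto simp: charts_at_iff)
    have ov: "open (overlap e d)" "x \<in> overlap e d"
      using open_inclusion[OF eB(1) dA(1)] mem_overlap[OF eB(2) dA(2)] by (auto simp: x_def)
    have "((\<lambda>u. fd (transition e d) u (y u)) has_derivative
       (\<lambda>v. fd (\<lambda>z. fd (transition e d) z (y x)) x v + fd (transition e d) x (fd y x v))) (at x)"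
      by (rule has_derivative_fd_apply[where h="\<lambda>u. u", OF ov smooth_inclusion[OF eB(1) dA(1)] has_derivative_ident dy])
    then show ?thesis
    proof (rule has_derivative_transform_within_open[where s="N \<inter> overlap e d"])
      show "open (N \<inter> overlap e d)" "x \<in> N \<inter> overlap e d" using N ov by auto
      fix u assume u: "u \<in> N \<inter> overlap e d"
      then obtain q where q: "q \<in> fst e" "q \<in> W" "u = snd e q" unfolding N_def by blast
      from u obtain q' where q': "q' \<in> fst e" "q' \<in> fst d" "u = snd e q'" by blast
      have "q' = q" using q q' sub.chart_inv_snd[OF eB(1)] by metis
      then show "fd (transition e d) u (y u) = Z (chart_inv e u) d"
        using differential_chart[OF tanY[OF q(2)], of e d] q q' eB dA by (simp add: Z_def y_def charts_at_iff)
    qed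
  qed
  have Zdiff: "(\<lambda>u. Z (chart_inv e u) d) differentiable (at (snd e p))" if "d \<in> charts_at A p" for d
    using Zd[OF that] unfolding x_def differentiable_def by blast
  have Zp: "Z p c = fd (transition e c) x (Y p e)"
    unfolding Z_def x_def by (rule differential_chart[OF tanY[OF p] e c])
  have yx: "y x = Y p e" using eB by (simp add: y_def x_def)
  have lin: "linear (fd (transition e c) x)" unfolding x_def by (rule linear_inclusion[OF e c])
  have "cov_deriv A g B p (X p) Z c = accel A g e c x (X p e) (Y p e) + fd (transition e c) x (fd y x (X p e))"
    using cov_deriv_chart[where Z=Z, OF e c tanX Zdiff[OF c]] Zp fd_eqI[OF Zd[OF c]] yx eB
    by (simp add: accel_def x_def)
  moreover have "a + fd (transition e c) x b \<in> range (fd (transition e c) x) \<longleftrightarrow> a \<in> range (fd (transition e c) x)" for a b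
  proof
    assume "a + fd (transition e c) x b \<in> range (fd (transition e c) x)"
    then obtain z where "a + fd (transition e c) x b = fd (transition e c) x z" by blast
    then have "a = fd (transition e c) x (z - b)" by (simp add: linear_diff[OF lin] algebra_simps)
    then show "a \<in> range (fd (transition e c) x)" by blast
  next
    assume "a \<in> range (fd (transition e c) x)"
    then obtain z where "a = fd (transition e c) x z" by blast
    then have "a + fd (transition e c) x b = fd (transition e c) x (z + b)" by (simp add: linear_add[OF lin])
    then show "a + fd (transition e c) x b \<in> range (fd (transition e c) x)" by blast
  qed
  moreover have "cov_deriv A g B p (X p) Z \<in> tangent_space A p"
    using N Ntan Zdiff by (intro cov_deriv_in[OF e tanX, of N]) (auto simp: x_def)
  ultimately show ?thesis
    unfolding second_fundamental_form_def Z_def[symmetric]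
    using normal_part_zero_iff[OF pB, of "cov_deriv A g B p (X p) Z"] sub_tangent_iff[OF e c, of "cov_deriv A g B p (X p) Z"]
    by (simp add: x_def)
qed

text \<open>Total geodesy quantifies over local vector fields. These fields realise any prescribed
  components at a point of the chart domain, and they are smooth because the transition maps
  are.\<close>

lemma constant_vector_field:
  assumes e: "e \<in> B"
  shows "vector_field_on (fst e) B (\<lambda>q. tvec B e q v)"
proof -
  have tan: "tvec B e q v \<in> tangent_space B q" if "q \<in> fst e" for q
    using that e by (intro sub.tvec_in) (simp add: charts_at_iff)
  have pts: "q \<in> pts B" if "q \<in> fst e" for q using that e by (auto simp: pts_def)
  show ?thesis
    unfolding vector_field_on_def smooth_map_on_def
  proof (intro conjI ballI)
    show "openin (atlas_topology B) (fst e)"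
      unfolding openin_atlas_topology[OF sub.smooth_atlas]
      using pts e sub.open_overlap[of _ e] by (auto simp: Int_commute)
    show "(\<lambda>p. (p, tvec B e p v)) ` fst e \<subseteq> pts (tangent_bundle B)"
      using tan e unfolding pts_def tangent_bundle_def by (force simp: fst_induced_chart)
  next
    fix c d' assume c: "c \<in> B" and "d' \<in> tangent_bundle B"
    then obtain d where d: "d \<in> B" "d' = induced_chart B d" by (auto simp: tangent_bundle_def)
    let ?S = "snd c ` (fst c \<inter> fst e \<inter> (\<lambda>p. (p, tvec B e p v)) -` fst d')"
    have S: "?S = overlap c e \<inter> overlap c d"
    proof -
      have "fst c \<inter> fst e \<inter> (\<lambda>p. (p, tvec B e p v)) -` fst d' = (fst c \<inter> fst e) \<inter> (fst c \<inter> fst d)"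
        using tan by (auto simp: d(2) fst_induced_chart)
      also have "snd c ` \<dots> = overlap c e \<inter> overlap c d"
        by (rule inj_on_image_Int[OF sub.inj_chart[OF c]]) auto
      finally show ?thesis .
    qed
    have oS: "open (overlap c e \<inter> overlap c d)" using sub.open_overlap[OF c e] sub.open_overlap[OF c d(1)] by (rule open_Int)
    show "open ?S" unfolding S by (rule oS)
    have sub: "overlap c e \<inter> overlap c d \<subseteq> overlap c e" "overlap c e \<inter> overlap c d \<subseteq> overlap c d" by auto
    have im: "transition c e ` (overlap c e \<inter> overlap c d) \<subseteq> overlap e d"
    proof
      fix z assume "z \<in> transition c e ` (overlap c e \<inter> overlap c d)"
      then obtain u where u: "u \<in> overlap c e" "u \<in> overlap c d" "z = transition c e u" by blast
      obtain q where q: "q \<in> fst c" "q \<in> fst e" "u = snd c q" using u(1) by blast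
      obtain q' where q': "q' \<in> fst c" "q' \<in> fst d" "u = snd c q'" using u(2) by blast
      have "q' = q" using q q' sub.chart_inv_snd[OF c] by metis
      then show "z \<in> overlap e d" using u(3) q q' c by auto
    qed
    have "smooth_on (\<lambda>u. join (transition c d u) (fd (transition e d) (transition c e u) v)) (overlap c e \<inter> overlap c d)"
      using smooth_on_subset[OF sub.smooth_transition[OF c d(1)] sub(2)]
        smooth_on_subset[OF sub.smooth_transition[OF c e] sub(1)]
      by (intro smooth_on_join oS smooth_on_fd_apply[OF sub.open_overlap[OF e d(1)] oS sub.smooth_transition[OF e d(1)] im]
          smooth_on_const)
    then show "smooth_on (snd d' \<circ> (\<lambda>p. (p, tvec B e p v)) \<circ> chart_inv c) ?S"
      unfolding S
    proof (rule smooth_on_cong[OF oS, rotated])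
      fix u assume u: "u \<in> overlap c e \<inter> overlap c d"
      obtain q where q: "q \<in> fst c" "q \<in> fst e" "u = snd c q" using u by blast
      obtain q' where q': "q' \<in> fst c" "q' \<in> fst d" "u = snd c q'" using u by blast
      have "q' = q" using q q' sub.chart_inv_snd[OF c] by metis
      then show "join (transition c d u) (fd (transition e d) (transition c e u) v)
          = (snd d' \<circ> (\<lambda>p. (p, tvec B e p v)) \<circ> chart_inv c) u"
        using q q' c d by (simp add: snd_induced_chart tvec_def charts_at_iff)
    qed
  qed (rule tan)
qed

lemma totally_geodesic_imp_accel:
  assumes "totally_geodesic A g B" and e: "e \<in> charts_at B p" and c: "c \<in> charts_at A p"
  shows "accel A g e c (snd e p) v w \<in> range (fd (transition e c) (snd e p))"
proof -
  have eB: "e \<in> B" "p \<in> fst e" using e by (auto simp: charts_at_iff)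
  note X = constant_vector_field[OF eB(1), of v] and Y = constant_vector_field[OF eB(1), of w]
  have "second_fundamental_form A g B p (\<lambda>q. tvec B e q v) (\<lambda>q. tvec B e q w) = (\<lambda>_. 0)"
    using assms(1) X Y eB(2) unfolding totally_geodesic_def by blast
  then show ?thesis
    using second_fundamental_form_zero_iff[OF X Y eB(2) e c] sub.tvec_self[OF e] by simp
qed

text \<open>Symmetry of second derivatives and of the Christoffel symbols makes \<open>accel\<close>
  symmetric and bilinear in \<open>v\<close> and \<open>w\<close>, so the diagonal determines it.
  The Sasaki computation can therefore be confined to equal arguments.\<close>

lemma accel_polar:
  assumes e: "e \<in> charts_at B p" and c: "c \<in> charts_at A p"
  shows "accel A g e c (snd e p) v w = (1/2) *\<^sub>R (accel A g e c (snd e p) (v + w) (v + w)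
     - accel A g e c (snd e p) v v - accel A g e c (snd e p) w w)"
proof -
  have eB: "e \<in> B" "p \<in> fst e" and cA: "c \<in> A" "p \<in> fst c" using e c by (auto simp: charts_at_iff)
  define x where "x = snd e p"
  define f where "f = transition e c"
  have fx: "f x \<in> snd c ` fst c" using eB cA by (simp add: f_def x_def)
  have ov: "open (overlap e c)" "x \<in> overlap e c"
    using open_inclusion[OF eB(1) cA(1)] mem_overlap[OF eB(2) cA(2)] by (auto simp: x_def)
  have sm: "smooth_on f (overlap e c)" unfolding f_def by (rule smooth_inclusion[OF eB(1) cA(1)])
  have lin: "linear (fd f x)" by (rule fd_linear[OF smooth_on_differentiable[OF sm ov(2)]])
  have l1: "linear (fd (\<lambda>u. fd f u w) x)" for w
    by (rule fd_linear[OF smooth_on_differentiable[OF smooth_on_fd[OF ov(1) sm] ov(2)]])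
  have s: "fd (\<lambda>u. fd f u w) x v = fd (\<lambda>u. fd f u v) x w" for v w
    by (rule second_derivative_symmetric[OF ov sm])
  have "fd (\<lambda>u. fd f u (v + w)) x (v + w) = fd (\<lambda>u. fd f u v) x v + fd (\<lambda>u. fd f u w) x w + 2 *\<^sub>R fd (\<lambda>u. fd f u w) x v"
    using s[of "v + w" v] s[of "v + w" w] s[of v w] by (simp add: linear_add[OF l1] scaleR_2 s[of _ "v + w"])
  moreover have "gam A g c (f x) (fd f x (v + w)) (fd f x (v + w)) = gam A g c (f x) (fd f x v) (fd f x v)
     + gam A g c (f x) (fd f x w) (fd f x w) + 2 *\<^sub>R gam A g c (f x) (fd f x v) (fd f x w)"
    using gam_sym[OF cA(1) fx, of "fd f x w" "fd f x v"]
    by (simp add: linear_add[OF lin] linear_add[OF linear_gam1] linear_add[OF linear_gam2] scaleR_2)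
  ultimately have "accel A g e c x (v + w) (v + w) = accel A g e c x v v + accel A g e c x w w + 2 *\<^sub>R accel A g e c x v w"
    unfolding accel_def f_def by (simp add: algebra_simps)
  then show ?thesis unfolding x_def by simp
qed

text \<open>The range of the derivative is a subspace, so polarisation leads from the diagonal to
  all pairs. One pair of charts at each point decides, since the criterion for the second
  fundamental form holds in every pair.\<close>

lemma accel_imp_totally_geodesic:
  assumes "\<And>p. p \<in> pts B \<Longrightarrow> \<exists>e\<in>charts_at B p. \<exists>c\<in>charts_at A p. \<forall>v.
    accel A g e c (snd e p) v v \<in> range (fd (transition e c) (snd e p))"
  shows "totally_geodesic A g B"
  unfolding totally_geodesic_def
proof (intro conjI submanifold allI impI ballI)
  fix W X Y p assume XY: "vector_field_on W B X \<and> vector_field_on W B Y" and p: "p \<in> W"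
  then have "p \<in> pts B"
    using openin_atlas_topology[OF sub.smooth_atlas] by (auto simp: vector_field_on_def smooth_map_on_def)
  from assms[OF this] obtain e c where e: "e \<in> charts_at B p" and c: "c \<in> charts_at A p"
    and *: "\<And>v. accel A g e c (snd e p) v v \<in> range (fd (transition e c) (snd e p))" by blast
  have "subspace (range (fd (transition e c) (snd e p)))"
    using subspace_UNIV linear_subspace_image[OF linear_inclusion[OF e c]] by blast
  then have "accel A g e c (snd e p) v w \<in> range (fd (transition e c) (snd e p))" for v w
    by (subst accel_polar[OF e c]) (intro subspace_scale subspace_diff *)
  then show "second_fundamental_form A g B p X Y = (\<lambda>_. 0)"
    using second_fundamental_form_zero_iff[of W X Y p e c] XY p e c by simp
qed

end

subsection \<open>The tangent bundle\<close>

lemma charts_at_tangent_bundle: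
  "d \<in> charts_at (tangent_bundle A) z \<longleftrightarrow>
    snd z \<in> tangent_space A (fst z) \<and> (\<exists>c\<in>charts_at A (fst z). d = induced_chart A c)"
  by (auto simp: charts_at_def tangent_bundle_def fst_induced_chart simp del: split_paired_All split_paired_Ex)

lemma pts_tangent_bundle:
  "z \<in> pts (tangent_bundle A) \<longleftrightarrow> fst z \<in> pts A \<and> snd z \<in> tangent_space A (fst z)"
  unfolding pts_iff charts_at_tangent_bundle by blast

context atlas
begin

text \<open>The fibre coordinate is unrestricted, because \<open>tvec\<close> supplies a tangent
  vector with any given components; only the base coordinate has to lie in the overlap.\<close>

lemma induced_chart_image:
  assumes "c \<in> A" "d \<in> A"
  shows "overlap (induced_chart A c) (induced_chart A d) = lpart -` overlap c d"
proof
  show "overlap (induced_chart A c) (induced_chart A d) \<subseteq> lpart -` overlap c d"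
    by (auto simp: snd_induced_chart fst_induced_chart)
next
  show "lpart -` overlap c d \<subseteq> overlap (induced_chart A c) (induced_chart A d)"
  proof
    fix y :: "real^('n + 'n)" assume "y \<in> lpart -` overlap c d"
    then obtain q where q: "q \<in> fst c" "q \<in> fst d" "lpart y = snd c q" by blast
    have c: "c \<in> charts_at A q" using q assms by (simp add: charts_at_iff)
    have "y = snd (induced_chart A c) (q, tvec A c q (rpart y))"
      using join_parts[of y] by (simp add: snd_induced_chart tvec_self[OF c] q(3))
    moreover have "(q, tvec A c q (rpart y)) \<in> fst (induced_chart A c) \<inter> fst (induced_chart A d)"
      using q tvec_in[OF c] by (simp add: fst_induced_chart)
    ultimately show "y \<in> overlap (induced_chart A c) (induced_chart A d)" by blast
  qed
qed

lemma induced_chart_dom: "c \<in> A \<Longrightarrow> snd (induced_chart A c) ` fst (induced_chart A c) = lpart -` (snd c ` fst c)"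
  using induced_chart_image[of c c] by simp

lemma induced_chart_inj:
  assumes c: "c \<in> A"
  shows "inj_on (snd (induced_chart A c)) (fst (induced_chart A c))"
proof (rule inj_onI)
  fix z z' assume z: "z \<in> fst (induced_chart A c)" "z' \<in> fst (induced_chart A c)"
    and eq: "snd (induced_chart A c) z = snd (induced_chart A c) z'"
  have "snd c (fst z) = snd c (fst z')" and v: "snd z c = snd z' c"
    using arg_cong[OF eq, of lpart] arg_cong[OF eq, of rpart] by (simp_all add: snd_induced_chart)
  then have p: "fst z = fst z'"
    using inj_onD[OF inj_chart[OF c]] z by (simp add: fst_induced_chart)
  have "snd z = snd z'"
    using z p c v by (intro tangent_eqI[of "snd z" "fst z" "snd z'" c]) (auto simp: fst_induced_chart charts_at_iff)
  with p show "z = z'" by (simp add: prod_eq_iff)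
qed

lemma induced_chart_inv:
  assumes c: "c \<in> A" and y: "lpart y \<in> snd c ` fst c"
  shows "chart_inv (induced_chart A c) y = (chart_inv c (lpart y), tvec A c (chart_inv c (lpart y)) (rpart y))"
proof -
  let ?z = "(chart_inv c (lpart y), tvec A c (chart_inv c (lpart y)) (rpart y))"
  have c': "c \<in> charts_at A (chart_inv c (lpart y))" using c chart_inv_in[OF y] by (simp add: charts_at_iff)
  have "?z \<in> fst (induced_chart A c)" using c' tvec_in[OF c'] by (simp add: fst_induced_chart charts_at_iff)
  moreover have "snd (induced_chart A c) ?z = y"
    using join_parts[of y] by (simp add: snd_induced_chart tvec_self[OF c'] snd_chart_inv[OF y])
  ultimately show ?thesis unfolding chart_inv_def[of "induced_chart A c"]
    using inv_into_f_f[OF induced_chart_inj[OF c]] by metis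
qed

lemma induced_transition:
  assumes c: "c \<in> A" and d: "d \<in> A" and y: "lpart y \<in> overlap c d"
  shows "transition (induced_chart A c) (induced_chart A d) y
    = join (transition c d (lpart y)) (fd (transition c d) (lpart y) (rpart y))"
proof -
  obtain q where q: "q \<in> fst c" "q \<in> fst d" "lpart y = snd c q" using y by blast
  then show ?thesis
    using induced_chart_inv[OF c, of y] c d by (simp add: snd_induced_chart tvec_def charts_at_iff)
qed

lemma atlas_tangent_bundle: "atlas (tangent_bundle A)"
proof (unfold_locales, unfold smooth_atlas_def, intro conjI ballI)
  fix c assume "c \<in> tangent_bundle A"
  then show "inj_on (snd c) (fst c)" using induced_chart_inj by (auto simp: tangent_bundle_def)
next
  fix c' d' assume "c' \<in> tangent_bundle A" "d' \<in> tangent_bundle A"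
  then obtain c d where c: "c \<in> A" "c' = induced_chart A c" and d: "d \<in> A" "d' = induced_chart A d"
    unfolding tangent_bundle_def by blast
  have o: "open ((lpart :: real^('n + 'n) \<Rightarrow> real^'n) -` overlap c d)"
    using open_overlap[OF c(1) d(1)] by (intro open_vimage linear_continuous_on[OF bl_parts(1)])
  then show "open (overlap c' d')"
    unfolding c(2) d(2) induced_chart_image[OF c(1) d(1)] .
  let ?\<phi> = "transition c d"
  note sm = smooth_transition[OF c(1) d(1)] and oc = open_overlap[OF c(1) d(1)]
  have im: "lpart ` (lpart -` overlap c d) \<subseteq> overlap c d" by (rule image_vimage_subset)
  have "smooth_on (\<lambda>y. join (?\<phi> (lpart y)) (fd ?\<phi> (lpart y) (rpart y))) (lpart -` overlap c d)"
    by (rule smooth_on_join[OF o smooth_on_compose[OF o oc im smooth_on_linear[OF bl_parts(1)] sm]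
          smooth_on_fd_apply[OF oc o sm im smooth_on_linear[OF bl_parts(1)] smooth_on_linear[OF bl_parts(2)]]])
  then show "smooth_on (transition c' d') (overlap c' d')"
    unfolding c(2) d(2) induced_chart_image[OF c(1) d(1)]
    by (rule smooth_on_cong[OF o, rotated])
      (simp add: induced_transition[OF c(1) d(1)] del: comp_apply)
qed

text \<open>Moving the base point also changes the derivative that acts on the fibre coordinate. The
  resulting second-derivative term is what keeps the fibre part of a vector from being tensorial;
  the connection map compensates for it.\<close>

lemma fd_induced_transition:
  assumes c: "c \<in> A" and d: "d \<in> A" and y: "lpart y \<in> overlap c d"
  shows "fd (transition (induced_chart A c) (induced_chart A d)) y V
    = join (fd (transition c d) (lpart y) (lpart V))
        (fd (\<lambda>x. fd (transition c d) x (rpart y)) (lpart y) (lpart V) + fd (transition c d) (lpart y) (rpart V))"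
proof -
  let ?\<phi> = "transition c d"
  have o: "open ((lpart :: real^('n + 'n) \<Rightarrow> real^'n) -` overlap c d)"
    using open_overlap[OF c d] by (intro open_vimage linear_continuous_on[OF bl_parts(1)])
  have l: "(lpart has_derivative lpart) (at y)" "(rpart has_derivative rpart) (at y)"
    by (rule bounded_linear_imp_has_derivative bl_parts)+
  note sm = smooth_transition[OF c d]
  have "((\<lambda>y. join (?\<phi> (lpart y)) (fd ?\<phi> (lpart y) (rpart y))) has_derivative (\<lambda>V. join (fd ?\<phi> (lpart y) (lpart V))
        (fd (\<lambda>x. fd ?\<phi> x (rpart y)) (lpart y) (lpart V) + fd ?\<phi> (lpart y) (rpart V)))) (at y)"
    by (intro has_derivative_join has_derivative_fd_apply[where h=lpart, OF open_overlap[OF c d] y sm] l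
        has_derivative_compose[OF l(1) fd_works[OF smooth_on_differentiable[OF sm y]]])
  then have "(transition (induced_chart A c) (induced_chart A d) has_derivative (\<lambda>V. join (fd ?\<phi> (lpart y) (lpart V))
        (fd (\<lambda>x. fd ?\<phi> x (rpart y)) (lpart y) (lpart V) + fd ?\<phi> (lpart y) (rpart V)))) (at y)"
  proof (rule has_derivative_transform_within_open[OF _ o])
    show "y \<in> lpart -` overlap c d" using y by simp
  qed (simp add: induced_transition[OF c d] del: comp_apply)
  then show ?thesis by (simp add: fd_eqI)
qed

end


subsection \<open>Differentiability of the Christoffel symbols\<close>

lemma prod_differentiable:
  fixes f :: "'i \<Rightarrow> 'a::real_normed_vector \<Rightarrow> real"
  assumes "finite I" "\<And>i. i \<in> I \<Longrightarrow> f i differentiable (at x)"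
  shows "(\<lambda>y. \<Prod>i\<in>I. f i y) differentiable (at x)"
  using assms by (induction I rule: finite_induct) (auto intro!: differentiable_mult)

lemma det_differentiable:
  fixes G :: "'a::real_normed_vector \<Rightarrow> real^'n^'n::finite"
  assumes "\<And>i j. (\<lambda>y. G y $ i $ j) differentiable (at x)"
  shows "(\<lambda>y. det (G y)) differentiable (at x)"
proof -
  have "(\<lambda>y. \<Prod>i\<in>UNIV. G y $ i $ p i) differentiable (at x)" for p
    by (rule prod_differentiable) (simp_all add: assms)
  then show ?thesis
    unfolding det_def by (intro differentiable_sum differentiable_mult differentiable_const) auto
qed

text \<open>By Cramer's rule an entry of the inverse is a quotient of two determinants, and
  determinants are polynomials in the entries.\<close>

lemma matrix_inv_differentiable:
  fixes G :: "'a::real_normed_vector \<Rightarrow> real^'n^'n::finite"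
  assumes S: "open S" "x \<in> S" and inv: "\<And>y. y \<in> S \<Longrightarrow> matrix_inv (G y) ** G y = mat 1"
    and d: "\<And>i j. (\<lambda>y. G y $ i $ j) differentiable (at x)"
  shows "(\<lambda>y. matrix_inv (G y) $ k $ j) differentiable (at x)"
proof (rule differentiable_cong_open[OF S])
  let ?N = "\<lambda>y. \<chi> i l. if l = k then axis j 1 $ i else G y $ i $ l"
  have det0: "det (G y) \<noteq> 0" if "y \<in> S" for y
    using inv[OF that] invertible_det_nz invertible_left_inverse by blast
  have "(\<lambda>y. det (?N y)) differentiable (at x)"
  proof (rule det_differentiable)
    fix i l
    show "(\<lambda>y. ?N y $ i $ l) differentiable (at x)" using d[of i l] by (cases "l = k") auto
  qed
  then show "(\<lambda>y. det (?N y) / det (G y)) differentiable (at x)"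
    by (rule differentiable_divide[OF _ det_differentiable[OF d] det0[OF S(2)]])
  fix y assume y: "y \<in> S"
  have "G y *v (matrix_inv (G y) *v axis j 1) = axis j 1"
    using inv[OF y] matrix_left_right_inverse by (metis matrix_vector_mul_assoc matrix_vector_mul_lid)
  then have "matrix_inv (G y) *v axis j 1 =
      (\<chi> k. det (\<chi> i l. if l = k then axis j 1 $ i else G y $ i $ l) / det (G y))"
    using cramer[OF det0[OF y]] by blast
  then have "(matrix_inv (G y) *v axis j 1) $ k = det (?N y) / det (G y)" by simp
  then show "det (?N y) / det (G y) = matrix_inv (G y) $ k $ j"
    by (simp add: matrix_vector_mult_basis column_def)
qed

text \<open>Differentiability of the Christoffel symbols takes second derivatives of the metric,
  more than \<open>riem\<close> provides. It is what makes the Sasaki metric differentiable.\<close>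

locale riem_smooth = riem A g for A :: "('p, 'n::finite) atlas" and g :: "('p, 'n) metric" +
  assumes metric_smooth: "c \<in> A \<Longrightarrow> smooth_on (\<lambda>x. metric_matrix A g c x $ a $ b) (snd c ` fst c)"
begin

abbreviation dgam where "dgam c x v u w \<equiv> fd (\<lambda>y. gam A g c y u w) x v"

lemma gam_differentiable:
  assumes c: "c \<in> A" and x: "x \<in> snd c ` fst c"
  shows "(\<lambda>y. gam A g c y u w) differentiable (at x)"
proof -
  let ?G = "metric_matrix A g c"
  have "(\<lambda>y. partial_deriv b (\<lambda>y. ?G y $ i $ j) y) differentiable (at x)" for b i j
    unfolding partial_deriv_def
    by (rule smooth_on_differentiable[OF smooth_on_fd[OF open_dom[OF c] metric_smooth[OF c]] x])
  moreover have "(\<lambda>y. matrix_inv (?G y) $ a $ e) differentiable (at x)" for a e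
    by (rule matrix_inv_differentiable[OF open_dom[OF c] x metric_matrix_inv[OF c] metric_diff[OF c x]])
  ultimately have "(\<lambda>y. christoffel A g c y a b d) differentiable (at x)" for a b d
    unfolding christoffel_def Let_def
    by (intro differentiable_divide differentiable_sum differentiable_mult differentiable_add differentiable_diff)
      auto
  then have "(\<lambda>y. \<Sum>b\<in>UNIV. \<Sum>d\<in>UNIV. christoffel A g c y a b d * u $ b * w $ d) differentiable (at x)" for a
    by (intro differentiable_sum differentiable_mult differentiable_const) auto
  then show ?thesis
    unfolding gam_def differentiable_componentwise_within[where f="\<lambda>y. vec_lambda (f y)" for f]
    by (auto simp: Basis_vec_def inner_axis)
qed

lemma gam_has_derivative:
  assumes c: "c \<in> A" "h x \<in> snd c ` fst c"
    and h: "(h has_derivative h') (at x)"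
    and a: "(a has_derivative a') (at x)" and b: "(b has_derivative b') (at x)"
  shows "((\<lambda>y. gam A g c (h y) (a y) (b y)) has_derivative
    (\<lambda>v. dgam c (h x) (h' v) (a x) (b x) + gam A g c (h x) (a' v) (b x)
      + gam A g c (h x) (a x) (b' v))) (at x)"
proof (rule has_derivative_bilinear_family[where S="snd c ` fst c" and B="gam A g c"])
  show "open (snd c ` fst c)" by (rule open_dom[OF c(1)])
qed (rule c(2) linear_gam1 linear_gam2 gam_differentiable[OF c] h a b)+


subsection \<open>The Sasaki metric in induced charts\<close>

interpretation TB: atlas "tangent_bundle A"
  by (rule atlas_tangent_bundle)

context
  fixes z X
  assumes z: "z \<in> pts (tangent_bundle A)" and X: "X \<in> tangent_space (tangent_bundle A) z"
begin

lemma charts_TB: "c \<in> charts_at A (fst z) \<Longrightarrow> induced_chart A c \<in> charts_at (tangent_bundle A) z"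
  using z unfolding charts_at_tangent_bundle pts_tangent_bundle by blast

lemma TB_change:
  assumes c: "c \<in> charts_at A (fst z)" and d: "d \<in> charts_at A (fst z)"
  shows "X (induced_chart A d) = join (fd (transition c d) (snd c (fst z)) (lpart (X (induced_chart A c))))
    (fd (\<lambda>x. fd (transition c d) x (snd z c)) (snd c (fst z)) (lpart (X (induced_chart A c)))
      + fd (transition c d) (snd c (fst z)) (rpart (X (induced_chart A c))))"
proof -
  have "c \<in> A" "d \<in> A" "snd c (fst z) \<in> overlap c d" using c d by (auto simp: charts_at_iff)
  then show ?thesis
    using TB.tangent_change[OF X charts_TB[OF c] charts_TB[OF d]]
      fd_induced_transition[of c d "snd (induced_chart A c) z"]
    by (simp add: snd_induced_chart)
qed

text \<open>In induced coordinates the projection is \<open>lpart\<close>, a linear map and so its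
  own derivative.\<close>

lemma horizontal_chart:
  assumes c: "c \<in> charts_at A (fst z)"
  shows "differential (tangent_bundle A) A fst z X c = lpart (X (induced_chart A c))"
proof -
  have cA: "c \<in> A" "fst z \<in> fst c" using c by (auto simp: charts_at_iff)
  let ?y = "snd (induced_chart A c) z"
  have o: "open ((lpart :: real^('n + 'n) \<Rightarrow> real^'n) -` (snd c ` fst c))"
    using open_dom[OF cA(1)] by (intro open_vimage linear_continuous_on[OF bl_parts(1)])
  have y: "?y \<in> lpart -` (snd c ` fst c)" using cA by (simp add: snd_induced_chart)
  have "((snd c \<circ> fst) \<circ> chart_inv (induced_chart A c) has_derivative lpart) (at ?y)"
    by (rule has_derivative_transform_within_open[OF bounded_linear_imp_has_derivative[OF bl_parts(1)] o y])
      (simp add: induced_chart_inv[OF cA(1)] snd_chart_inv)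
  then show ?thesis
    using TB.dir_deriv_eq[OF X charts_TB[OF c], of "snd c \<circ> fst"] c
    by (simp add: differential_def differentiable_def fd_eqI) blast
qed

lemma horizontal_in: "differential (tangent_bundle A) A fst z X \<in> tangent_space A (fst z)"
proof (rule tangentI)
  fix c d assume c: "c \<in> charts_at A (fst z)" and d: "d \<in> charts_at A (fst z)"
  show "differential (tangent_bundle A) A fst z X d
      = fd (transition c d) (snd c (fst z)) (differential (tangent_bundle A) A fst z X c)"
    unfolding horizontal_chart[OF c] horizontal_chart[OF d] TB_change[OF c d] by simp
qed (simp add: differential_def)

lemma connection_map_chart:
  "c \<in> charts_at A (fst z) \<Longrightarrow> connection_map A g z X c = rpart (X (induced_chart A c))
     + gam A g c (snd c (fst z)) (snd z c) (lpart (X (induced_chart A c)))"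
  by (simp add: connection_map_def rpart_def lpart_def gam_def vec_eq_iff)

text \<open>The second-derivative term in the change of the fibre part is cancelled by the one in
  \<open>gam_transition\<close>. The two carry their arguments in opposite order, so symmetry of
  second derivatives is used.\<close>

lemma connection_map_in: "connection_map A g z X \<in> tangent_space A (fst z)"
proof (rule tangentI)
  fix c d assume c: "c \<in> charts_at A (fst z)" and d: "d \<in> charts_at A (fst z)"
  have cA: "c \<in> A" "fst z \<in> fst c" and dA: "d \<in> A" "fst z \<in> fst d" using c d by (auto simp: charts_at_iff)
  have zt: "snd z \<in> tangent_space A (fst z)" using z by (simp add: pts_tangent_bundle)
  note lin = fd_transition_linear[OF c d]
  have s: "fd (\<lambda>x. fd (transition c d) x u) (snd c (fst z)) v = fd (\<lambda>x. fd (transition c d) x v) (snd c (fst z)) u" for u v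
    by (rule second_derivative_symmetric[OF open_overlap[OF cA(1) dA(1)] mem_overlap[OF cA(2) dA(2)]
          smooth_transition[OF cA(1) dA(1)]])
  show "connection_map A g z X d = fd (transition c d) (snd c (fst z)) (connection_map A g z X c)"
    unfolding connection_map_chart[OF c] connection_map_chart[OF d] TB_change[OF c d]
      tangent_change[OF zt c d] lpart_join rpart_join gam_transition[OF c d]
    by (simp add: linear_add[OF lin] s[of "snd z c"])
qed (simp add: connection_map_def)

end

text \<open>The Sasaki metric on coordinate vectors, expressed through \<open>g\<close> in the chart
  \<open>c\<close>; the second summand pairs the values of the connection map.\<close>

definition sasaki_form where
  "sasaki_form c y U V = gform A g c (lpart y) (lpart U) (lpart V)
     + gform A g c (lpart y) (rpart U + gam A g c (lpart y) (rpart y) (lpart U))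
         (rpart V + gam A g c (lpart y) (rpart y) (lpart V))"

lemma sasaki_metric_chart:
  assumes z: "z \<in> pts (tangent_bundle A)" and c: "c \<in> charts_at A (fst z)"
    and X: "X \<in> tangent_space (tangent_bundle A) z" and Y: "Y \<in> tangent_space (tangent_bundle A) z"
  shows "sasaki_metric A g z X Y
    = sasaki_form c (snd (induced_chart A c) z) (X (induced_chart A c)) (Y (induced_chart A c))"
  unfolding sasaki_metric_def Let_def
    metric_gform[OF c horizontal_in[OF z X] horizontal_in[OF z Y]]
    metric_gform[OF c connection_map_in[OF z X] connection_map_in[OF z Y]]
    horizontal_chart[OF z X c] horizontal_chart[OF z Y c]
    connection_map_chart[OF z X c] connection_map_chart[OF z Y c] sasaki_form_def
  by (simp add: snd_induced_chart)

lemma sasaki_gform: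
  assumes c: "c \<in> A" and y: "lpart y \<in> snd c ` fst c"
  shows "gform (tangent_bundle A) (sasaki_metric A g) (induced_chart A c) y U V = sasaki_form c y U V"
proof -
  let ?T = "induced_chart A c"
  have yd: "y \<in> snd ?T ` fst ?T" using induced_chart_dom[OF c] y by simp
  have inv: "fst (chart_inv ?T y) = chart_inv c (lpart y)" by (simp add: induced_chart_inv[OF c y])
  have c': "c \<in> charts_at A (fst (chart_inv ?T y))"
    unfolding inv using c chart_inv_in[OF y] by (simp add: charts_at_iff)
  have "?T \<in> tangent_bundle A" using c by (simp add: tangent_bundle_def)
  then have T: "?T \<in> charts_at (tangent_bundle A) (chart_inv ?T y)"
    using TB.chart_inv_in[OF yd] by (simp add: charts_at_iff)
  have z: "chart_inv ?T y \<in> pts (tangent_bundle A)" using T pts_iff by metis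
  show ?thesis
    unfolding gform_def Let_def sasaki_metric_chart[OF z c' TB.tvec_in[OF T] TB.tvec_in[OF T]]
    by (simp add: TB.tvec_self[OF T] TB.snd_chart_inv[OF yd])
qed

lemma linear_sasaki1:
  assumes "c \<in> A" "lpart y \<in> snd c ` fst c"
  shows "sasaki_form c y (r *\<^sub>R U + s *\<^sub>R V) W = r * sasaki_form c y U W + s * sasaki_form c y V W"
  unfolding sasaki_form_def
  by (simp add: linear_add[OF linear_lpart] linear_add[OF linear_rpart] linear_cmul[OF linear_lpart]
      linear_cmul[OF linear_rpart] linear_add[OF linear_gam2] linear_cmul[OF linear_gam2]
      linear_add[OF linear_gform1[OF assms]] linear_cmul[OF linear_gform1[OF assms]] algebra_simps)

text \<open>While \<open>V\<close> and \<open>W\<close> stay fixed, their vertical parts vary with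
  the base point and the fibre coordinate through the Christoffel symbols. This accounts for the
  last two terms.\<close>

lemma sasaki_has_derivative:
  assumes c: "c \<in> A" and y: "lpart y \<in> snd c ` fst c"
  defines "x \<equiv> lpart y" and "\<xi> \<equiv> rpart y"
  defines "\<eta> \<equiv> \<lambda>U. rpart U + gam A g c x \<xi> (lpart U)"
  shows "((\<lambda>y. sasaki_form c y V W) has_derivative (\<lambda>U. dgform A g c x (lpart U) (lpart V) (lpart W)
     + (dgform A g c x (lpart U) (\<eta> V) (\<eta> W)
       + gform A g c x (dgam c x (lpart U) \<xi> (lpart V) + gam A g c x (rpart U) (lpart V)) (\<eta> W)
       + gform A g c x (\<eta> V) (dgam c x (lpart U) \<xi> (lpart W) + gam A g c x (rpart U) (lpart W))))) (at y)"
proof -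
  have l: "(lpart has_derivative lpart) (at y)" and r: "(rpart has_derivative rpart) (at y)"
    by (rule bounded_linear_imp_has_derivative bl_parts)+
  have e: "((\<lambda>y. rpart V + gam A g c (lpart y) (rpart y) (lpart V)) has_derivative
      (\<lambda>U. dgam c x (lpart U) \<xi> (lpart V) + gam A g c x (rpart U) (lpart V))) (at y)" for V :: "real^('n + 'n)"
    using has_derivative_add[OF has_derivative_const gam_has_derivative[where h=lpart, OF c y l r has_derivative_const]]
    by (simp add: x_def \<xi>_def linear_0[OF linear_gam2])
  show ?thesis
    unfolding sasaki_form_def x_def \<xi>_def \<eta>_def
    using has_derivative_add[OF gform_has_derivative[where h=lpart, OF c y l has_derivative_const has_derivative_const]
        gform_has_derivative[where h=lpart, OF c y l e e]]
    by (simp add: linear_0[OF linear_gform1[OF c y]] linear_0[OF linear_gform2[OF c y]] x_def \<xi>_def)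
qed

text \<open>Definiteness holds because a vector with zero horizontal part and zero value of the
  connection map has zero fibre part too. Differentiability comes from that of the Christoffel
  symbols.\<close>

lemma riem_sasaki: "riem (tangent_bundle A) (sasaki_metric A g)"
proof
  fix u v z assume u: "u \<in> tangent_space (tangent_bundle A) z" and v: "v \<in> tangent_space (tangent_bundle A) z"
    and z: "z \<in> pts (tangent_bundle A)"
  then obtain c where c: "c \<in> charts_at A (fst z)"
    unfolding pts_tangent_bundle using pts_iff[of "fst z" A] by blast
  have cA: "c \<in> A" "snd c (fst z) \<in> snd c ` fst c" using c by (auto simp: charts_at_iff)
  show "sasaki_metric A g z u v = sasaki_metric A g z v u"
    unfolding sasaki_metric_chart[OF z c u v] sasaki_metric_chart[OF z c v u] sasaki_form_def
    using gform_sym[OF cA] by (simp add: snd_induced_chart)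
next
  fix u z assume u: "u \<in> tangent_space (tangent_bundle A) z" and z: "z \<in> pts (tangent_bundle A)"
    and u0: "u \<noteq> (\<lambda>_. 0)"
  then obtain c where c: "c \<in> charts_at A (fst z)"
    unfolding pts_tangent_bundle using pts_iff[of "fst z" A] by blast
  have cA: "c \<in> A" "snd c (fst z) \<in> snd c ` fst c" using c by (auto simp: charts_at_iff)
  define U where "U = u (induced_chart A c)"
  have U0: "U \<noteq> 0"
    using u0 TB.tangent_eqI[OF u TB.tangent_zero charts_TB[OF z u c]] unfolding U_def by blast
  define \<eta> where "\<eta> = rpart U + gam A g c (snd c (fst z)) (snd z c) (lpart U)"
  have "lpart U \<noteq> 0 \<or> \<eta> \<noteq> 0"
  proof (rule ccontr)
    assume "\<not> ?thesis"
    then have "lpart U = 0" "rpart U = 0" by (auto simp: \<eta>_def linear_0[OF linear_gam2])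
    then show False using U0 join_parts[of U] by simp
  qed
  moreover have "gform A g c (snd c (fst z)) a a \<ge> 0" for a
    using gform_pos[OF cA, of a] linear_0[OF linear_gform1[OF cA], of 0] by (cases "a = 0") auto
  ultimately have "gform A g c (snd c (fst z)) (lpart U) (lpart U) + gform A g c (snd c (fst z)) \<eta> \<eta> > 0"
    using gform_pos[OF cA] by (meson add_nonneg_pos add_pos_nonneg)
  then show "sasaki_metric A g z u u > 0"
    unfolding sasaki_metric_chart[OF z c u u] sasaki_form_def
    by (simp add: snd_induced_chart \<eta>_def U_def)
next
  fix u v w z r s assume u: "u \<in> tangent_space (tangent_bundle A) z" and v: "v \<in> tangent_space (tangent_bundle A) z"
    and w: "w \<in> tangent_space (tangent_bundle A) z" and z: "z \<in> pts (tangent_bundle A)"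
  then obtain c where c: "c \<in> charts_at A (fst z)"
    unfolding pts_tangent_bundle using pts_iff[of "fst z" A] by blast
  have cA: "c \<in> A" "lpart (snd (induced_chart A c) z) \<in> snd c ` fst c"
    using c by (auto simp: charts_at_iff snd_induced_chart)
  show "sasaki_metric A g z (\<lambda>c. r *\<^sub>R u c + s *\<^sub>R v c) w = r * sasaki_metric A g z u w + s * sasaki_metric A g z v w"
    unfolding sasaki_metric_chart[OF z c TB.tangent_lincomb[OF u v] w] sasaki_metric_chart[OF z c u w]
      sasaki_metric_chart[OF z c v w] by (rule linear_sasaki1[OF cA])
next
  fix c' y a b assume "c' \<in> tangent_bundle A" and y': "y \<in> snd c' ` fst c'"
  then obtain c where c: "c \<in> A" "c' = induced_chart A c" by (auto simp: tangent_bundle_def)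
  have y: "lpart y \<in> snd c ` fst c" using y' induced_chart_dom[OF c(1)] c(2) by auto
  have o: "open ((lpart :: real^('n + 'n) \<Rightarrow> real^'n) -` (snd c ` fst c))"
    using open_dom[OF c(1)] by (intro open_vimage linear_continuous_on[OF bl_parts(1)])
  have "(\<lambda>y. sasaki_form c y (axis a 1) (axis b 1)) differentiable (at y)"
    using sasaki_has_derivative[OF c(1) y] unfolding differentiable_def by blast
  then show "(\<lambda>x. metric_matrix (tangent_bundle A) (sasaki_metric A g) c' x $ a $ b) differentiable (at y)"
    unfolding metric_matrix_gform c(2)
    by (rule differentiable_cong_open[OF o, rotated 2]) (use y in \<open>auto simp: sasaki_gform[OF c(1)]\<close>)
qed

interpretation TB: riem "tangent_bundle A" "sasaki_metric A g"
  by (rule riem_sasaki)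

text \<open>
  The acceleration of a curve \<open>(x, \<xi>)\<close> with velocity \<open>(a, b)\<close> and coordinate acceleration
  \<open>(W1, W2)\<close>, tested against the vector with horizontal part \<open>p\<close> and vertical part \<open>q\<close>.
  Here \<open>\<eta>\<close> is the covariant derivative of \<open>\<xi>\<close>, the second summand contains the covariant
  derivative of \<open>\<eta>\<close>, and the last one is the curvature term \<open>g (\<eta>, R(a, p) \<xi>)\<close>.
\<close>

lemma sasaki_acceleration:
  fixes a b p q W1 W2 \<xi> :: "real^'n"
  assumes c: "c \<in> A" and x: "x \<in> snd c ` fst c"
  defines "G \<equiv> gform A g c x" and "\<Gamma> \<equiv> gam A g c x" and "d\<Gamma> \<equiv> dgam c x"
  defines "\<eta> \<equiv> b + \<Gamma> \<xi> a"
  shows "gform (tangent_bundle A) (sasaki_metric A g) (induced_chart A c) (join x \<xi>)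
      (join W1 W2 + gam (tangent_bundle A) (sasaki_metric A g) (induced_chart A c) (join x \<xi>) (join a b) (join a b))
      (join p (q - \<Gamma> \<xi> p))
    = G (W1 + \<Gamma> a a) p
      + G (W2 + \<Gamma> \<xi> W1 + d\<Gamma> a \<xi> a + \<Gamma> b a + \<Gamma> a \<eta>) q
      + G \<eta> (d\<Gamma> a \<xi> p - \<Gamma> (\<Gamma> \<xi> a) p - d\<Gamma> p \<xi> a + \<Gamma> (\<Gamma> \<xi> p) a)"
proof -
  let ?T = "induced_chart A c" and ?GS = "gform (tangent_bundle A) (sasaki_metric A g) (induced_chart A c)"
  define y where "y = join x \<xi>"
  define V where "V = join a b"
  define w where "w = join p (q - \<Gamma> \<xi> p)"
  have y: "lpart y \<in> snd c ` fst c" using x by (simp add: y_def)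
  have T: "?T \<in> tangent_bundle A" "y \<in> snd ?T ` fst ?T"
    using c y induced_chart_dom[OF c] by (auto simp: tangent_bundle_def)
  have o: "open ((lpart :: real^('n + 'n) \<Rightarrow> real^'n) -` (snd c ` fst c))"
    using open_dom[OF c] by (intro open_vimage linear_continuous_on[OF bl_parts(1)])
  note G1 = linear_gform1[OF c x, folded G_def] and G2 = linear_gform2[OF c x, folded G_def]
  note \<Gamma>1 = linear_gam1[of A g c x, folded \<Gamma>_def] and \<Gamma>2 = linear_gam2[of A g c x, folded \<Gamma>_def]
  note lin = linear_add[OF G1] linear_add[OF G2] linear_diff[OF G1] linear_diff[OF G2]
    linear_add[OF \<Gamma>1] linear_add[OF \<Gamma>2] linear_diff[OF \<Gamma>1] linear_diff[OF \<Gamma>2]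
  have Gs: "G u v = G v u" for u v unfolding G_def by (rule gform_sym[OF c x])
  have \<Gamma>s: "\<Gamma> u v = \<Gamma> v u" for u v unfolding \<Gamma>_def by (rule gam_sym[OF c x])
  have mc: "dgform A g c x v u w = G (\<Gamma> v u) w + G u (\<Gamma> v w)" for v u w
    unfolding G_def \<Gamma>_def by (rule metric_compatible[OF c x])
  have D: "fd (\<lambda>y. ?GS y V W) y U = dgform A g c x (lpart U) (lpart V) (lpart W)
     + (dgform A g c x (lpart U) (rpart V + \<Gamma> \<xi> (lpart V)) (rpart W + \<Gamma> \<xi> (lpart W))
       + G (d\<Gamma> (lpart U) \<xi> (lpart V) + \<Gamma> (rpart U) (lpart V)) (rpart W + \<Gamma> \<xi> (lpart W))
       + G (rpart V + \<Gamma> \<xi> (lpart V)) (d\<Gamma> (lpart U) \<xi> (lpart W) + \<Gamma> (rpart U) (lpart W)))" for U V W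
  proof -
    have "fd (\<lambda>y. ?GS y V W) y = fd (\<lambda>y. sasaki_form c y V W) y"
      by (rule fd_cong[OF o]) (use y in \<open>auto simp: sasaki_gform[OF c]\<close>)
    then show ?thesis
      using fd_eqI[OF sasaki_has_derivative[OF c y, of V W]] by (simp add: y_def G_def \<Gamma>_def d\<Gamma>_def)
  qed
  \<comment> \<open>In the Koszul formula with equal arguments two of the three terms
    coincide.\<close>
  have "?GS y (gam (tangent_bundle A) (sasaki_metric A g) ?T y V V) w
      = fd (\<lambda>y. ?GS y V w) y V - fd (\<lambda>y. ?GS y V V) y w / 2"
    unfolding TB.gform_gam[OF T] by simp
  also have "\<dots> = G (\<Gamma> a a) p + G (d\<Gamma> a \<xi> a + \<Gamma> b a + \<Gamma> a \<eta>) q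
      + G \<eta> (d\<Gamma> a \<xi> p - \<Gamma> (\<Gamma> \<xi> a) p - d\<Gamma> p \<xi> a + \<Gamma> (\<Gamma> \<xi> p) a)"
  proof -
    have 1: "fd (\<lambda>y. ?GS y V w) y V = (G (\<Gamma> a a) p + G a (\<Gamma> a p)) + (G (\<Gamma> a \<eta>) q + G \<eta> (\<Gamma> a q))
       + (G (d\<Gamma> a \<xi> a) q + G (\<Gamma> b a) q) + (G \<eta> (d\<Gamma> a \<xi> p) + G \<eta> (\<Gamma> b p))"
      unfolding D mc V_def w_def by (simp add: \<eta>_def[symmetric] lin)
    have 2: "fd (\<lambda>y. ?GS y V V) y w / 2 = G (\<Gamma> p a) a + G (\<Gamma> p \<eta>) \<eta>
        + (G \<eta> (d\<Gamma> p \<xi> a) + G \<eta> (\<Gamma> q a) - G \<eta> (\<Gamma> (\<Gamma> \<xi> p) a))"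
      unfolding D mc V_def w_def
      by (simp add: \<eta>_def[symmetric] lin Gs[of a "\<Gamma> p a"] Gs[of "\<Gamma> p \<eta>" \<eta>] Gs[of _ \<eta>] field_simps)
    \<comment> \<open>Expanding the inner \<open>\<eta>\<close> cancels the term with
      \<open>\<Gamma> b p\<close> and leaves one quadratic Christoffel term of the curvature; the
      other comes from the fibre part of \<open>w\<close>.\<close>
    have 3: "G \<eta> (\<Gamma> p \<eta>) = G \<eta> (\<Gamma> b p) + G \<eta> (\<Gamma> (\<Gamma> \<xi> a) p)"
      unfolding \<Gamma>s[of p \<eta>] by (simp add: \<eta>_def lin)
    show ?thesis
      unfolding 1 2 using 3 Gs[of a "\<Gamma> a p"] \<Gamma>s[of a p] Gs[of "\<Gamma> p \<eta>" \<eta>] \<Gamma>s[of a q] by (simp add: lin)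
  qed
  finally have "?GS y (gam (tangent_bundle A) (sasaki_metric A g) ?T y V V) w = \<dots>" .
  moreover have "?GS y (join W1 W2) w = G W1 p + G (W2 + \<Gamma> \<xi> W1) q"
    unfolding sasaki_gform[OF c y] sasaki_form_def by (simp add: y_def w_def G_def \<Gamma>_def)
  ultimately have "?GS y (join W1 W2 + gam (tangent_bundle A) (sasaki_metric A g) ?T y V V) w
     = G (W1 + \<Gamma> a a) p + G (W2 + \<Gamma> \<xi> W1 + d\<Gamma> a \<xi> a + \<Gamma> b a + \<Gamma> a \<eta>) q
      + G \<eta> (d\<Gamma> a \<xi> p - \<Gamma> (\<Gamma> \<xi> a) p - d\<Gamma> p \<xi> a + \<Gamma> (\<Gamma> \<xi> p) a)"
    by (simp add: linear_add[OF TB.linear_gform1[OF T]] lin)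
  then show ?thesis unfolding y_def V_def w_def .
qed

end

subsection \<open>The image of a normal vector field\<close>

lemma topspace_atlas_topology:
  assumes "smooth_atlas A"
  shows "topspace (atlas_topology A) = pts A"
proof
  show "topspace (atlas_topology A) \<subseteq> pts A"
    using openin_topspace[of "atlas_topology A"] unfolding openin_atlas_topology[OF assms] by blast
  have "open (snd c ` (pts A \<inter> fst c))" if c: "c \<in> A" for c
  proof -
    have "open (snd c ` (fst c \<inter> fst c))" using assms c unfolding smooth_atlas_def by blast
    moreover have "pts A \<inter> fst c = fst c \<inter> fst c" using c by (auto simp: pts_def)
    ultimately show ?thesis by simp
  qed
  then have "openin (atlas_topology A) (pts A)"
    unfolding openin_atlas_topology[OF assms] by simp
  then show "pts A \<subseteq> topspace (atlas_topology A)" by (rule openin_subset)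
qed

section \<open>Transport of an atlas along an injective map\<close>

definition image_chart :: "('p \<Rightarrow> 'q) \<Rightarrow> ('p, 'n::finite) atlas \<Rightarrow> ('p, 'n) chart \<Rightarrow> ('q, 'n) chart" where
  "image_chart f B c = (f ` fst c, snd c \<circ> inv_into (pts B) f)"

lemma image_atlas_eq: "image_atlas f B = image_chart f B ` B"
  by (simp add: image_atlas_def image_chart_def)

lemma pts_image_atlas: "pts (image_atlas f B) = f ` pts B"
  by (auto simp: image_atlas_def pts_def)

context atlas
begin

lemma dom_subset: "c \<in> A \<Longrightarrow> p \<in> fst c \<Longrightarrow> p \<in> pts A"
  by (auto simp: pts_def)

context
  fixes f :: "'p \<Rightarrow> 'q"
  assumes inj: "inj_on f (pts A)"
begin

lemma snd_image_chart: "p \<in> pts A \<Longrightarrow> snd (image_chart f A c) (f p) = snd c p"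
  by (simp add: image_chart_def inv_into_f_f[OF inj])

lemma image_image_chart: "S \<subseteq> pts A \<Longrightarrow> snd (image_chart f A c) ` (f ` S) = snd c ` S"
  unfolding image_image by (rule image_cong) (auto simp: snd_image_chart)

lemma overlap_image_chart:
  assumes "c \<in> A" "d \<in> A"
  shows "overlap (image_chart f A c) (image_chart f A d) = overlap c d"
proof -
  have "fst (image_chart f A c) \<inter> fst (image_chart f A d) = f ` (fst c \<inter> fst d)"
    using dom_subset[OF assms(1)] dom_subset[OF assms(2)]
    by (simp add: image_chart_def inj_on_image_Int[OF inj] subset_eq)
  then show ?thesis using image_image_chart[of "fst c \<inter> fst d" c] dom_subset[OF assms(1)] by (simp add: subset_eq)
qed

lemma inj_image_chart:
  assumes c: "c \<in> A"
  shows "inj_on (snd (image_chart f A c)) (fst (image_chart f A c))"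
proof (rule inj_onI)
  fix y y' assume y: "y \<in> fst (image_chart f A c)" "y' \<in> fst (image_chart f A c)"
    and eq: "snd (image_chart f A c) y = snd (image_chart f A c) y'"
  then obtain p p' where p: "y = f p" "p \<in> fst c" "y' = f p'" "p' \<in> fst c" by (auto simp: image_chart_def)
  then have "snd c p = snd c p'"
    using eq snd_image_chart[OF dom_subset[OF c p(2)]] snd_image_chart[OF dom_subset[OF c p(4)]] by simp
  then show "y = y'" using p inj_onD[OF inj_chart[OF c]] by auto
qed

lemma chart_inv_image_chart:
  assumes c: "c \<in> A" and u: "u \<in> snd c ` fst c"
  shows "chart_inv (image_chart f A c) u = f (chart_inv c u)"
proof -
  have p: "chart_inv c u \<in> fst c" by (rule chart_inv_in[OF u])
  then have "f (chart_inv c u) \<in> fst (image_chart f A c)" by (simp add: image_chart_def)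
  moreover have "snd (image_chart f A c) (f (chart_inv c u)) = u"
    using snd_image_chart[OF dom_subset[OF c p]] snd_chart_inv[OF u] by simp
  ultimately show ?thesis
    unfolding chart_inv_def[of "image_chart f A c"] using inv_into_f_f[OF inj_image_chart[OF c]] by metis
qed

lemma smooth_image_atlas: "smooth_atlas (image_atlas f A)"
  unfolding smooth_atlas_def image_atlas_eq
proof (intro conjI ballI)
  fix c' assume "c' \<in> image_chart f A ` A"
  then show "inj_on (snd c') (fst c')" using inj_image_chart by auto
next
  fix c' d' assume "c' \<in> image_chart f A ` A" "d' \<in> image_chart f A ` A"
  then obtain c d where c: "c \<in> A" "c' = image_chart f A c" and d: "d \<in> A" "d' = image_chart f A d" by blast
  have ov: "overlap c' d' = overlap c d" unfolding c(2) d(2) by (rule overlap_image_chart[OF c(1) d(1)])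
  show "open (overlap c' d')" unfolding ov by (rule open_overlap[OF c(1) d(1)])
  show "smooth_on (transition c' d') (overlap c' d')"
    unfolding ov
  proof (rule smooth_on_cong[OF open_overlap[OF c(1) d(1)] _ smooth_transition[OF c(1) d(1)]])
    fix u assume u: "u \<in> overlap c d"
    then have u': "u \<in> snd c ` fst c" by blast
    then have "chart_inv c u \<in> pts A" using chart_inv_in[OF u'] dom_subset[OF c(1)] by blast
    then show "transition c d u = transition c' d' u"
      using chart_inv_image_chart[OF c(1) u'] by (simp add: c(2) d(2) snd_image_chart)
  qed
qed

lemma openin_image_atlas:
  assumes S: "S \<subseteq> pts A"
  shows "openin (atlas_topology (image_atlas f A)) (f ` S) \<longleftrightarrow> openin (atlas_topology A) S"
proof -
  have "snd (image_chart f A c) ` (f ` S \<inter> fst (image_chart f A c)) = snd c ` (S \<inter> fst c)" if "c \<in> A" for c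
  proof -
    have "f ` S \<inter> fst (image_chart f A c) = f ` (S \<inter> fst c)"
      using inj_on_image_Int[OF inj S, of "fst c"] dom_subset[OF that] by (simp add: image_chart_def subset_eq)
    then show ?thesis using image_image_chart[of "S \<inter> fst c" c] S by (simp add: le_infI1)
  qed
  then show ?thesis
    unfolding openin_atlas_topology[OF smooth_image_atlas] openin_atlas_topology[OF smooth_atlas] pts_image_atlas
    using S by (auto simp: image_atlas_eq)
qed

text \<open>Transfers the Hausdorff property and second countability to the image, as both are
  topological invariants.\<close>

lemma homeomorphic_image_atlas:
  "atlas_topology A homeomorphic_space atlas_topology (image_atlas f A)"
proof (rule homeomorphic_map_imp_homeomorphic_space[of _ _ f], rule bijective_open_imp_homeomorphic_map)
  note top = topspace_atlas_topology[OF smooth_atlas] topspace_atlas_topology[OF smooth_image_atlas] pts_image_atlas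
  show "f ` topspace (atlas_topology A) = topspace (atlas_topology (image_atlas f A))"
    "inj_on f (topspace (atlas_topology A))"
    unfolding top using inj by auto
  show "open_map (atlas_topology A) (atlas_topology (image_atlas f A)) f"
    unfolding open_map_def
    using openin_image_atlas openin_subset[of "atlas_topology A"] unfolding top by blast
  show "continuous_map (atlas_topology A) (atlas_topology (image_atlas f A)) f"
    unfolding continuous_map_def top
  proof (intro conjI allI impI)
    fix U assume U: "openin (atlas_topology (image_atlas f A)) U"
    have "U \<subseteq> f ` pts A" using openin_subset[OF U] unfolding top .
    then have "f ` {x \<in> pts A. f x \<in> U} = U" by auto
    then show "openin (atlas_topology A) {x \<in> pts A. f x \<in> U}"
      using openin_image_atlas[of "{x \<in> pts A. f x \<in> U}"] U by auto
  qed auto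
qed

end

end

locale parallel_normal_field = submanifold_of A g B + riem_smooth A g
  for A :: "('p, 'n::finite) atlas" and B :: "('p, 'l::finite) atlas" and g +
  fixes \<xi> :: "'p \<Rightarrow> 'p \<times> ('p, 'n) tvec"
  assumes normal: "normal_vector_field A g B \<xi>" and parallel: "normal_parallel A g B \<xi>"
begin

interpretation TB: riem "tangent_bundle A" "sasaki_metric A g"
  by (rule riem_sasaki)

lemma fst_xi: "p \<in> pts B \<Longrightarrow> fst (\<xi> p) = p"
  using normal by (simp add: normal_vector_field_def)

lemma xi_pts: "p \<in> pts B \<Longrightarrow> \<xi> p \<in> pts (tangent_bundle A)"
  using normal by (auto simp: normal_vector_field_def smooth_map_on_def)

lemma xi_tangent: "p \<in> pts B \<Longrightarrow> snd (\<xi> p) \<in> tangent_space A p"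
  using xi_pts[of p] fst_xi[of p] by (simp add: pts_tangent_bundle)

lemma inj_xi: "inj_on \<xi> (pts B)"
  using fst_xi by (metis inj_onI)

interpretation I: atlas "image_atlas \<xi> B"
  by unfold_locales (rule sub.smooth_image_atlas[OF inj_xi])

text \<open>As \<open>\<xi>\<close> preserves base points, an image chart meets an induced chart
  exactly where the underlying charts meet. Both submanifolds are thus described over the same
  coordinate region.\<close>

lemma xi_dom:
  assumes "e \<in> B" "c \<in> A"
  shows "fst e \<inter> pts B \<inter> \<xi> -` fst (induced_chart A c) = fst e \<inter> fst c"
proof -
  have "p \<in> pts B \<and> (\<xi> p \<in> fst (induced_chart A c) \<longleftrightarrow> p \<in> fst c)" if "p \<in> fst e" for p
    using fst_xi[of p] xi_tangent[of p] sub.dom_subset[OF assms(1) that] by (simp add: fst_induced_chart)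
  then show ?thesis by blast
qed

lemma smooth_xi:
  assumes e: "e \<in> B" and c: "c \<in> A"
  shows "smooth_on (snd (induced_chart A c) \<circ> \<xi> \<circ> chart_inv e) (overlap e c)"
proof -
  have "induced_chart A c \<in> tangent_bundle A" using c by (simp add: tangent_bundle_def)
  then show ?thesis
    using normal e unfolding normal_vector_field_def smooth_map_on_def xi_dom[OF e c, symmetric] by blast
qed

section \<open>The normal field and its image in coordinates\<close>

definition xi_coord where "xi_coord e c u = snd (\<xi> (chart_inv e u)) c"

lemma chart_inv_pts: "e \<in> B \<Longrightarrow> u \<in> overlap e c \<Longrightarrow> chart_inv e u \<in> pts B"
  by (auto simp: pts_def)

lemma induced_xi:
  assumes "e \<in> B" "u \<in> overlap e c"
  shows "snd (induced_chart A c) (\<xi> (chart_inv e u)) = join (transition e c u) (xi_coord e c u)"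
  using fst_xi[OF chart_inv_pts[OF assms]] by (simp add: snd_induced_chart xi_coord_def)

lemma smooth_xi_coord:
  assumes "e \<in> B" "c \<in> A"
  shows "smooth_on (xi_coord e c) (overlap e c)"
  using smooth_on_bounded_linear[OF open_inclusion[OF assms] bl_parts(2) smooth_xi[OF assms]]
  by (simp add: snd_induced_chart xi_coord_def[abs_def])

lemma overlap_image:
  assumes e: "e \<in> B" and c: "c \<in> A"
  shows "overlap (image_chart \<xi> B e) (induced_chart A c) = overlap e c"
proof -
  have "fst (image_chart \<xi> B e) \<inter> fst (induced_chart A c) = \<xi> ` (fst e \<inter> pts B \<inter> \<xi> -` fst (induced_chart A c))"
    using e by (auto simp: image_chart_def pts_def)
  also have "\<dots> = \<xi> ` (fst e \<inter> fst c)" unfolding xi_dom[OF e c] ..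
  finally show ?thesis using sub.image_image_chart[OF inj_xi, of "fst e \<inter> fst c" e] e by (auto simp: pts_def)
qed

lemma transition_image:
  assumes e: "e \<in> B" and u: "u \<in> overlap e c"
  shows "transition (image_chart \<xi> B e) (induced_chart A c) u = join (transition e c u) (xi_coord e c u)"
proof -
  have "u \<in> snd e ` fst e" using u by blast
  then show ?thesis using sub.chart_inv_image_chart[OF inj_xi e] induced_xi[OF e u] by simp
qed

lemma fd_transition_image:
  assumes e: "e \<in> B" and c: "c \<in> A" and u: "u \<in> overlap e c"
  shows "(transition (image_chart \<xi> B e) (induced_chart A c) has_derivative
    (\<lambda>v. join (fd (transition e c) u v) (fd (xi_coord e c) u v))) (at u)"
  by (rule has_derivative_transform_within_open[OF has_derivative_join[OF
        fd_works[OF smooth_on_differentiable[OF smooth_inclusion[OF e c] u]]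
        fd_works[OF smooth_on_differentiable[OF smooth_xi_coord[OF e c] u]]] open_inclusion[OF e c] u])
    (rule transition_image[OF e, symmetric])

text \<open>The base component of the image in coordinates is the original inclusion, whose
  derivative is already injective, so the image is immersed as well. The topological conditions are
  transported along the homeomorphism.\<close>

lemma submanifold_image: "submanifold (image_atlas \<xi> B) (tangent_bundle A)"
  unfolding submanifold_def
proof (intro conjI ballI)
  have B: "Hausdorff_space (atlas_topology B)" "second_countable (atlas_topology B)"
    using submanifold by (simp_all add: submanifold_def smooth_manifold_def)
  note hom = sub.homeomorphic_image_atlas[OF inj_xi]
  show "smooth_manifold (image_atlas \<xi> B)"
    unfolding smooth_manifold_def
    using sub.smooth_image_atlas[OF inj_xi] homeomorphic_Hausdorff_space[OF hom]
      homeomorphic_space_second_countability[OF hom] B by blast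
next
  show "smooth_map_on (pts (image_atlas \<xi> B)) (image_atlas \<xi> B) (tangent_bundle A) (\<lambda>p. p)"
    unfolding smooth_map_on_def
  proof (intro conjI ballI)
    show "openin (atlas_topology (image_atlas \<xi> B)) (pts (image_atlas \<xi> B))"
      using openin_topspace unfolding topspace_atlas_topology[OF I.smooth_atlas, symmetric] .
    show "(\<lambda>p. p) ` pts (image_atlas \<xi> B) \<subseteq> pts (tangent_bundle A)"
      using xi_pts by (auto simp: pts_image_atlas)
  next
    fix e' c' assume e': "e' \<in> image_atlas \<xi> B" and "c' \<in> tangent_bundle A"
    then obtain e c where e: "e \<in> B" "e' = image_chart \<xi> B e" and c: "c \<in> A" "c' = induced_chart A c"
      by (auto simp: image_atlas_eq tangent_bundle_def)
    have "fst e' \<inter> pts (image_atlas \<xi> B) \<inter> (\<lambda>p. p) -` fst c' = fst e' \<inter> fst c'"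
      using e' by (auto simp: pts_def)
    then have S: "snd e' ` (fst e' \<inter> pts (image_atlas \<xi> B) \<inter> (\<lambda>p. p) -` fst c') = overlap e c"
      using overlap_image[OF e(1) c(1)] by (simp add: e(2) c(2))
    show "open (snd e' ` (fst e' \<inter> pts (image_atlas \<xi> B) \<inter> (\<lambda>p. p) -` fst c'))"
      unfolding S by (rule open_inclusion[OF e(1) c(1)])
    show "smooth_on (snd c' \<circ> (\<lambda>p. p) \<circ> chart_inv e')
        (snd e' ` (fst e' \<inter> pts (image_atlas \<xi> B) \<inter> (\<lambda>p. p) -` fst c'))"
      unfolding S
    proof (rule smooth_on_cong[OF open_inclusion[OF e(1) c(1)]])
      show "smooth_on (\<lambda>u. join (transition e c u) (xi_coord e c u)) (overlap e c)"
        by (rule smooth_on_join[OF open_inclusion[OF e(1) c(1)] smooth_inclusion[OF e(1) c(1)] smooth_xi_coord[OF e(1) c(1)]])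
      show "join (transition e c u) (xi_coord e c u) = (snd c' \<circ> (\<lambda>p. p) \<circ> chart_inv e') u" if "u \<in> overlap e c" for u
        using transition_image[OF e(1) that] by (simp add: e(2) c(2))
    qed
  qed
next
  fix z assume "z \<in> pts (image_atlas \<xi> B)"
  then obtain p where p: "p \<in> pts B" "z = \<xi> p" by (auto simp: pts_image_atlas)
  obtain e c where e: "e \<in> charts_at B p" and c: "c \<in> charts_at A p" using p(1) pts_sub pts_iff by metis
  have eB: "e \<in> B" "p \<in> fst e" and cA: "c \<in> A" "p \<in> fst c" using e c by (auto simp: charts_at_iff)
  have x: "snd e p \<in> overlap e c" by (rule mem_overlap[OF eB(2) cA(2)])
  let ?e = "image_chart \<xi> B e" and ?c = "induced_chart A c"
  have e': "?e \<in> charts_at (image_atlas \<xi> B) z"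
    using eB by (auto simp: charts_at_iff image_atlas_eq p(2) image_chart_def)
  have c': "?c \<in> charts_at (tangent_bundle A) z"
    using c fst_xi[OF p(1)] xi_tangent[OF p(1)] unfolding charts_at_tangent_bundle p(2) by auto
  have ez: "snd ?e z = snd e p" unfolding p(2) by (rule sub.snd_image_chart[OF inj_xi p(1)])
  have D: "differential (image_atlas \<xi> B) (tangent_bundle A) (\<lambda>p. p) z X ?c
      = join (fd (transition e c) (snd e p) (X ?e)) (fd (xi_coord e c) (snd e p) (X ?e))"
    if X: "X \<in> tangent_space (image_atlas \<xi> B) z" for X
  proof -
    note d = fd_transition_image[OF eB(1) cA(1) x]
    have "snd ?c \<circ> (\<lambda>p. p) = snd ?c" by auto
    then show ?thesis
      using I.dir_deriv_eq[OF X e', of "snd ?c"] d c' fd_eqI[OF d] ez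
      by (simp add: differential_def differentiable_def) blast
  qed
  show "inj_on (differential (image_atlas \<xi> B) (tangent_bundle A) (\<lambda>p. p) z) (tangent_space (image_atlas \<xi> B) z)"
  proof (rule inj_onI)
    fix X Y assume X: "X \<in> tangent_space (image_atlas \<xi> B) z" and Y: "Y \<in> tangent_space (image_atlas \<xi> B) z"
      and eq: "differential (image_atlas \<xi> B) (tangent_bundle A) (\<lambda>p. p) z X
        = differential (image_atlas \<xi> B) (tangent_bundle A) (\<lambda>p. p) z Y"
    have "lpart (differential (image_atlas \<xi> B) (tangent_bundle A) (\<lambda>p. p) z X ?c)
        = lpart (differential (image_atlas \<xi> B) (tangent_bundle A) (\<lambda>p. p) z Y ?c)" using eq by simp
    then have "fd (transition e c) (snd e p) (X ?e - Y ?e) = 0"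
      unfolding D[OF X] D[OF Y] by (simp add: linear_diff[OF linear_inclusion[OF e c]])
    then have "X ?e = Y ?e" using inclusion_inj[OF e c] by fastforce
    then show "X = Y" by (rule I.tangent_eqI[OF X Y e'])
  qed
qed

interpretation I: submanifold_of "tangent_bundle A" "sasaki_metric A g" "image_atlas \<xi> B"
  by unfold_locales (rule submanifold_image)

text \<open>The components in \<open>c\<close> of the covariant derivative of \<open>\<xi>\<close>
  along \<open>v\<close>. The Christoffel arguments stand in the order of
  \<open>connection_map\<close>, so this is also the vertical part of the velocity of the
  image.\<close>

definition eta where
  "eta e c u v = fd (xi_coord e c) u v + gam A g c (transition e c u) (xi_coord e c u) (fd (transition e c) u v)"

context
  fixes e c
  assumes e: "e \<in> B" and c: "c \<in> A"
begin

lemma point: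
  assumes u: "u \<in> overlap e c"
  shows "e \<in> charts_at B (chart_inv e u)" "c \<in> charts_at A (chart_inv e u)" "snd e (chart_inv e u) = u"
    "transition e c u = snd c (chart_inv e u)" "transition e c u \<in> snd c ` fst c"
  using u e c by (auto simp: charts_at_iff)

lemma xi_orthogonal:
  assumes u: "u \<in> overlap e c"
  shows "gform A g c (transition e c u) (xi_coord e c u) (fd (transition e c) u w) = 0"
proof -
  define p where "p = chart_inv e u"
  note pt = point[OF u, folded p_def]
  have p: "p \<in> pts B" using pt(1) pts_iff by metis
  have X: "tvec B e p w \<in> tangent_space B p" by (rule sub.tvec_in[OF pt(1)])
  let ?v = "differential B A (\<lambda>p. p) p (tvec B e p w)"
  have "?v \<in> sub_tangent A B p" unfolding sub_tangent_def using X by blast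
  then have "g p (snd (\<xi> p)) ?v = 0" using normal p by (auto simp: normal_vector_field_def)
  then have "gform A g c (snd c p) (snd (\<xi> p) c) (fd (transition e c) u w) = 0"
    using metric_gform[OF pt(2) xi_tangent[OF p] differential_in[OF X p]]
    unfolding differential_chart[OF X pt(1,2)] pt(3) sub.tvec_self[OF pt(1)] by simp
  then show ?thesis unfolding pt(4) xi_coord_def p_def[symmetric] .
qed

text \<open>Here parallelism enters: the covariant derivative is a genuine tangent vector, so a
  vanishing normal part makes it tangent to the submanifold. \<open>gam_sym\<close> reconciles the
  two orders of the Christoffel arguments.\<close>

lemma eta_tangent:
  assumes u: "u \<in> overlap e c"
  shows "eta e c u v \<in> range (fd (transition e c) u)"
proof -
  define p where "p = chart_inv e u"
  note pt = point[OF u, folded p_def]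
  have p: "p \<in> pts B" using pt(1) pts_iff by metis
  have X: "tvec B e p v \<in> tangent_space B p" by (rule sub.tvec_in[OF pt(1)])
  let ?D = "cov_deriv A g B p (tvec B e p v) (\<lambda>q. snd (\<xi> q))"
  have d: "(\<lambda>u. snd (\<xi> (chart_inv e u)) c) differentiable (at (snd e p))" if "c \<in> charts_at A p" for c
  proof -
    have "c \<in> A" "snd e p \<in> overlap e c" using that pt(1) by (auto simp: charts_at_iff)
    then show ?thesis using smooth_on_differentiable[OF smooth_xi_coord[OF e]] by (simp add: xi_coord_def[abs_def])
  qed
  have N: "open (overlap e c)" "snd e p \<in> overlap e c" using open_inclusion[OF e c] u pt(3) by auto
  have "?D \<in> tangent_space A p"
    by (rule cov_deriv_in[OF pt(1) X N xi_tangent[OF chart_inv_pts[OF e]] d])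
  moreover have "normal_part A g B p ?D = (\<lambda>_. 0)" using parallel p X by (simp add: normal_parallel_def)
  ultimately have "?D \<in> sub_tangent A B p" using normal_part_zero_iff[OF p] by blast
  then have "?D c \<in> range (fd (transition e c) u)" using sub_tangent_iff[OF pt(1,2)] pt(3) by simp
  moreover have "?D c = eta e c u v"
  proof -
    have xc: "(\<lambda>u. snd (\<xi> (chart_inv e u)) c) = xi_coord e c" by (simp add: xi_coord_def[abs_def])
    have xp: "snd (\<xi> p) c = xi_coord e c u" by (simp add: xi_coord_def p_def)
    show ?thesis
      unfolding cov_deriv_chart[where Z="\<lambda>q. snd (\<xi> q)", OF pt(1,2) X d[OF pt(2)]] xc xp pt(3)
        sub.tvec_self[OF pt(1)] pt(4)[symmetric] eta_def gam_sym[OF c point(5)[OF u], of "xi_coord e c u"] ..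
  qed
  ultimately show ?thesis by simp
qed

section \<open>Pointwise identities for the covariant derivative of the normal field and the
  accelerations\<close>

context
  fixes x
  assumes x: "x \<in> overlap e c"
begin

abbreviation "ff \<equiv> transition e c"
abbreviation "ss \<equiv> xi_coord e c"
abbreviation "GG \<equiv> gform A g c (ff x)"
abbreviation "Gam \<equiv> gam A g c (ff x)"

lemma derivs:
  "(ff has_derivative fd ff x) (at x)" "(ss has_derivative fd ss x) (at x)"
  "((\<lambda>u. fd ff u v) has_derivative fd (\<lambda>u. fd ff u v) x) (at x)"
  "((\<lambda>u. fd ss u v) has_derivative fd (\<lambda>u. fd ss u v) x) (at x)"
  by (intro fd_works smooth_on_differentiable[OF _ x] smooth_on_fd open_inclusion[OF e c]
      smooth_inclusion[OF e c] smooth_xi_coord[OF e c])+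

lemma GG_in: "ff x \<in> snd c ` fst c"
  by (rule point(5)[OF x])

lemmas GG1 = linear_gform1[OF c GG_in] and GG2 = linear_gform2[OF c GG_in]

lemma GG_sym: "GG u v = GG v u"
  by (rule gform_sym[OF c GG_in])

lemma eta_has_derivative:
  "((\<lambda>u. eta e c u v) has_derivative (\<lambda>w. fd (\<lambda>u. fd ss u v) x w
     + (dgam c (ff x) (fd ff x w) (ss x) (fd ff x v) + Gam (fd ss x w) (fd ff x v)
        + Gam (ss x) (fd (\<lambda>u. fd ff u v) x w)))) (at x)"
  unfolding eta_def
  by (intro has_derivative_add derivs gam_has_derivative[where h=ff, OF c GG_in])

text \<open>The covariant derivative, along the line with direction \<open>v\<close>, of
  \<open>\<eta>\<close> applied to the velocity, which is constant in \<open>e\<close>.\<close>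

abbreviation "nabla_eta v \<equiv> fd (\<lambda>u. eta e c u v) x v + Gam (fd ff x v) (eta e c x v)"

text \<open>Tangency of \<open>\<eta>\<close> holds on the whole overlap, so its product with
  \<open>\<xi>\<close> is zero there and may be differentiated. The square arises because the
  covariant derivative of \<open>\<xi>\<close> is again \<open>\<eta>\<close>.\<close>

lemma nabla_eta_xi: "GG (nabla_eta v) (ss x) + GG (eta e c x v) (eta e c x v) = 0"
proof -
  have 0: "gform A g c (ff u) (eta e c u v) (ss u) = 0" if u: "u \<in> overlap e c" for u
  proof -
    obtain z where "eta e c u v = fd ff u z" using eta_tangent[OF u] by blast
    then show ?thesis
      using xi_orthogonal[OF u, of z] gform_sym[OF c point(5)[OF u]] by simp
  qed
  have eq: "fd (\<lambda>u. gform A g c (ff u) (eta e c u v) (ss u)) x v = fd (\<lambda>_. 0::real) x v"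
    by (rule fun_cong[OF fd_cong[OF open_inclusion[OF e c] x 0]])
  have "((\<lambda>u. eta e c u v) has_derivative fd (\<lambda>u. eta e c u v) x) (at x)"
    by (rule fd_works) (use eta_has_derivative in \<open>auto simp: differentiable_def\<close>)
  from fd_eqI[OF gform_has_derivative[where h=ff, OF c GG_in derivs(1) this derivs(2)]] eq
  have "dgform A g c (ff x) (fd ff x v) (eta e c x v) (ss x) + GG (fd (\<lambda>u. eta e c u v) x v) (ss x)
     + GG (eta e c x v) (fd ss x v) = 0"
    by simp
  then show ?thesis
    unfolding metric_compatible[OF c GG_in] gam_sym[OF c GG_in, of _ "ss x"]
    by (simp add: eta_def[of e c x v] linear_add[OF GG1] linear_add[OF GG2] del: comp_apply)
qed

text \<open>This is the Weingarten equation, with \<open>\<eta>\<close> as minus the shape operator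
  of \<open>\<xi>\<close>. The full \<open>accel\<close> can stand for the second fundamental form
  because it is paired with a normal vector.\<close>

lemma eta_accel: "GG (eta e c x v) (fd ff x w) + GG (ss x) (accel A g e c x v w) = 0"
proof -
  have eq: "fd (\<lambda>u. gform A g c (ff u) (ss u) (fd ff u w)) x v = fd (\<lambda>_. 0::real) x v"
    by (rule fun_cong[OF fd_cong[OF open_inclusion[OF e c] x xi_orthogonal]])
  from fd_eqI[OF gform_has_derivative[where h=ff, OF c GG_in derivs(1,2,3)]] eq
  have "dgform A g c (ff x) (fd ff x v) (ss x) (fd ff x w) + GG (fd ss x v) (fd ff x w)
      + GG (ss x) (fd (\<lambda>u. fd ff u w) x v) = 0"
    by simp
  then show ?thesis
    unfolding metric_compatible[OF c GG_in] accel_def eta_def gam_sym[OF c GG_in, of _ "ss x"]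
    by (simp add: linear_add[OF GG1] linear_add[OF GG2] del: comp_apply)
qed

lemma fd_image: "fd (transition (image_chart \<xi> B e) (induced_chart A c)) x z = join (fd ff x z) (fd ss x z)"
  by (simp add: fd_eqI[OF fd_transition_image[OF e c x]])

abbreviation "GS \<equiv> gform (tangent_bundle A) (sasaki_metric A g) (induced_chart A c) (join (ff x) (ss x))"

lemma induced_in:
  "induced_chart A c \<in> tangent_bundle A"
  "join (ff x) (ss x) \<in> snd (induced_chart A c) ` fst (induced_chart A c)"
  using c GG_in unfolding induced_chart_dom[OF c] by (auto simp: tangent_bundle_def)

text \<open>The subtracted vector is tangent to the image; its horizontal part is the derivative of
  the inclusion on \<open>z\<close> and its vertical part is \<open>\<eta>\<close> of
  \<open>z\<close>. Tangency of the acceleration thus becomes vanishing against all \<open>p\<close>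
  and \<open>q\<close>, for some \<open>z\<close>.\<close>

lemma image_acceleration:
  "GS (accel (tangent_bundle A) (sasaki_metric A g) (image_chart \<xi> B e) (induced_chart A c) x v v
      - fd (transition (image_chart \<xi> B e) (induced_chart A c)) x z) (join p (q - Gam (ss x) p))
   = GG (accel A g e c x v v - fd ff x z) p + GG (nabla_eta v - eta e c x z) q
     + GG (eta e c x v) (dgam c (ff x) (fd ff x v) (ss x) p - Gam (Gam (ss x) (fd ff x v)) p
         - dgam c (ff x) p (ss x) (fd ff x v) + Gam (Gam (ss x) p) (fd ff x v))"
proof -
  let ?T = "transition (image_chart \<xi> B e) (induced_chart A c)"
  have "fd (\<lambda>u. fd ?T u v) x = fd (\<lambda>u. join (fd ff u v) (fd ss u v)) x"
    by (rule fd_cong[OF open_inclusion[OF e c] x]) (simp add: fd_eqI[OF fd_transition_image[OF e c]])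
  then have D2: "fd (\<lambda>u. fd ?T u v) x v = join (fd (\<lambda>u. fd ff u v) x v) (fd (\<lambda>u. fd ss u v) x v)"
    using fd_eqI[OF has_derivative_join[OF derivs(3,4)]] by simp
  have z: "GS (join (fd ff x z) (fd ss x z)) (join p (q - Gam (ss x) p)) = GG (fd ff x z) p + GG (eta e c x z) q"
    using sasaki_gform[OF c, of "join (ff x) (ss x)"] GG_in by (simp add: sasaki_form_def eta_def)
  show ?thesis
    unfolding accel_def[of "tangent_bundle A"] D2 transition_image[OF e x] fd_image
      linear_diff[OF TB.linear_gform1[OF induced_in]] z sasaki_acceleration[OF c GG_in]
    by (simp add: accel_def eta_def[of e c x v, symmetric] fd_eqI[OF eta_has_derivative]
        linear_diff[OF GG1] linear_add[OF GG1] del: comp_apply)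
qed

lemma image_accel_imp_accel:
  assumes "accel (tangent_bundle A) (sasaki_metric A g) (image_chart \<xi> B e) (induced_chart A c) x v v
    \<in> range (fd (transition (image_chart \<xi> B e) (induced_chart A c)) x)"
  shows "accel A g e c x v v \<in> range (fd ff x)"
proof -
  obtain z where z: "accel (tangent_bundle A) (sasaki_metric A g) (image_chart \<xi> B e) (induced_chart A c) x v v
    = fd (transition (image_chart \<xi> B e) (induced_chart A c)) x z" using assms by blast
  have 0: "GG (accel A g e c x v v - fd ff x z) p + GG (nabla_eta v - eta e c x z) q
     + GG (eta e c x v) (dgam c (ff x) (fd ff x v) (ss x) p - Gam (Gam (ss x) (fd ff x v)) p
         - dgam c (ff x) p (ss x) (fd ff x v) + Gam (Gam (ss x) p) (fd ff x v)) = 0" for p q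
    using image_acceleration[of v z p q] z linear_0[OF TB.linear_gform1[OF induced_in]] by simp
  have dgam0: "dgam c (ff x) w (ss x) 0 = 0" "dgam c (ff x) 0 (ss x) w = 0" for w
    using linear_0[OF fd_linear[OF gam_differentiable[OF c GG_in]]] by (simp_all add: linear_0[OF linear_gam2] del: comp_apply)
  \<comment> \<open>For \<open>p = 0\<close> the horizontal term and the curvature term drop
    out.\<close>
  have "GG (nabla_eta v - eta e c x z) q = 0" for q
    using 0[of 0 q]
    by (simp add: dgam0 linear_0[OF linear_gam1] linear_0[OF linear_gam2] linear_0[OF GG2] del: comp_apply)
  then have "nabla_eta v - eta e c x z = 0" by (rule gform_self_zero[OF c GG_in])
  then have n: "nabla_eta v = eta e c x z" by simp
  obtain y where "eta e c x z = fd ff x y" using eta_tangent[OF x] by blast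
  then have "GG (nabla_eta v) (ss x) = 0" using n xi_orthogonal[OF x, of y] GG_sym by simp
  then have "GG (eta e c x v) (eta e c x v) = 0" using nabla_eta_xi[of v] by simp
  then have "eta e c x v = 0" by (rule gform_self_zero[OF c GG_in])
  \<comment> \<open>With \<open>q = 0\<close> the vertical term is gone, and the curvature term
    vanishes with \<open>\<eta>\<close>.\<close>
  then have "GG (accel A g e c x v v - fd ff x z) p = 0" for p
    using 0[of p 0] by (simp add: linear_0[OF GG1] linear_0[OF GG2] del: comp_apply)
  then have "accel A g e c x v v - fd ff x z = 0" by (rule gform_self_zero[OF c GG_in])
  then show ?thesis by simp
qed

text \<open>The Weingarten equation is tested in the direction \<open>y\<close> that represents the
  tangent vector \<open>\<eta>\<close> of \<open>v\<close> itself, which yields its square.\<close>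

lemma accel_imp_eta_zero:
  assumes "\<And>v w. accel A g e c x v w \<in> range (fd ff x)"
  shows "eta e c x v = 0"
proof -
  obtain y where y: "eta e c x v = fd ff x y" using eta_tangent[OF x] by blast
  obtain z where "accel A g e c x v y = fd ff x z" using assms by blast
  then have "GG (ss x) (accel A g e c x v y) = 0" using xi_orthogonal[OF x] by simp
  then have "GG (eta e c x v) (eta e c x v) = 0" using eta_accel[of v y] y by simp
  then show ?thesis by (rule gform_self_zero[OF c GG_in])
qed

text \<open>Vanishing of \<open>\<eta>\<close> is required on the whole overlap because
  \<open>nabla_eta\<close> differentiates it. The \<open>z\<close> that represents the acceleration
  in the base then also serves for the image, since \<open>\<eta>\<close> of \<open>z\<close> leaves
  no vertical part.\<close>

lemma accel_imp_image_accel: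
  assumes eta0: "\<And>u v. u \<in> overlap e c \<Longrightarrow> eta e c u v = 0" and "accel A g e c x v v \<in> range (fd ff x)"
  shows "accel (tangent_bundle A) (sasaki_metric A g) (image_chart \<xi> B e) (induced_chart A c) x v v
    \<in> range (fd (transition (image_chart \<xi> B e) (induced_chart A c)) x)"
proof -
  obtain z where z: "accel A g e c x v v = fd ff x z" using assms(2) by blast
  have "fd (\<lambda>u. eta e c u v) x = fd (\<lambda>_. 0) x"
    by (rule fd_cong[OF open_inclusion[OF e c] x eta0])
  then have "nabla_eta v = 0" by (simp add: eta0[OF x] linear_0[OF linear_gam2] del: comp_apply)
  then have 0: "GS (accel (tangent_bundle A) (sasaki_metric A g) (image_chart \<xi> B e) (induced_chart A c) x v v
      - fd (transition (image_chart \<xi> B e) (induced_chart A c)) x z) (join p (q - Gam (ss x) p)) = 0" for p q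
    unfolding image_acceleration by (simp add: z eta0[OF x] linear_0[OF GG1] del: comp_apply)
  \<comment> \<open>Every \<open>w\<close> is of the special form: the correction by
    \<open>Gam\<close> is undone by adding it to the fibre part.\<close>
  have "GS (accel (tangent_bundle A) (sasaki_metric A g) (image_chart \<xi> B e) (induced_chart A c) x v v
      - fd (transition (image_chart \<xi> B e) (induced_chart A c)) x z) w = 0" for w
    using 0[of "lpart w" "rpart w + Gam (ss x) (lpart w)"] by simp
  then have "accel (tangent_bundle A) (sasaki_metric A g) (image_chart \<xi> B e) (induced_chart A c) x v v
      - fd (transition (image_chart \<xi> B e) (induced_chart A c)) x z = 0"
    by (rule TB.gform_self_zero[OF induced_in])
  then show ?thesis by simp
qed

end

end

section \<open>The equivalence, read off in matching charts\<close>

lemma image_charts: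
  assumes "e \<in> charts_at B p" "c \<in> charts_at A p"
  shows "image_chart \<xi> B e \<in> charts_at (image_atlas \<xi> B) (\<xi> p)"
    "induced_chart A c \<in> charts_at (tangent_bundle A) (\<xi> p)"
    "snd (image_chart \<xi> B e) (\<xi> p) = snd e p"
proof -
  have p: "p \<in> pts B" using assms(1) pts_iff by metis
  show "image_chart \<xi> B e \<in> charts_at (image_atlas \<xi> B) (\<xi> p)"
    using assms by (auto simp: charts_at_iff image_atlas_eq image_chart_def)
  show "induced_chart A c \<in> charts_at (tangent_bundle A) (\<xi> p)"
    using assms(2) fst_xi[OF p] xi_tangent[OF p] unfolding charts_at_tangent_bundle by auto
  show "snd (image_chart \<xi> B e) (\<xi> p) = snd e p" by (rule sub.snd_image_chart[OF inj_xi p])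
qed

lemma totally_geodesic_image_iff:
  "totally_geodesic (tangent_bundle A) (sasaki_metric A g) (image_atlas \<xi> B) \<longleftrightarrow> totally_geodesic A g B"
proof
  assume tg: "totally_geodesic (tangent_bundle A) (sasaki_metric A g) (image_atlas \<xi> B)"
  show "totally_geodesic A g B"
  proof (rule accel_imp_totally_geodesic)
    fix p assume p: "p \<in> pts B"
    obtain e c where e: "e \<in> charts_at B p" and c: "c \<in> charts_at A p" using p pts_sub pts_iff by metis
    have ec: "e \<in> B" "c \<in> A" "snd e p \<in> overlap e c" using e c by (auto simp: charts_at_iff)
    have "accel A g e c (snd e p) v v \<in> range (fd (transition e c) (snd e p))" for v
      using I.totally_geodesic_imp_accel[OF tg image_charts(1,2)[OF e c], of v v] image_charts(3)[OF e c]
      by (intro image_accel_imp_accel[OF ec]) simp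
    then show "\<exists>e\<in>charts_at B p. \<exists>c\<in>charts_at A p. \<forall>v.
        accel A g e c (snd e p) v v \<in> range (fd (transition e c) (snd e p))" using e c by blast
  qed
next
  assume tg: "totally_geodesic A g B"
  show "totally_geodesic (tangent_bundle A) (sasaki_metric A g) (image_atlas \<xi> B)"
  proof (rule I.accel_imp_totally_geodesic)
    fix z assume "z \<in> pts (image_atlas \<xi> B)"
    then obtain p where p: "p \<in> pts B" "z = \<xi> p" by (auto simp: pts_image_atlas)
    obtain e c where e: "e \<in> charts_at B p" and c: "c \<in> charts_at A p" using p(1) pts_sub pts_iff by metis
    have ec: "e \<in> B" "c \<in> A" "snd e p \<in> overlap e c" using e c by (auto simp: charts_at_iff)
    \<comment> \<open>The whole overlap is considered, not only the coordinates of \<open>p\<close>,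
      so that \<open>\<eta>\<close> is seen to vanish on an open set.\<close>
    have acc: "accel A g e c u v w \<in> range (fd (transition e c) u)" if u: "u \<in> overlap e c" for u v w
      using totally_geodesic_imp_accel[OF tg point(1,2)[OF ec(1,2) u]] point(3)[OF ec(1,2) u] by simp
    have eta0: "eta e c u v = 0" if u: "u \<in> overlap e c" for u v
      by (rule accel_imp_eta_zero[OF ec(1,2) u acc[OF u]])
    have "accel (tangent_bundle A) (sasaki_metric A g) (image_chart \<xi> B e) (induced_chart A c) (snd e p) v v
        \<in> range (fd (transition (image_chart \<xi> B e) (induced_chart A c)) (snd e p))" for v
      by (rule accel_imp_image_accel[OF ec eta0 acc[OF ec(3)]])
    then show "\<exists>e\<in>charts_at (image_atlas \<xi> B) z. \<exists>c\<in>charts_at (tangent_bundle A) z. \<forall>v.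
      accel (tangent_bundle A) (sasaki_metric A g) e c (snd e z) v v \<in> range (fd (transition e c) (snd e z))"
      using image_charts[OF e c] unfolding p(2) by metis
  qed
qed

end

theorem theorem3p3:
  fixes M :: "('p, 'n::finite) atlas"
    and g :: "('p, 'n) metric"
    and F :: "('p, 'l::finite) atlas"
    and \<xi> :: "'p \<Rightarrow> 'p \<times> ('p, 'n) tvec"
  assumes "riemannian_manifold M g"
    and "submanifold F M"
    and "normal_vector_field M g F \<xi>"
    and "normal_parallel M g F \<xi>"
  shows "totally_geodesic (tangent_bundle M) (sasaki_metric M g) (image_atlas \<xi> F)
         \<longleftrightarrow> totally_geodesic M g F"
proof -
  have M: "smooth_atlas M"
    and sm: "c \<in> M \<Longrightarrow> smooth_on (\<lambda>x. metric_matrix M g c x $ a $ b) (snd c ` fst c)" for c a b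
    using assms(1) by (simp_all add: riemannian_manifold_def smooth_manifold_def)
  have metric: "\<forall>p\<in>pts M. \<forall>u\<in>tangent_space M p. \<forall>v\<in>tangent_space M p.
        g p u v = g p v u \<and>
        (u \<noteq> (\<lambda>_. 0) \<longrightarrow> g p u u > 0) \<and>
        (\<forall>w\<in>tangent_space M p. \<forall>r s.
           g p (\<lambda>c. r *\<^sub>R u c + s *\<^sub>R v c) w = r * g p u w + s * g p v w)"
    using assms(1) by (simp add: riemannian_manifold_def)
  interpret parallel_normal_field M F g \<xi>
  proof
    show "(\<lambda>x. metric_matrix M g c x $ a $ b) differentiable (at x)" if "c \<in> M" "x \<in> snd c ` fst c" for c x a b
      by (rule smooth_on_differentiable[OF sm[OF that(1)] that(2)])
  qed (use M sm metric assms in blast)+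
  show ?thesis by (rule totally_geodesic_image_iff)
qed

end
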